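(* For any $\Pi^0_3$ formula $\phi$ with two free variables (one ranging over $\mathbb{N}^{\mathbb{N}}$, one over $\mathbb{N}$) there is a computable real number $\xi$ such that for every base $r\in M$, $\phi(\xi,r)$ is true if and only if $\xi$ is normal to base $r$.
   Context: A base is an integer $r\geq 2$. Two bases are multiplicatively dependent if one is a rational power of the other; $M$ is the set of minimal elements of the multiplicative-dependence equivalence classes. For a real $x$, $\{x\}$ is its fractional part. For $\vec\xi=(\xi_1,\dots,\xi_N)$ in $[0,1]$, $D(\vec\xi)=\sup_{0\leq u<v\leq 1}\bigl|\#\{n:1\leq n\leq N,\ u\leq \xi_n<v\}/N-(v-u)\bigr|$. A real $\xi$ is normal to base $r$ iff $\lim_{N\to\infty}D(\{r^j\xi\}:0\leq j<N)=0$. A $\Pi^0_3$ formula is one of the form $\forall x\exists y\forall z\,\theta$ with $\theta$ having only bounded number quantifiers, here allowing a free function variable ranging over $\mathbb{N}^{\mathbb{N}}$; the computable real $\xi$ is substituted for this variable via the total computable function $\mathbb{N}\to\mathbb{N}$ that computes it. *)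

theory Defs
  imports Complex_Main "HOL-Library.Nat_Bijection"
begin

datatype recf =
    Zero
  | Succ
  | Proj nat
  | Comp recf "recf list"
  | PrimRec recf recf
  | Mu recf

text \<open>
  Evaluation of partial recursive functions: \<open>evals_to p xs y\<close> says that the program \<open>p\<close>,
  applied to the arguments \<open>xs\<close>, halts with output \<open>y\<close>. The variable of
  recursion or minimization is the first argument. Minimization halts with \<open>n\<close> only if
  all the values below \<open>n\<close> are defined and positive.
\<close>

inductive evals_to :: "recf \<Rightarrow> nat list \<Rightarrow> nat \<Rightarrow> bool" where
  "evals_to Zero xs 0"
| "evals_to Succ (x # xs) (Suc x)"
| "i < length xs \<Longrightarrow> evals_to (Proj i) xs (xs ! i)"
| "list_all2 (\<lambda>g y. evals_to g xs y) gs ys \<Longrightarrow> evals_to p ys z \<Longrightarrow> evals_to (Comp p gs) xs z"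
| "evals_to p xs z \<Longrightarrow> evals_to (PrimRec p q) (0 # xs) z"
| "evals_to (PrimRec p q) (n # xs) y \<Longrightarrow> evals_to q (n # y # xs) z
    \<Longrightarrow> evals_to (PrimRec p q) (Suc n # xs) z"
| "evals_to p (n # xs) 0 \<Longrightarrow> (\<forall>m<n. \<exists>k. evals_to p (m # xs) (Suc k))
    \<Longrightarrow> evals_to (Mu p) xs n"

definition computable_fun :: "(nat \<Rightarrow> nat) \<Rightarrow> bool" where
  "computable_fun f \<longleftrightarrow> (\<exists>p. \<forall>n. evals_to p [n] (f n))"

text \<open>
  The element of Baire space that represents a real number: the (encoded) integer part,
  followed by the binary digits of the fractional part. For dyadic rationals this picks the
  expansion ending in zeros. A real number has a computable representation
  in this sense iff it is computable in any of the usual senses (digits to some base, rational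
  approximations with a computable modulus).
\<close>

definition real_name :: "real \<Rightarrow> nat \<Rightarrow> nat" where
  "real_name \<xi> n =
     (if n = 0 then int_encode \<lfloor>\<xi>\<rfloor> else nat (\<lfloor>2 ^ n * \<xi>\<rfloor> mod 2))"

definition computable_real :: "real \<Rightarrow> bool" where
  "computable_real \<xi> \<longleftrightarrow> computable_fun (real_name \<xi>)"

text \<open>
  Number variables are named by natural numbers; \<open>FunApp\<close> applies the single function
  variable to a term.
\<close>

datatype trm =
    Var nat
  | ZeroT
  | SucT trm
  | Add trm trm
  | Mult trm trm
  | FunApp trm

text \<open>
  \<open>BAll x t \<phi>\<close> and \<open>BEx x t \<phi>\<close> are the bounded quantifiers ranging over \<open>x < t\<close>; the bound
  \<open>t\<close> is outside the scope of the quantified variable.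
\<close>

datatype fm =
    Eq trm trm
  | Less trm trm
  | Neg fm
  | Conj fm fm
  | Disj fm fm
  | BAll nat trm fm
  | BEx nat trm fm
  | UAll nat fm
  | UEx nat fm

primrec trm_val :: "(nat \<Rightarrow> nat) \<Rightarrow> (nat \<Rightarrow> nat) \<Rightarrow> trm \<Rightarrow> nat" where
  "trm_val X e (Var v) = e v"
| "trm_val X e ZeroT = 0"
| "trm_val X e (SucT t) = Suc (trm_val X e t)"
| "trm_val X e (Add s t) = trm_val X e s + trm_val X e t"
| "trm_val X e (Mult s t) = trm_val X e s * trm_val X e t"
| "trm_val X e (FunApp t) = X (trm_val X e t)"

primrec sat :: "(nat \<Rightarrow> nat) \<Rightarrow> (nat \<Rightarrow> nat) \<Rightarrow> fm \<Rightarrow> bool" where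
  "sat X e (Eq s t) \<longleftrightarrow> trm_val X e s = trm_val X e t"
| "sat X e (Less s t) \<longleftrightarrow> trm_val X e s < trm_val X e t"
| "sat X e (Neg \<phi>) \<longleftrightarrow> \<not> sat X e \<phi>"
| "sat X e (Conj \<phi> \<psi>) \<longleftrightarrow> sat X e \<phi> \<and> sat X e \<psi>"
| "sat X e (Disj \<phi> \<psi>) \<longleftrightarrow> sat X e \<phi> \<or> sat X e \<psi>"
| "sat X e (BAll v t \<phi>) \<longleftrightarrow> (\<forall>k < trm_val X e t. sat X (e(v := k)) \<phi>)"
| "sat X e (BEx v t \<phi>) \<longleftrightarrow> (\<exists>k < trm_val X e t. sat X (e(v := k)) \<phi>)"
| "sat X e (UAll v \<phi>) \<longleftrightarrow> (\<forall>k. sat X (e(v := k)) \<phi>)"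
| "sat X e (UEx v \<phi>) \<longleftrightarrow> (\<exists>k. sat X (e(v := k)) \<phi>)"

primrec trm_vars :: "trm \<Rightarrow> nat set" where
  "trm_vars (Var v) = {v}"
| "trm_vars ZeroT = {}"
| "trm_vars (SucT t) = trm_vars t"
| "trm_vars (Add s t) = trm_vars s \<union> trm_vars t"
| "trm_vars (Mult s t) = trm_vars s \<union> trm_vars t"
| "trm_vars (FunApp t) = trm_vars t"

primrec free_vars :: "fm \<Rightarrow> nat set" where
  "free_vars (Eq s t) = trm_vars s \<union> trm_vars t"
| "free_vars (Less s t) = trm_vars s \<union> trm_vars t"
| "free_vars (Neg \<phi>) = free_vars \<phi>"
| "free_vars (Conj \<phi> \<psi>) = free_vars \<phi> \<union> free_vars \<psi>"
| "free_vars (Disj \<phi> \<psi>) = free_vars \<phi> \<union> free_vars \<psi>"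
| "free_vars (BAll v t \<phi>) = trm_vars t \<union> (free_vars \<phi> - {v})"
| "free_vars (BEx v t \<phi>) = trm_vars t \<union> (free_vars \<phi> - {v})"
| "free_vars (UAll v \<phi>) = free_vars \<phi> - {v}"
| "free_vars (UEx v \<phi>) = free_vars \<phi> - {v}"

primrec bounded_fm :: "fm \<Rightarrow> bool" where
  "bounded_fm (Eq s t) \<longleftrightarrow> True"
| "bounded_fm (Less s t) \<longleftrightarrow> True"
| "bounded_fm (Neg \<phi>) \<longleftrightarrow> bounded_fm \<phi>"
| "bounded_fm (Conj \<phi> \<psi>) \<longleftrightarrow> bounded_fm \<phi> \<and> bounded_fm \<psi>"
| "bounded_fm (Disj \<phi> \<psi>) \<longleftrightarrow> bounded_fm \<phi> \<and> bounded_fm \<psi>"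
| "bounded_fm (BAll v t \<phi>) \<longleftrightarrow> bounded_fm \<phi>"
| "bounded_fm (BEx v t \<phi>) \<longleftrightarrow> bounded_fm \<phi>"
| "bounded_fm (UAll v \<phi>) \<longleftrightarrow> False"
| "bounded_fm (UEx v \<phi>) \<longleftrightarrow> False"

definition Pi03 :: "fm \<Rightarrow> bool" where
  "Pi03 \<phi> \<longleftrightarrow> (\<exists>x y z \<theta>. \<phi> = UAll x (UEx y (UAll z \<theta>)) \<and> bounded_fm \<theta>)"

definition mult_dependent :: "nat \<Rightarrow> nat \<Rightarrow> bool" where
  "mult_dependent r s \<longleftrightarrow>
     (\<exists>q \<in> \<rat>. real r = real s powr q \<or> real s = real r powr q)"

definition minimal_bases :: "nat set" where
  "minimal_bases = {r. 2 \<le> r \<and> (\<forall>s\<ge>2. mult_dependent s r \<longrightarrow> r \<le> s)}"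

text \<open>The points are indexed from 0, as in \<open>{r\<^sup>j \<xi>}\<close> with \<open>0 \<le> j < N\<close>.\<close>

definition discrepancy :: "(nat \<Rightarrow> real) \<Rightarrow> nat \<Rightarrow> real" where
  "discrepancy x N =
     (SUP (u, v) \<in> {(u, v). 0 \<le> u \<and> u < v \<and> v \<le> 1}.
        \<bar>real (card {n. n < N \<and> u \<le> x n \<and> x n < v}) / real N - (v - u)\<bar>)"

definition normal_to_base :: "nat \<Rightarrow> real \<Rightarrow> bool" where
  "normal_to_base r \<xi> \<longleftrightarrow> (\<lambda>N. discrepancy (\<lambda>j. frac (real r ^ j * \<xi>)) N) \<longlonglongrightarrow> 0"

end

theory Submission
  imports Defs "HOL-Analysis.Analysis"
begin

text \<open>
  The number is built by nested dyadic intervals. Prolonging an interval by a long block of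
  random digits to a base \<open>s\<close>, with the digit 0 slightly favoured by an amount \<open>\<epsilon>\<close>, makes the
  frequency of 0 to base \<open>s\<close> deviate by about \<open>\<epsilon>\<close>, makes the digits to base \<open>s\<close> no worse than
  that, and makes the digits to every multiplicatively independent base \<open>r\<close> nearly
  equidistributed. The last point is a second moment bound for Weyl sums: the Fourier transform
  of the digit law at \<open>h (r ^ i - r ^ j)\<close> is bounded by a Riesz product at \<open>s\<close> to the power
  of the fractional part of \<open>i log r / log s + \<beta>\<close>; the quotient of the logarithms is irrational,
  so these points are equidistributed, and by the Parseval identity long Riesz products are
  small on average.

  Whether a prolongation is good can be decided by counting, so good prolongations can be
  found by search. The failure of \<open>\<forall>x. \<exists>y. \<forall>z. \<theta>\<close> at \<open>r\<close> means that for some \<open>x\<close> counterexamples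
  \<open>z\<close> turn up for all \<open>y\<close>. Whenever counterexamples for one more \<open>y\<close> have been confirmed on the
  known digits, base \<open>r\<close> is biased by an amount that depends only on \<open>x\<close> and tends to 0 with
  \<open>x\<close>, for so long that all earlier digits become negligible. If the formula fails at \<open>r\<close>, then
  the same bias recurs infinitely often; if it holds, then each bias occurs only finitely often.
\<close>

section \<open>Fejer kernels and Weyl sums\<close>

text \<open>The formula speaks about the very number that is being built. This circle is broken
  because a bounded formula inspects the digits only up to a polynomial bound: a task is started
  only when all digits that can matter for it are fixed, so what the search reads off the current
  approximation is already the final truth. The other obstacle is that the equidistribution
  arguments give no usable bound for the precision from which good blocks exist. The search
  therefore never waits: it takes the best block available at each step, and an interrupted task is
  resumed as a fresh run. Each block is subject to two opposite conditions. It must be long enough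
  to outweigh the positions at its ends, where the points are only roughly known, and short compared
  with the past, so that an unfinished block does not affect the discrepancy. For normality, upper
  bounds for the counts are enough, since the counts of complementary intervals add up to the
  total.\<close>

definition unit_exp :: "real \<Rightarrow> complex" where
  "unit_exp x = cis (2 * pi * x)"

lemma unit_exp_add: "unit_exp (x + y) = unit_exp x * unit_exp y"
  by (simp add: unit_exp_def cis_mult distrib_left)

lemma unit_exp_0 [simp]: "unit_exp 0 = 1"
  by (simp add: unit_exp_def)

lemma norm_unit_exp [simp]: "norm (unit_exp x) = 1"
  by (simp add: unit_exp_def)

lemma cnj_unit_exp: "cnj (unit_exp x) = unit_exp (- x)"
  by (simp add: unit_exp_def cis_cnj)

lemma unit_exp_power: "unit_exp (real n * x) = unit_exp x ^ n"
  using Complex.DeMoivre[of "2 * pi * x" n] by (simp add: unit_exp_def mult.left_commute)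

lemma unit_exp_of_int [simp]: "unit_exp (of_int k) = 1"
  by (simp add: unit_exp_def cis_multiple_2pi)

lemma unit_exp_add_of_int [simp]: "unit_exp (x + of_int k) = unit_exp x"
  by (simp add: unit_exp_add)

lemma norm_unit_exp_minus_1: "norm (unit_exp x - 1) = 2 * \<bar>sin (pi * x)\<bar>"
  using dist_exp_i_1[of "2 * pi * x"] by (simp add: unit_exp_def cis_conv_exp mult.commute)

lemma unit_exp_eq_1_iff: "unit_exp x = 1 \<longleftrightarrow> x \<in> \<int>"
proof
  assume "unit_exp x = 1"
  then have "sin (pi * x) = 0"
    using norm_unit_exp_minus_1[of x] by simp
  then obtain i :: int where "pi * x = of_int i * pi"
    by (auto simp: sin_zero_iff_int2)
  then show "x \<in> \<int>" by auto
next
  assume "x \<in> \<int>"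
  then show "unit_exp x = 1" by (auto elim!: Ints_cases)
qed

lemma norm_unit_exp_diff_le: "norm (unit_exp x - unit_exp y) \<le> 2 * pi * \<bar>x - y\<bar>"
proof -
  have "unit_exp x - unit_exp y = unit_exp y * (unit_exp (x - y) - 1)"
    using unit_exp_add[of y "x - y"] by (simp add: algebra_simps)
  then have "norm (unit_exp x - unit_exp y) = 2 * \<bar>sin (pi * (x - y))\<bar>"
    by (simp add: norm_mult norm_unit_exp_minus_1)
  also have "\<dots> \<le> 2 * \<bar>pi * (x - y)\<bar>"
    using abs_sin_x_le_abs_x[of "pi * (x - y)"] by linarith
  finally show ?thesis by (simp add: abs_mult)
qed

lemma unit_exp_geometric:
  "(\<Sum>h<n. unit_exp (real h * x)) * (unit_exp x - 1) = unit_exp (real n * x) - 1"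
  by (simp add: unit_exp_power power_diff_1_eq)

lemma sum_unit_exp_root:
  assumes "M > 0" and "\<not> int M dvd k"
  shows "(\<Sum>l<M. unit_exp (of_int k * real l / real M)) = 0"
proof -
  have "of_int k / real M \<notin> \<int>"
  proof
    assume "of_int k / real M \<in> \<int>"
    then obtain i where "of_int k / real M = of_int i" by (auto elim: Ints_cases)
    then have "real_of_int k = of_int (i * int M)" using assms(1) by (simp add: field_simps)
    then have "k = i * int M" by (simp only: of_int_eq_iff)
    then show False using assms(2) by simp
  qed
  then have "unit_exp (of_int k / real M) \<noteq> 1" by (simp add: unit_exp_eq_1_iff)
  moreover have "(\<Sum>l<M. unit_exp (of_int k * real l / real M)) * (unit_exp (of_int k / real M) - 1)
      = unit_exp (real M * (of_int k / real M)) - 1"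
    using unit_exp_geometric[where n = M and x = "of_int k / real M"] by (simp add: mult_ac)
  ultimately show ?thesis using assms(1) by simp
qed

text \<open>Concavity of the sine gives the chord bound \<open>sin (pi * t) \<ge> 2 * t\<close> on
  [0, 1/2]. Keeping \<open>\<bar>y\<bar>\<close> away from 1 as well as from 0 expresses that y has
  distance at least d from the integers.\<close>

lemma norm_unit_exp_minus_1_ge:
  assumes "0 \<le> d" "d \<le> \<bar>y\<bar>" "\<bar>y\<bar> \<le> 1 - d"
  shows "norm (unit_exp y - 1) \<ge> 4 * d"
proof -
  have sin_ge: "2 * t \<le> sin (pi * t)" if "0 \<le> t" "t \<le> 1/2" for t :: real
  proof -
    have "convex_on {0..pi} (\<lambda>x::real. - sin x)"
      by (rule f''_ge0_imp_convex[where f' = "\<lambda>x. - cos x" and f'' = sin])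
        (auto intro!: derivative_eq_intros sin_ge_zero)
    from convex_onD[OF this, of "2 * t" 0 "pi / 2"] that
    show ?thesis by (simp add: mult_ac)
  qed
  define z where "z = \<bar>y\<bar>"
  have "\<bar>sin (pi * y)\<bar> = \<bar>sin (pi * z)\<bar>"
    by (simp add: z_def abs_if)
  also have "\<dots> \<ge> 2 * d"
  proof (cases "z \<le> 1/2")
    case True
    then show ?thesis using sin_ge[of z] assms by (simp add: z_def)
  next
    case False
    have "sin (pi * z) = sin (pi * (1 - z))" by (simp add: right_diff_distrib sin_diff)
    then show ?thesis using sin_ge[of "1 - z"] False assms by (simp add: z_def)
  qed
  finally show ?thesis by (simp add: norm_unit_exp_minus_1)
qed

text \<open>This kernel is nonnegative, has mean 1 and contains only frequencies below
  \<open>K\<close> in modulus. It can thus majorize indicator functions, while its sums over a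
  sequence are controlled by finitely many Weyl sums.\<close>

definition fejer :: "nat \<Rightarrow> real \<Rightarrow> real" where
  "fejer K y = (norm (\<Sum>h<K. unit_exp (real h * y)))\<^sup>2 / real K"

lemma norm_sum_squared:
  fixes f :: "'a \<Rightarrow> complex"
  shows "complex_of_real ((norm (\<Sum>i\<in>I. f i))\<^sup>2) = (\<Sum>i\<in>I. \<Sum>j\<in>I. f i * cnj (f j))"
  unfolding complex_norm_square cnj_sum sum_product ..

lemma norm_sum_unit_exp_squared:
  "(norm (\<Sum>i\<in>I. unit_exp (x i)))\<^sup>2 = (\<Sum>i\<in>I. \<Sum>j\<in>I. Re (unit_exp (x i - x j)))"
proof -
  have "complex_of_real ((norm (\<Sum>i\<in>I. unit_exp (x i)))\<^sup>2)
      = (\<Sum>i\<in>I. \<Sum>j\<in>I. unit_exp (x i - x j))"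
    unfolding norm_sum_squared by (simp add: cnj_unit_exp flip: unit_exp_add)
  then have "Re (complex_of_real ((norm (\<Sum>i\<in>I. unit_exp (x i)))\<^sup>2))
      = (\<Sum>i\<in>I. \<Sum>j\<in>I. Re (unit_exp (x i - x j)))"
    by simp
  then show ?thesis by simp
qed

lemma fejer_nonneg: "fejer K y \<ge> 0"
  by (simp add: fejer_def)

lemma fejer_le:
  assumes "d > 0" "d \<le> \<bar>y\<bar>" "\<bar>y\<bar> \<le> 1 - d" "K > 0"
  shows "fejer K y \<le> 1 / (4 * real K * d\<^sup>2)"
proof -
  let ?S = "\<Sum>h<K. unit_exp (real h * y)"
  have ge: "norm (unit_exp y - 1) \<ge> 4 * d"
    using norm_unit_exp_minus_1_ge assms by simp
  have "norm ?S * norm (unit_exp y - 1) = norm (unit_exp (real K * y) - 1)"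
    by (simp flip: norm_mult add: unit_exp_geometric)
  also have "\<dots> \<le> 2"
    using norm_triangle_ineq4[of "unit_exp (real K * y)" 1] by simp
  finally have "norm ?S * norm (unit_exp y - 1) \<le> 2" .
  moreover have "norm ?S * (4 * d) \<le> norm ?S * norm (unit_exp y - 1)"
    using ge by (intro mult_left_mono) auto
  ultimately have "norm ?S \<le> 1 / (2 * d)" using assms by (simp add: field_simps)
  then have "(norm ?S)\<^sup>2 \<le> (1 / (2 * d))\<^sup>2" by (intro power_mono) auto
  then show ?thesis using assms by (simp add: fejer_def field_simps power2_eq_square)
qed

lemma fejer_expand:
  "real K * fejer K y = (\<Sum>a<K. \<Sum>b<K. Re (unit_exp (real_of_int (int a - int b) * y)))"
  by (simp add: fejer_def norm_sum_unit_exp_squared left_diff_distrib)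

text \<open>Averaging over M equally spaced points annihilates every frequency that is not a
  multiple of M. The frequencies a - b are smaller than K \<le> M in modulus, so only the diagonal
  remains, and the discrete average replaces the integral without error.\<close>

lemma sum_fejer_grid:
  assumes "0 < K" "K \<le> M"
  shows "(\<Sum>l<M. fejer K (y - real l / real M)) = real M"
proof -
  have grid: "(\<Sum>l<M. Re (unit_exp (real_of_int (int a - int b) * (y - real l / real M))))
      = (if a = b then real M else 0)" if "a < K" "b < K" for a b
  proof (cases "a = b")
    case False
    have "\<not> int M dvd (int b - int a)"
    proof
      assume "int M dvd int b - int a"
      then have "\<bar>int M\<bar> \<le> \<bar>int b - int a\<bar>" using False by (intro dvd_imp_le_int) auto
      then show False using that assms by linarith
    qed
    then have "(\<Sum>l<M. unit_exp (of_int (int b - int a) * real l / real M)) = 0"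
      using assms by (intro sum_unit_exp_root) auto
    moreover have "(\<Sum>l<M. unit_exp (real_of_int (int a - int b) * (y - real l / real M)))
       = unit_exp (real_of_int (int a - int b) * y) * (\<Sum>l<M. unit_exp (of_int (int b - int a) * real l / real M))"
      by (simp add: sum_distrib_left flip: unit_exp_add) (intro sum.cong, auto simp: algebra_simps diff_divide_distrib)
    ultimately have "Re (\<Sum>l<M. unit_exp (real_of_int (int a - int b) * (y - real l / real M))) = 0"
      by simp
    then show ?thesis using False by simp
  qed simp
  have "real K * (\<Sum>l<M. fejer K (y - real l / real M))
      = (\<Sum>l<M. \<Sum>a<K. \<Sum>b<K. Re (unit_exp (real_of_int (int a - int b) * (y - real l / real M))))"
    by (simp add: sum_distrib_left fejer_expand)
  also have "\<dots> = (\<Sum>a<K. \<Sum>b<K. \<Sum>l<M. Re (unit_exp (real_of_int (int a - int b) * (y - real l / real M))))"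
    by (subst sum.swap) (intro sum.cong refl sum.swap)
  also have "\<dots> = (\<Sum>a<K. \<Sum>b<K. if a = b then real M else 0)"
    by (intro sum.cong refl) (simp add: grid del: of_int_diff)
  also have "\<dots> = real K * real M" by simp
  finally show ?thesis using assms by simp
qed

text \<open>The diagonal gives the main term; each of the at most K^2 other pairs costs \<delta>
  times the number of points, and division by K leaves K * \<delta>. The shift \<theta> only
  contributes unimodular factors, and negative frequencies are conjugates of positive ones.\<close>

lemma sum_fejer_le:
  fixes \<delta> :: real and x :: "'a \<Rightarrow> real"
  assumes "finite J" and "K > 0" and "\<delta> \<ge> 0"
    and weyl: "\<And>h. \<lbrakk>1 \<le> h; h < K\<rbrakk> \<Longrightarrow> norm (\<Sum>j\<in>J. unit_exp (real h * x j)) \<le> \<delta> * card J"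
  shows "(\<Sum>j\<in>J. fejer K (x j - \<theta>)) \<le> card J * (1 + real K * \<delta>)"
proof -
  let ?N = "real (card J)"
  have weyl': "norm (\<Sum>j\<in>J. unit_exp (real_of_int h * x j)) \<le> \<delta> * ?N"
    if "h \<noteq> 0" "\<bar>h\<bar> < int K" for h
  proof -
    have "norm (\<Sum>j\<in>J. unit_exp (real_of_int h * x j))
        = norm (\<Sum>j\<in>J. unit_exp (real (nat \<bar>h\<bar>) * x j))"
    proof (cases "h \<ge> 0")
      case False
      then have "(\<Sum>j\<in>J. unit_exp (real_of_int h * x j)) = cnj (\<Sum>j\<in>J. unit_exp (real (nat \<bar>h\<bar>) * x j))"
        by (simp add: cnj_unit_exp)
      then show ?thesis by (metis complex_mod_cnj)
    qed simp
    also have "\<dots> \<le> \<delta> * ?N" using that by (intro weyl) auto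
    finally show ?thesis .
  qed
  have pair: "(\<Sum>j\<in>J. Re (unit_exp (real_of_int (int a - int b) * (x j - \<theta>))))
      \<le> (if a = b then ?N else 0) + \<delta> * ?N" if "a < K" "b < K" for a b
  proof (cases "a = b")
    case True
    then show ?thesis using assms by simp
  next
    case False
    have "(\<Sum>j\<in>J. unit_exp (real_of_int (int a - int b) * (x j - \<theta>)))
       = unit_exp (- real_of_int (int a - int b) * \<theta>) * (\<Sum>j\<in>J. unit_exp (real_of_int (int a - int b) * x j))"
      by (simp add: sum_distrib_left flip: unit_exp_add) (simp add: algebra_simps)
    then have "norm (\<Sum>j\<in>J. unit_exp (real_of_int (int a - int b) * (x j - \<theta>)))
       = norm (\<Sum>j\<in>J. unit_exp (real_of_int (int a - int b) * x j))"
      by (simp add: norm_mult)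
    also have "\<dots> \<le> \<delta> * ?N" using False that by (intro weyl') auto
    finally show ?thesis using False complex_Re_le_cmod[of "(\<Sum>j\<in>J. unit_exp (real_of_int (int a - int b) * (x j - \<theta>)))"]
      by simp
  qed
  have "real K * (\<Sum>j\<in>J. fejer K (x j - \<theta>))
     = (\<Sum>j\<in>J. \<Sum>a<K. \<Sum>b<K. Re (unit_exp (real_of_int (int a - int b) * (x j - \<theta>))))"
    by (simp add: sum_distrib_left fejer_expand)
  also have "\<dots> = (\<Sum>a<K. \<Sum>b<K. \<Sum>j\<in>J. Re (unit_exp (real_of_int (int a - int b) * (x j - \<theta>))))"
    by (subst sum.swap) (intro sum.cong refl sum.swap)
  also have "\<dots> \<le> (\<Sum>a<K. \<Sum>b<K. (if a = b then ?N else 0) + \<delta> * ?N)"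
    by (intro sum_mono) (use pair in auto)
  also have "\<dots> = real K * (?N * (1 + real K * \<delta>))"
    by (simp add: sum.distrib algebra_simps)
  finally show ?thesis using assms by simp
qed

lemma unit_exp_mult_frac: "unit_exp (real h * frac y) = unit_exp (real h * y)"
proof -
  have "real h * frac y = real h * y + of_int (- (int h * \<lfloor>y\<rfloor>))"
    by (simp add: frac_def right_diff_distrib)
  then show ?thesis using unit_exp_add_of_int by metis
qed
lemma power5_eq: "x ^ 5 = x * x ^ 4" for x :: "'a::monoid_mult"
  using power_Suc[of x 4] by simp

text \<open>Degree of the kernel and number M of grid points at resolution m. A margin of 1/(16 m^2)
  around a cell leaves a kernel tail of 64 m^4 / M, and this should be 1/(16 m); hence the fifth
  power.\<close>

definition weyl_order :: "nat \<Rightarrow> nat" where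
  "weyl_order m = 1024 * m ^ 5"

text \<open>Tolerance times order is 1/(32 m), the error that \<open>sum_fejer_le\<close> may
  contribute.\<close>

definition weyl_tol :: "nat \<Rightarrow> real" where
  "weyl_tol m = 1 / (32 * real m * real (weyl_order m))"

text \<open>
  The indicator function of a cell is dominated, up to the factor \<open>1 - 1 / (16 m)\<close>, by an
  average of translates of the Fejer kernel over a slightly larger window of a fine grid.
\<close>

lemma weyl_cell_count:
  fixes x :: "'a \<Rightarrow> real" and m c :: nat
  assumes "finite J" and "m \<ge> 1" and "c < m"
    and weyl: "\<And>h. \<lbrakk>1 \<le> h; h < weyl_order m\<rbrakk> \<Longrightarrow>
      norm (\<Sum>j\<in>J. unit_exp (real h * x j)) \<le> weyl_tol m * card J"
  shows "real (card {j\<in>J. \<lfloor>real m * frac (x j)\<rfloor> = int c}) \<le> card J * (1 / m + 1 / (2 * (real m)\<^sup>2))"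
proof -
  define M where "M = weyl_order m"
  define u where "u = 1024 * m ^ 4"
  define D where "D = 64 * m ^ 3"
  define d where "d = 1 / (16 * (real m)\<^sup>2)"
  define C where "C = {j\<in>J. \<lfloor>real m * frac (x j)\<rfloor> = int c}"
  let ?N = "real (card J)"
  have M_pos: "M > 0" using assms by (simp add: M_def weyl_order_def)
  have M_eq: "M = m * u" by (simp add: M_def weyl_order_def u_def power5_eq)
  have d_eq: "d = real D / real M" using assms
    by (simp add: d_def D_def M_def weyl_order_def field_simps power5_eq power4_eq_xxxx power3_eq_cube power2_eq_square)
  have d_pos: "d > 0" using assms by (simp add: d_def)
  \<comment> \<open>The cell fills u grid steps, and D more points on either side form the margin d.
    The window can leave the range from 0 to M, so \<open>A\<close> takes its points modulo
    M.\<close>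
  define W where "W = {int (c * u) - int D .. int ((c + 1) * u) + int D}"
  define A where "A = {l. l < M \<and> (\<exists>i\<in>W. int l = i mod int M)}"
  have "A \<subseteq> (\<lambda>i. nat (i mod int M)) ` W" by (force simp: A_def)
  then have "card A \<le> card ((\<lambda>i. nat (i mod int M)) ` W)"
    by (rule card_mono[rotated]) (simp add: W_def)
  also have "\<dots> \<le> card W" by (rule card_image_le) (simp add: W_def)
  also have "card W = u + 2 * D + 1" by (simp add: W_def algebra_simps)
  finally have card_A: "card A \<le> u + 2 * D + 1" .
  have A_sub: "A \<subseteq> {..<M}" and fin_A: "finite A" by (auto simp: A_def)
  have cu: "(c + 1) * u \<le> M" unfolding M_eq using assms by (intro mult_right_mono) auto
  have far: "fejer M (frac (x j) - real l / real M) \<le> 1 / (4 * real M * d\<^sup>2)"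
    if "j \<in> C" "l < M" "l \<notin> A" for j l
  proof -
    define y where "y = frac (x j)"
    have "real c \<le> real m * y" "real m * y < real c + 1"
      using that by (auto simp: C_def y_def floor_eq_iff)
    then have "real c * real u \<le> real m * y * real u" "real m * y * real u \<le> (real c + 1) * real u"
      by (intro mult_right_mono; simp)+
    then have y: "real (c * u) \<le> real M * y" "real M * y \<le> real ((c + 1) * u)"
      unfolding M_eq by (simp_all add: algebra_simps)
    define lo where "lo = int (c * u) - int D"
    define hi where "hi = int ((c + 1) * u) + int D"
    have W_eq: "W = {lo..hi}" by (simp add: W_def lo_def hi_def)
    have "c * u \<le> M" using cu by simp
    then have lo_le: "lo \<le> int M" unfolding lo_def by linarith
    have hi_ge: "0 \<le> hi" unfolding hi_def by linarith
    have "int l \<notin> W" using that by (auto simp: A_def)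
    moreover have "int l + int M \<notin> W" "int l - int M \<notin> W" using that by (auto simp: A_def)
    ultimately have "(int l < lo \<and> int l + int M > hi) \<or> (int l > hi \<and> int l - int M < lo)"
      unfolding W_eq atLeastAtMost_iff using that(2) lo_le hi_ge by linarith
    then consider "int l < lo" "int l + int M > hi" | "int l > hi" "int l - int M < lo"
      by blast
    then have "real D \<le> \<bar>real M * y - real l\<bar> \<and> \<bar>real M * y - real l\<bar> \<le> real M - real D"
    proof cases
      case 1
      then have "real l < real (c * u) - real D" "real l + real M > real ((c + 1) * u) + real D"
        unfolding lo_def hi_def by linarith+
      then show ?thesis using y by linarith
    next
      case 2
      then have "real l > real ((c + 1) * u) + real D" "real l - real M < real (c * u) - real D"
        unfolding lo_def hi_def by linarith+
      then show ?thesis using y by linarith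
    qed
    moreover have "y - real l / real M = (real M * y - real l) / real M"
      using M_pos by (simp add: diff_divide_distrib)
    then have "\<bar>y - real l / real M\<bar> = \<bar>real M * y - real l\<bar> / real M"
      by (simp add: abs_divide)
    moreover have "(real M - real D) / real M = 1 - d"
      using M_pos by (simp add: d_eq diff_divide_distrib)
    ultimately have "d \<le> \<bar>y - real l / real M\<bar>" "\<bar>y - real l / real M\<bar> \<le> 1 - d"
      using M_pos divide_right_mono[of _ _ "real M"] by (metis d_eq of_nat_0_le_iff)+
    then show ?thesis using fejer_le[OF d_pos _ _ M_pos] by (simp add: y_def)
  qed
  have near: "real M * (1 - 1 / (4 * real M * d\<^sup>2)) \<le> (\<Sum>l\<in>A. fejer M (frac (x j) - real l / real M))"
    if "j \<in> C" for j
  proof -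
    have "real M = (\<Sum>l<M. fejer M (frac (x j) - real l / real M))"
      using sum_fejer_grid[of M M] M_pos by simp
    also have "\<dots> = (\<Sum>l\<in>{..<M} - A. fejer M (frac (x j) - real l / real M))
        + (\<Sum>l\<in>A. fejer M (frac (x j) - real l / real M))"
      by (rule sum.subset_diff[OF A_sub]) auto
    also have "(\<Sum>l\<in>{..<M} - A. fejer M (frac (x j) - real l / real M))
        \<le> (\<Sum>l\<in>{..<M} - A. 1 / (4 * real M * d\<^sup>2))"
      by (intro sum_mono far) (use that in auto)
    also have "\<dots> \<le> real M * (1 / (4 * real M * d\<^sup>2))"
    proof -
      have "card ({..<M} - A) \<le> M" using card_mono[of "{..<M}" "{..<M} - A"] by simp
      then have "real (card ({..<M} - A)) * (1 / (4 * real M * d\<^sup>2)) \<le> real M * (1 / (4 * real M * d\<^sup>2))"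
        by (intro mult_right_mono) auto
      then show ?thesis by simp
    qed
    finally show ?thesis by (simp add: right_diff_distrib)
  qed
  have "real (card C) * (real M * (1 - 1 / (4 * real M * d\<^sup>2)))
     = (\<Sum>j\<in>C. real M * (1 - 1 / (4 * real M * d\<^sup>2)))" by simp
  also have "\<dots> \<le> (\<Sum>j\<in>C. \<Sum>l\<in>A. fejer M (frac (x j) - real l / real M))"
    by (intro sum_mono near)
  also have "\<dots> \<le> (\<Sum>j\<in>J. \<Sum>l\<in>A. fejer M (frac (x j) - real l / real M))"
    using assms by (intro sum_mono2) (auto simp: C_def fejer_nonneg sum_nonneg)
  also have "\<dots> = (\<Sum>l\<in>A. \<Sum>j\<in>J. fejer M (frac (x j) - real l / real M))"
    by (rule sum.swap)
  also have "\<dots> \<le> (\<Sum>l\<in>A. ?N * (1 + real M * weyl_tol m))"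
    using assms M_pos
    by (intro sum_mono sum_fejer_le) (auto simp: unit_exp_mult_frac M_def weyl_tol_def)
  also have "\<dots> \<le> (real u + 2 * real D + 1) * (?N * (1 + real M * weyl_tol m))"
    using card_A by (simp, intro mult_right_mono) (auto simp: weyl_tol_def)
  also have "real M * weyl_tol m = 1 / (32 * m)"
    using M_pos by (simp add: weyl_tol_def M_def field_simps)
  also have "1 / (4 * real M * d\<^sup>2) = 1 / (16 * m)"
    using assms by (simp add: d_def M_def weyl_order_def field_simps power5_eq power4_eq_xxxx power3_eq_cube power2_eq_square)
  finally have le: "real (card C) * (real M * (1 - 1 / (16 * m)))
      \<le> (real u + 2 * real D + 1) * (?N * (1 + 1 / (32 * m)))" .
  \<comment> \<open>In t = 1 / m the comparison becomes polynomial: the window has relative width at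
    most t + 5 t^2 / 32, where 2/16 stems from the two margins and 1/32 from the additional end
    point. The surplus t^2 / 2 absorbs this, the tail and the Weyl error.\<close>
  define t where "t = 1 / real m"
  have t: "0 < t" "t \<le> 1" using assms by (simp_all add: t_def)
  have "1 / real M \<le> t\<^sup>2 / 32"
  proof -
    have "32 * real m ^ 2 \<le> 1024 * real m ^ 5"
      using assms by (intro mult_mono power_increasing) auto
    then have "32 * real m ^ 2 \<le> real M" by (simp add: M_def weyl_order_def)
    then show ?thesis using assms M_pos by (simp add: t_def field_simps)
  qed
  moreover have "real u / real M = t"
    using M_pos by (simp add: M_eq t_def)
  moreover have "d = t\<^sup>2 / 16" by (simp add: d_def t_def power_divide)
  then have "2 * real D / real M = 2 * (t\<^sup>2 / 16)" unfolding d_eq by (simp add: mult_ac)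
  ultimately have "(real u + 2 * real D + 1) / real M \<le> t + 2 * (t\<^sup>2 / 16) + t\<^sup>2 / 32"
    unfolding add_divide_distrib by linarith
  then have "real u + 2 * real D + 1 \<le> real M * (t + 5 * t\<^sup>2 / 32)"
    using M_pos by (simp add: field_simps)
  then have "(real u + 2 * real D + 1) * (?N * (1 + 1 / (32 * m)))
      \<le> real M * (t + 5 * t\<^sup>2 / 32) * (?N * (1 + 1 / (32 * m)))"
    by (intro mult_right_mono) auto
  moreover have "1 / real (16 * m) = t / 16" "1 / real (32 * m) = t / 32" by (simp_all add: t_def)
  ultimately have "real (card C) * (real M * (1 - t / 16)) \<le> real M * (t + 5 * t\<^sup>2 / 32) * (?N * (1 + t / 32))"
    using le by (simp only:)
  then have "real M * (real (card C) * (1 - t / 16)) \<le> real M * (?N * ((t + 5 * t\<^sup>2 / 32) * (1 + t / 32)))"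
    by (simp add: mult_ac)
  then have "real (card C) * (1 - t / 16) \<le> ?N * ((t + 5 * t\<^sup>2 / 32) * (1 + t / 32))"
    using M_pos by (simp add: mult_le_cancel_left)
  also have "\<dots> \<le> ?N * ((t + t\<^sup>2 / 2) * (1 - t / 16))"
  proof (intro mult_left_mono)
    have "t ^ 3 \<le> t\<^sup>2 * 1" unfolding power3_eq_cube power2_eq_square using t by (intro mult_left_mono) auto
    moreover have "(t + t\<^sup>2 / 2) * (1 - t / 16) - (t + 5 * t\<^sup>2 / 32) * (1 + t / 32) = t\<^sup>2 * (1/4) - t ^ 3 * (37 / 1024)"
      by (simp add: field_simps power2_eq_square power3_eq_cube)
    ultimately show "(t + 5 * t\<^sup>2 / 32) * (1 + t / 32) \<le> (t + t\<^sup>2 / 2) * (1 - t / 16)"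
      using zero_le_power2[of t] by linarith
  qed simp
  finally have "real (card C) * (1 - t / 16) \<le> (?N * (t + t\<^sup>2 / 2)) * (1 - t / 16)"
    by (simp add: mult_ac)
  then have "real (card C) \<le> ?N * (t + t\<^sup>2 / 2)"
    using t by (simp add: mult_le_cancel_right)
  moreover have "t + t\<^sup>2 / 2 = 1 / m + 1 / (2 * (real m)\<^sup>2)"
    by (simp add: t_def power_divide)
  ultimately show ?thesis by (simp only: C_def)
qed

section \<open>Random digits\<close>

lemma prod_le_factor:
  fixes f :: "'a \<Rightarrow> real"
  assumes "finite I" "i \<in> I" "\<And>j. j \<in> I \<Longrightarrow> 0 \<le> f j \<and> f j \<le> 1"
  shows "prod f I \<le> f i"
proof -
  have "prod f I = f i * prod f (I - {i})" using assms by (simp add: prod.remove)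
  also have "\<dots> \<le> f i * 1" using assms by (intro mult_left_mono prod_le_1) auto
  finally show ?thesis by simp
qed

lemma sum_lessThan_mult:
  fixes f :: "nat \<Rightarrow> 'a::comm_monoid_add"
  shows "(\<Sum>l<a * b. f l) = (\<Sum>x<a. \<Sum>y<b. f (x + a * y))"
proof -
  have "(\<Sum>x<a. \<Sum>y<b. f (x + a * y)) = (\<Sum>(x, y)\<in>{..<a} \<times> {..<b}. f (x + a * y))"
    by (rule sum.cartesian_product)
  also have "\<dots> = (\<Sum>l<a * b. f l)"
  proof (rule sum.reindex_bij_witness[where j = "\<lambda>(x, y). x + a * y" and i = "\<lambda>l. (l mod a, l div a)"], goal_cases)
    case (2 z)
    then obtain x y where xy: "z = (x, y)" "x < a" "y < b" by auto
    have "x + a * y < a * (y + 1)" using xy by simp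
    also have "\<dots> \<le> a * b" using xy by (intro mult_left_mono) auto
    finally show ?case using xy by simp
  next
    case (4 l)
    then have "a > 0" by (cases a) auto
    then show ?case using 4 by (auto simp: less_mult_imp_div_less mult.commute)
  qed auto
  finally show ?thesis by simp
qed

section \<open>Averages over independent digits\<close>

locale digit_law =
  fixes s :: nat and p :: "nat \<Rightarrow> real"
  assumes base_ge_2: "s \<ge> 2"
    and p_nonneg: "\<And>d. p d \<ge> 0"
    and p_sum: "(\<Sum>d<s. p d) = 1"
begin

text \<open>
  The average of \<open>f w\<close> over the numbers \<open>w < s ^ L\<close> whose \<open>L\<close> digits to base \<open>s\<close> are
  independent with law \<open>p\<close>; the least significant digit is split off first.
\<close>

primrec average :: "nat \<Rightarrow> (nat \<Rightarrow> 'a) \<Rightarrow> 'a::real_vector" where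
  "average 0 f = f 0"
| "average (Suc L) f = (\<Sum>d<s. p d *\<^sub>R average L (\<lambda>w. f (d + s * w)))"

lemma average_sum: "average L (\<lambda>w. \<Sum>i\<in>I. f i w) = (\<Sum>i\<in>I. average L (f i))"
proof (induction L arbitrary: f)
  case (Suc L)
  show ?case by (simp add: Suc scaleR_sum_right) (rule sum.swap)
qed simp

lemma average_scaleR: "average L (\<lambda>w. c *\<^sub>R f w) = c *\<^sub>R average L f"
  by (induction L arbitrary: f) (simp_all add: scaleR_sum_right mult.commute)

lemma average_mult:
  fixes f :: "nat \<Rightarrow> 'a::real_algebra"
  shows "average L (\<lambda>w. c * f w) = c * average L f"
  by (induction L arbitrary: f) (simp_all add: sum_distrib_left)

lemma average_Re: "average L (\<lambda>w. Re (f w)) = Re (average L f)"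
  by (induction L arbitrary: f) simp_all

text \<open>Method of conditional expectations: for some lowest digit the conditional average does
  not exceed the total one, for otherwise the inequality would be strict at a digit of positive
  probability.\<close>

lemma average_witness:
  fixes f :: "nat \<Rightarrow> real"
  shows "\<exists>w < s ^ L. f w \<le> average L f"
proof (induction L arbitrary: f)
  case (Suc L)
  let ?a = "\<lambda>d. average L (\<lambda>w. f (d + s * w))"
  have "\<exists>d<s. ?a d \<le> average (Suc L) f"
  proof (rule ccontr)
    assume "\<not> ?thesis"
    then have less: "average (Suc L) f < ?a d" if "d < s" for d using that by force
    have "\<exists>d<s. p d \<noteq> 0"
      using p_sum by (metis lessThan_iff sum.neutral zero_neq_one)
    then obtain d0 where d0: "d0 < s" "p d0 > 0" using p_nonneg by (metis order_le_less)
    have "(\<Sum>d<s. p d * average (Suc L) f) < (\<Sum>d<s. p d * ?a d)"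
    proof (rule sum_strict_mono_ex1)
      show "\<forall>d\<in>{..<s}. p d * average (Suc L) f \<le> p d * ?a d"
        using less by (blast intro: mult_left_mono[OF less_imp_le p_nonneg])
      show "\<exists>d\<in>{..<s}. p d * average (Suc L) f < p d * ?a d"
        using less d0 by (blast intro: mult_strict_left_mono)
    qed simp
    moreover have "(\<Sum>d<s. p d * average (Suc L) f) = average (Suc L) f"
      by (simp add: p_sum del: average.simps flip: sum_distrib_right)
    ultimately show False by simp
  qed
  then obtain d where d: "d < s" "?a d \<le> average (Suc L) f" by blast
  obtain w where w: "w < s ^ L" "f (d + s * w) \<le> ?a d"
    using Suc[of "\<lambda>w. f (d + s * w)"] by blast
  have "d + s * w < s * (w + 1)" using d by simp
  also have "\<dots> \<le> s * s ^ L" using w by (intro mult_left_mono) auto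
  finally show ?case using d w by (intro exI[of _ "d + s * w"]) auto
qed simp

section \<open>Characteristic functions, Riesz products and the Parseval identity\<close>

definition digit_char :: "real \<Rightarrow> complex" where
  "digit_char x = (\<Sum>d<s. p d *\<^sub>R unit_exp (real d * x))"

text \<open>The Riesz product: the modulus of the Fourier transform of the law of w at u, see
  \<open>norm_average_unit_exp\<close>.\<close>

definition char_prod :: "nat \<Rightarrow> real \<Rightarrow> real" where
  "char_prod K u = (\<Prod>k<K. norm (digit_char (u * real s ^ k)))"

lemma norm_digit_char_le_1: "norm (digit_char x) \<le> 1"
proof -
  have "norm (digit_char x) \<le> (\<Sum>d<s. norm (p d *\<^sub>R unit_exp (real d * x)))"
    unfolding digit_char_def by (rule norm_sum)
  then show ?thesis using p_nonneg p_sum by simp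
qed

lemma digit_char_add_of_int: "digit_char (x + of_int k) = digit_char x"
proof -
  have "real d * (x + of_int k) = real d * x + of_int (int d * k)" for d
    by (simp add: algebra_simps)
  then show ?thesis unfolding digit_char_def by (simp only: unit_exp_add_of_int)
qed

lemma norm_digit_char_minus: "norm (digit_char (- x)) = norm (digit_char x)"
proof -
  have "digit_char (- x) = cnj (digit_char x)"
    by (simp add: digit_char_def cnj_unit_exp)
  then show ?thesis by (metis complex_mod_cnj)
qed

lemma average_unit_exp:
  "average L (\<lambda>w. unit_exp (u * real w)) = (\<Prod>k<L. digit_char (u * real s ^ k))"
proof (induction L arbitrary: u)
  case (Suc L)
  have "average (Suc L) (\<lambda>w. unit_exp (u * real w))
     = (\<Sum>d<s. p d *\<^sub>R average L (\<lambda>w. unit_exp (real d * u) * unit_exp (u * real s * real w)))"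
    by (simp add: algebra_simps flip: unit_exp_add)
  also have "\<dots> = (\<Sum>d<s. p d *\<^sub>R unit_exp (real d * u)) * (\<Prod>k<L. digit_char (u * real s * real s ^ k))"
    by (simp add: average_mult Suc sum_distrib_right)
  also have "\<dots> = (\<Prod>k<Suc L. digit_char (u * real s ^ k))"
    by (simp only: prod.lessThan_Suc_shift) (simp add: digit_char_def mult_ac)
  finally show ?case .
qed simp

lemma norm_average_unit_exp: "norm (average L (\<lambda>w. unit_exp (u * real w))) = char_prod L u"
  by (simp add: average_unit_exp char_prod_def prod_norm)

lemma char_prod_nonneg: "char_prod K u \<ge> 0"
  by (simp add: char_prod_def prod_nonneg)

lemma char_prod_le_1: "char_prod K u \<le> 1"
  by (auto simp: char_prod_def norm_digit_char_le_1 intro!: prod_le_1)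

lemma char_prod_minus: "char_prod K (- u) = char_prod K u"
  by (simp add: char_prod_def norm_digit_char_minus)

lemma char_prod_Suc: "char_prod (Suc K) u = norm (digit_char u) * char_prod K (u * real s)"
  unfolding char_prod_def by (simp only: prod.lessThan_Suc_shift) (simp add: mult_ac)

lemma char_prod_add_of_int: "char_prod K (u + of_int k) = char_prod K u"
proof -
  have "(u + of_int k) * real s ^ i = u * real s ^ i + of_int (k * int s ^ i)" for i
    by (simp add: algebra_simps)
  then show ?thesis unfolding char_prod_def by (simp only: digit_char_add_of_int)
qed

text \<open>All factors are at most 1, so any K consecutive ones give an upper bound, and starting
  at index j amounts to rescaling u. Frequencies of very different size are brought to one scale in
  this way.\<close>

lemma char_prod_window:
  assumes "j + K \<le> L"
  shows "char_prod L u \<le> char_prod K (u * real s ^ j)"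
proof -
  have "char_prod L u = (\<Prod>k\<in>{..<L} - {j..<j+K}. norm (digit_char (u * real s ^ k)))
      * (\<Prod>k\<in>{j..<j+K}. norm (digit_char (u * real s ^ k)))"
    unfolding char_prod_def by (rule prod.subset_diff) (use assms in auto)
  also have "\<dots> \<le> 1 * (\<Prod>k\<in>{j..<j+K}. norm (digit_char (u * real s ^ k)))"
    by (intro mult_right_mono prod_le_1 prod_nonneg) (auto simp: norm_digit_char_le_1)
  also have "(\<Prod>k\<in>{j..<j+K}. norm (digit_char (u * real s ^ k))) = char_prod K (u * real s ^ j)"
    unfolding char_prod_def
    by (rule prod.reindex_bij_witness[of _ "\<lambda>k. j + k" "\<lambda>k. k - j"]) (auto simp: mult.assoc simp flip: power_add)
  finally show ?thesis by simp
qed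

text \<open>The probability that two independent digits agree. Parseval modulo s turns it into the
  mean square of \<open>digit_char\<close>, so it governs the decay of Riesz products.\<close>

definition collision :: real where
  "collision = (\<Sum>d<s. (p d)\<^sup>2)"

lemma sum_norm_digit_char_squared:
  "(\<Sum>l<s. (norm (digit_char (y + real l / real s)))\<^sup>2) = real s * collision"
proof -
  have root: "(\<Sum>l<s. unit_exp (real d * (y + real l / real s)) * cnj (unit_exp (real e * (y + real l / real s))))
     = (if d = e then of_nat s else 0)" if "d < s" "e < s" for d e
  proof (cases "d = e")
    case False
    have "\<not> int s dvd (int d - int e)"
    proof
      assume "int s dvd int d - int e"
      then have "\<bar>int s\<bar> \<le> \<bar>int d - int e\<bar>" using False by (intro dvd_imp_le_int) auto
      then show False using that by linarith
    qed
    then have "(\<Sum>l<s. unit_exp (of_int (int d - int e) * real l / real s)) = 0"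
      using base_ge_2 by (intro sum_unit_exp_root) auto
    moreover have "(\<Sum>l<s. unit_exp (real d * (y + real l / real s)) * cnj (unit_exp (real e * (y + real l / real s))))
       = unit_exp ((real d - real e) * y) * (\<Sum>l<s. unit_exp (of_int (int d - int e) * real l / real s))"
      by (simp add: sum_distrib_left cnj_unit_exp flip: unit_exp_add)
        (intro sum.cong, auto simp: algebra_simps diff_divide_distrib)
    ultimately show ?thesis using False by simp
  next
    case True
    then show ?thesis by (simp add: cnj_unit_exp flip: unit_exp_add)
  qed
  have "complex_of_real (\<Sum>l<s. (norm (digit_char (y + real l / real s)))\<^sup>2)
     = (\<Sum>l<s. \<Sum>d<s. \<Sum>e<s. of_real (p d * p e) *
         (unit_exp (real d * (y + real l / real s)) * cnj (unit_exp (real e * (y + real l / real s)))))"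
    unfolding of_real_sum digit_char_def norm_sum_squared
    by (simp add: scaleR_conv_of_real mult_ac)
  also have "\<dots> = (\<Sum>d<s. \<Sum>e<s. \<Sum>l<s. of_real (p d * p e) *
         (unit_exp (real d * (y + real l / real s)) * cnj (unit_exp (real e * (y + real l / real s)))))"
    by (subst sum.swap) (intro sum.cong refl sum.swap)
  also have "\<dots> = (\<Sum>d<s. \<Sum>e<s. of_real (p d * p e) * (if d = e then of_nat s else 0))"
    by (intro sum.cong refl) (simp only: sum_distrib_left[symmetric] root lessThan_iff)
  also have "\<dots> = complex_of_real (real s * collision)"
    by (simp add: collision_def sum_distrib_left power2_eq_square mult_ac if_distrib[of "\<lambda>x. _ * x"] cong: if_cong)
  finally show ?thesis by (simp only: of_real_eq_iff)
qed

text \<open>Write l = a + s^K b. As \<open>digit_char\<close> has period 1, the shift by b / s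
  affects the first factor only, whose squares sum to s * \<open>collision\<close> over b; the other
  factors form the same kind of sum at y * s.\<close>

lemma sum_char_prod_squared:
  "(\<Sum>l<s ^ K. (char_prod K (y + real l / real s ^ K))\<^sup>2) = (real s * collision) ^ K"
proof (induction K arbitrary: y)
  case (Suc K)
  let ?f = "\<lambda>l. (char_prod (Suc K) (y + real l / real s ^ Suc K))\<^sup>2"
  have s0: "real s \<noteq> 0" using base_ge_2 by simp
  have split: "?f (a + s ^ K * b)
     = (norm (digit_char (y + real a / real s ^ Suc K + real b / real s)))\<^sup>2
        * (char_prod K (y * real s + real a / real s ^ K))\<^sup>2" for a b
  proof -
    have "y + real (a + s ^ K * b) / real s ^ Suc K = y + real a / real s ^ Suc K + real b / real s"
      using s0 by (simp add: field_simps)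
    moreover have "(y + real a / real s ^ Suc K + real b / real s) * real s
        = y * real s + real a / real s ^ K + of_int (int b)"
      using s0 by (simp add: field_simps)
    ultimately show ?thesis
      unfolding char_prod_Suc by (simp only: char_prod_add_of_int power_mult_distrib)
  qed
  have "(\<Sum>l<s ^ Suc K. ?f l) = (\<Sum>a<s ^ K. \<Sum>b<s. ?f (a + s ^ K * b))"
    using sum_lessThan_mult[of ?f "s ^ K" s] by (simp only: power_Suc2)
  also have "\<dots> = (\<Sum>a<s ^ K. real s * collision * (char_prod K (y * real s + real a / real s ^ K))\<^sup>2)"
    by (simp only: split sum_distrib_right[symmetric] sum_norm_digit_char_squared)
  also have "\<dots> = (real s * collision) ^ Suc K"
    by (simp only: sum_distrib_left[symmetric] Suc power_Suc)
  finally show ?case .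
qed (simp add: char_prod_def)

section \<open>Variance of the number of zero digits\<close>

definition zero_digits :: "nat \<Rightarrow> nat \<Rightarrow> nat" where
  "zero_digits L w = card {i. i < L \<and> (w div s ^ i) mod s = 0}"

lemma zero_digits_Suc:
  assumes "d < s"
  shows "zero_digits (Suc L) (d + s * w) = (if d = 0 then 1 else 0) + zero_digits L w"
proof -
  have shift: "(d + s * w) div s ^ Suc i = w div s ^ i" for i
    using assms base_ge_2 by (simp add: div_mult2_eq)
  have "{i. i < Suc L \<and> ((d + s * w) div s ^ i) mod s = 0}
     = (if d = 0 then {0} else {}) \<union> Suc ` {i. i < L \<and> (w div s ^ i) mod s = 0}" (is "?A = ?B")
  proof (rule set_eqI)
    fix i show "i \<in> ?A \<longleftrightarrow> i \<in> ?B"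
    proof (cases i)
      case 0
      then show ?thesis using assms by auto
    next
      case (Suc j)
      then show ?thesis using shift[of j] by (auto simp del: power_Suc)
    qed
  qed
  then have "zero_digits (Suc L) (d + s * w)
     = card ((if d = 0 then {0} else {}) \<union> Suc ` {i. i < L \<and> (w div s ^ i) mod s = 0})"
    by (simp add: zero_digits_def)
  also have "\<dots> = card (if d = 0 then {0::nat} else {}) + card (Suc ` {i. i < L \<and> (w div s ^ i) mod s = 0})"
    by (rule card_Un_disjoint) auto
  finally show ?thesis by (auto simp: zero_digits_def card_image)
qed

text \<open>The offset a carries the induction: splitting off a digit adds its centred value to the
  offset, and the cross terms average to 0. At a = 0 this is the binomial variance.\<close>

lemma average_zero_digits_variance:
  "average L (\<lambda>w. (a + real (zero_digits L w) - real L * p 0)\<^sup>2) = a\<^sup>2 + real L * (p 0 * (1 - p 0))"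
proof (induction L arbitrary: a)
  case 0
  then show ?case by (simp add: zero_digits_def)
next
  case (Suc L)
  let ?b = "\<lambda>d::nat. if d = 0 then 1 else 0 :: real"
  have "average (Suc L) (\<lambda>w. (a + real (zero_digits (Suc L) w) - real (Suc L) * p 0)\<^sup>2)
     = (\<Sum>d<s. p d * average L (\<lambda>w. ((a + ?b d - p 0) + real (zero_digits L w) - real L * p 0)\<^sup>2))"
    unfolding average.simps real_scaleR_def
  proof (intro sum.cong refl)
    fix d assume "d \<in> {..<s}"
    then have "a + real (zero_digits (Suc L) (d + s * w)) - real (Suc L) * p 0
       = (a + ?b d - p 0) + real (zero_digits L w) - real L * p 0" for w
      by (subst zero_digits_Suc) (auto simp: algebra_simps)
    then show "p d * average L (\<lambda>w. (a + real (zero_digits (Suc L) (d + s * w)) - real (Suc L) * p 0)\<^sup>2)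
       = p d * average L (\<lambda>w. ((a + ?b d - p 0) + real (zero_digits L w) - real L * p 0)\<^sup>2)"
      by (simp only:)
  qed
  also have "\<dots> = (\<Sum>d<s. p d * ((a + ?b d - p 0)\<^sup>2 + real L * (p 0 * (1 - p 0))))"
    by (simp only: Suc)
  also have "\<dots> = (\<Sum>d<s. p d * ((a - p 0)\<^sup>2 + real L * (p 0 * (1 - p 0))) + (if d = 0 then p 0 * (2 * (a - p 0) + 1) else 0))"
    by (intro sum.cong refl) (auto simp: algebra_simps power2_eq_square)
  also have "\<dots> = (a - p 0)\<^sup>2 + real L * (p 0 * (1 - p 0)) + p 0 * (2 * (a - p 0) + 1)"
    using base_ge_2 by (simp add: sum.distrib p_sum flip: sum_distrib_right)
  also have "\<dots> = a\<^sup>2 + real (Suc L) * (p 0 * (1 - p 0))"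
    by (simp add: algebra_simps power2_eq_square)
  finally show ?case .
qed

end

section \<open>The uniform law mixed with a point mass at 0\<close>

definition biased_law :: "nat \<Rightarrow> real \<Rightarrow> nat \<Rightarrow> real" where
  "biased_law s \<epsilon> d = (1 - \<epsilon>) / real s + (if d = 0 then \<epsilon> else 0)"

lemma digit_law_biased:
  assumes "s \<ge> 2" "0 \<le> \<epsilon>" "\<epsilon> \<le> 1"
  shows "digit_law s (biased_law s \<epsilon>)"
proof
  show "(\<Sum>d<s. biased_law s \<epsilon> d) = 1"
    using assms by (simp add: biased_law_def sum.distrib)
qed (use assms in \<open>auto simp: biased_law_def\<close>)

text \<open>At a non-integral fraction with denominator s the uniform part of the law vanishes, and
  only the point mass \<epsilon> at 0 is left.\<close>

lemma biased_digit_char: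
  assumes "s \<ge> 2" "0 \<le> \<epsilon>" "\<epsilon> \<le> 1" "\<not> s dvd t"
  shows "norm (digit_law.digit_char s (biased_law s \<epsilon>) (real t / real s)) \<le> \<epsilon>"
proof -
  interpret digit_law s "biased_law s \<epsilon>" by (rule digit_law_biased) fact+
  have "(\<Sum>d<s. unit_exp (real d * (real t / real s))) = 0"
    using sum_unit_exp_root[of s "int t"] assms by (simp add: mult_ac)
  then have "digit_char (real t / real s) = of_real \<epsilon>"
    using assms unfolding digit_char_def biased_law_def
    by (simp add: scaleR_add_left sum.distrib if_distrib[of "\<lambda>c. c *\<^sub>R _"] flip: scaleR_sum_right cong: if_cong)
      (simp add: scaleR_conv_of_real)
  then show ?thesis using assms by simp
qed

lemma power_factor:
  fixes s t :: nat
  assumes "s \<ge> 2" "t > 0"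
  obtains v t' where "t = s ^ v * t'" "\<not> s dvd t'"
proof -
  have "\<exists>v t'. t = s ^ v * t' \<and> \<not> s dvd t'" using assms(2)
  proof (induction t rule: less_induct)
    case (less t)
    show ?case
    proof (cases "s dvd t")
      case True
      then obtain u where u: "t = s * u" by auto
      then have "u < t" "u > 0" using less.prems assms by auto
      then obtain v t' where "u = s ^ v * t'" "\<not> s dvd t'" using less.IH by blast
      then show ?thesis using u by (intro exI[of _ "Suc v"] exI[of _ t']) simp
    next
      case False
      then show ?thesis by (intro exI[of _ 0] exI[of _ t]) simp
    qed
  qed
  then show ?thesis using that by blast
qed

text \<open>If s^v is the largest power of s dividing t, then the factor with index L - 1 - v is
  \<open>digit_char\<close> at a non-integral fraction t' / s, and this single factor already gives
  the bound.\<close>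

lemma biased_char_prod:
  assumes "s \<ge> 2" "0 \<le> \<epsilon>" "\<epsilon> \<le> 1" "0 < t" "t < s ^ L"
  shows "digit_law.char_prod s (biased_law s \<epsilon>) L (real t / real s ^ L) \<le> \<epsilon>"
proof -
  interpret digit_law s "biased_law s \<epsilon>" by (rule digit_law_biased) fact+
  obtain v t' where t': "t = s ^ v * t'" "\<not> s dvd t'" using power_factor assms by metis
  have "t' > 0" using t' assms by (cases t') auto
  then have "s ^ v \<le> t" using t' by simp
  then have "v < L" using assms by (meson le_less_trans power_less_imp_less_exp one_less_numeral_iff
    less_le_trans order_less_le_trans semiring_norm(76) One_nat_def Suc_1 Suc_le_lessD)
  define k where "k = L - 1 - v"
  have L: "L = v + k + 1" using \<open>v < L\<close> by (simp add: k_def)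
  have "real t / real s ^ L * real s ^ k = real t' / real s"
    using assms by (simp add: t' L power_add)
  moreover have "char_prod L (real t / real s ^ L) \<le> norm (digit_char (real t / real s ^ L * real s ^ k))"
    unfolding char_prod_def by (rule prod_le_factor) (auto simp: L norm_digit_char_le_1)
  ultimately show ?thesis using biased_digit_char[OF assms(1-3) t'(2)] by simp
qed

section \<open>Equidistribution of logarithms\<close>

text \<open>Weyl's criterion for an irrational rotation. The geometric sums are bounded
  independently of the start i1 and the phase \<beta>, hence N0 is uniform in both; the second
  moment bound relies on this, because its phases depend on the pair of positions.\<close>

lemma irrational_orbit_cells:
  fixes \<alpha> :: real
  assumes "\<alpha> \<notin> \<rat>" and "m \<ge> 1"
  shows "\<exists>N0. \<forall>N\<ge>N0. \<forall>i1 \<beta>. \<forall>c<m.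
    real (card {i\<in>{i1..<i1+N}. \<lfloor>real m * frac (real i * \<alpha> + \<beta>)\<rfloor> = int c}) \<le> real N * (2 / real m)"
proof -
  define B where "B = (\<Sum>h\<in>{1..<weyl_order m}. 2 / norm (unit_exp (real h * \<alpha>) - 1))"
  have tol: "weyl_tol m > 0" using assms by (simp add: weyl_tol_def weyl_order_def)
  obtain N0 :: nat where N0: "B / weyl_tol m \<le> real N0" using real_arch_simple by blast
  have weyl: "norm (\<Sum>i\<in>{i1..<i1+N}. unit_exp (real h * (real i * \<alpha> + \<beta>))) \<le> B"
    if h: "1 \<le> h" "h < weyl_order m" for h i1 N \<beta>
  proof -
    have "real h * \<alpha> \<notin> \<int>"
    proof
      assume "real h * \<alpha> \<in> \<int>"
      then have "real h * \<alpha> / real h \<in> \<rat>" using Ints_subset_Rats by (intro Rats_divide) auto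
      then show False using assms h by simp
    qed
    then have nz: "norm (unit_exp (real h * \<alpha>) - 1) > 0" by (simp add: unit_exp_eq_1_iff)
    have "(\<Sum>i\<in>{i1..<i1+N}. unit_exp (real h * (real i * \<alpha> + \<beta>)))
        = (\<Sum>i<N. unit_exp (real h * (real (i1 + i) * \<alpha> + \<beta>)))"
      by (rule sum.reindex_bij_witness[of _ "\<lambda>i. i1 + i" "\<lambda>i. i - i1"]) auto
    also have "\<dots> = unit_exp (real h * (real i1 * \<alpha> + \<beta>)) * (\<Sum>i<N. unit_exp (real i * (real h * \<alpha>)))"
      unfolding sum_distrib_left unit_exp_add[symmetric] by (simp add: algebra_simps)
    finally have "norm (\<Sum>i\<in>{i1..<i1+N}. unit_exp (real h * (real i * \<alpha> + \<beta>))) * norm (unit_exp (real h * \<alpha>) - 1)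
       = norm (unit_exp (real N * (real h * \<alpha>)) - 1)"
      by (simp add: norm_mult flip: unit_exp_geometric)
    also have "\<dots> \<le> 2" using norm_triangle_ineq4[of "unit_exp (real N * (real h * \<alpha>))" 1] by simp
    finally have "norm (\<Sum>i\<in>{i1..<i1+N}. unit_exp (real h * (real i * \<alpha> + \<beta>))) \<le> 2 / norm (unit_exp (real h * \<alpha>) - 1)"
      using nz by (simp add: le_divide_eq)
    also have "\<dots> \<le> B" unfolding B_def using h by (intro member_le_sum) auto
    finally show ?thesis .
  qed
  show ?thesis
  proof (intro exI[of _ N0] allI impI)
    fix N i1 \<beta> c assume N: "N0 \<le> N" and c: "c < m"
    have "B \<le> weyl_tol m * real N0" using N0 tol by (simp add: divide_le_eq mult.commute)
    also have "\<dots> \<le> weyl_tol m * real N" using N tol by (intro mult_left_mono) auto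
    finally have B: "B \<le> weyl_tol m * real (card {i1..<i1+N})" by simp
    have "real (card {i\<in>{i1..<i1+N}. \<lfloor>real m * frac (real i * \<alpha> + \<beta>)\<rfloor> = int c})
       \<le> real (card {i1..<i1+N}) * (1 / m + 1 / (2 * (real m)\<^sup>2))"
      by (rule weyl_cell_count[OF _ assms(2) c order_trans[OF weyl B]]) auto
    also have "\<dots> \<le> real N * (2 / real m)"
      using assms by (auto intro!: mult_left_mono simp: field_simps power2_eq_square)
    finally show "real (card {i\<in>{i1..<i1+N}. \<lfloor>real m * frac (real i * \<alpha> + \<beta>)\<rfloor> = int c}) \<le> real N * (2 / real m)" .
  qed
qed

text \<open>On the logarithmic scale the points with floor j lie in an interval of length at most 2
  / Q. It meets at most three cells of width 1 / Q, each holding at most 2 N / Q points of the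
  orbit.\<close>

lemma log_orbit_cells:
  fixes \<alpha> :: real and s :: nat
  assumes "\<alpha> \<notin> \<rat>" and "s \<ge> 2" and "Q \<ge> 1"
  shows "\<exists>N0. \<forall>N\<ge>N0. \<forall>i1 \<beta>. \<forall>j\<in>{Q..<s * Q}.
    real (card {i\<in>{i1..<i1+N}. \<lfloor>real Q * real s powr frac (real i * \<alpha> + \<beta>)\<rfloor> = int j}) \<le> 6 * real N / real Q"
proof -
  obtain N0 where N0: "\<And>N i1 \<beta> c. N \<ge> N0 \<Longrightarrow> c < Q \<Longrightarrow>
     real (card {i\<in>{i1..<i1+N}. \<lfloor>real Q * frac (real i * \<alpha> + \<beta>)\<rfloor> = int c}) \<le> real N * (2 / real Q)"
    using irrational_orbit_cells[OF assms(1,3)] by blast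
  show ?thesis
  proof (intro exI[of _ N0] allI impI ballI)
    fix N i1 \<beta> j assume N: "N0 \<le> N" and j: "j \<in> {Q..<s * Q}"
    define z where "z i = frac (real i * \<alpha> + \<beta>)" for i :: nat
    define f where "f = \<lfloor>real Q * log s (real j / real Q)\<rfloor>"
    define cell where "cell c = {i\<in>{i1..<i1+N}. \<lfloor>real Q * z i\<rfloor> = c}" for c
    have Q0: "real Q > 0" "real j > 0" "real j \<ge> real Q" using assms j by auto
    have lns: "ln (real s) \<ge> 1 / 2"
    proof -
      have "ln 2 \<le> ln (real s)" using assms by simp
      then show ?thesis using ln2_ge_two_thirds by linarith
    qed
    have "{i\<in>{i1..<i1+N}. \<lfloor>real Q * real s powr z i\<rfloor> = int j} \<subseteq> (\<Union>c\<in>{f, f+1, f+2}. cell c)"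
    proof
      fix i assume i: "i \<in> {i\<in>{i1..<i1+N}. \<lfloor>real Q * real s powr z i\<rfloor> = int j}"
      then have "real j \<le> real Q * real s powr z i" "real Q * real s powr z i < real j + 1"
        by (auto simp: floor_eq_iff)
      then have "real j / real Q \<le> real s powr z i" "real s powr z i < (real j + 1) / real Q"
        using Q0 by (simp_all add: field_simps)
      then have le: "log s (real j / real Q) \<le> z i" and less: "z i < log s ((real j + 1) / real Q)"
        using assms Q0 by (simp_all add: log_le_iff less_log_iff)
      have "log s ((real j + 1) / real Q) = log s (real j / real Q) + log s (1 + 1 / real j)"
      proof -
        have eq: "(real j + 1) / real Q = (real j / real Q) * (1 + 1 / real j)"
          using Q0 by (simp add: field_simps)
        have "real j / real Q > 0" "1 + 1 / real j > 0" using Q0 by (simp_all add: add_pos_pos)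
        then show ?thesis unfolding eq using log_mult[of "real s" "real j / real Q" "1 + 1 / real j"]
          by (metis less_irrefl)
      qed
      also have "log s (1 + 1 / real j) \<le> 2 / real Q"
      proof -
        have "ln (1 + 1 / real j) \<le> 1 / real j" using Q0 by (intro ln_add_one_self_le_self) auto
        also have "\<dots> \<le> 1 / real Q" using Q0 by (simp add: frac_le)
        also have "\<dots> \<le> 2 / real Q * ln (real s)" using lns Q0 by (simp add: field_simps)
        finally show ?thesis using lns by (simp add: log_def divide_le_eq)
      qed
      finally have up: "z i < log s (real j / real Q) + 2 / real Q" using less by simp
      have "real Q * log s (real j / real Q) \<le> real Q * z i" using le Q0 by simp
      moreover have "real Q * z i < real Q * log s (real j / real Q) + 2"
        using up Q0 by (simp add: field_simps)
      ultimately have "\<lfloor>real Q * z i\<rfloor> \<in> {f, f+1, f+2}" unfolding f_def by simp linarith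
      then show "i \<in> (\<Union>c\<in>{f, f+1, f+2}. cell c)" using i by (auto simp: cell_def)
    qed
    then have "card {i\<in>{i1..<i1+N}. \<lfloor>real Q * real s powr z i\<rfloor> = int j} \<le> card (\<Union>c\<in>{f, f+1, f+2}. cell c)"
      by (rule card_mono[rotated]) (simp add: cell_def)
    also have "\<dots> \<le> (\<Sum>c\<in>{f, f+1, f+2}. card (cell c))" by (rule card_UN_le) simp
    also have "\<dots> = card (cell f) + card (cell (f+1)) + card (cell (f+2))" by simp
    finally have "real (card {i\<in>{i1..<i1+N}. \<lfloor>real Q * real s powr z i\<rfloor> = int j})
      \<le> real (card (cell f)) + real (card (cell (f+1))) + real (card (cell (f+2)))" by linarith
    moreover have "real (card (cell c)) \<le> real N * (2 / real Q)" for c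
    proof (cases "0 \<le> c \<and> c < int Q")
      case True
      then show ?thesis using N0[OF N, of "nat c" i1 \<beta>] by (simp add: cell_def z_def nat_less_iff)
    next
      case False
      have "\<lfloor>real Q * z i\<rfloor> \<noteq> c" for i
      proof -
        have "0 \<le> real Q * z i" "real Q * z i < real Q * 1"
          unfolding z_def using Q0 frac_lt_1 by (simp_all add: frac_ge_0)
        then have "0 \<le> \<lfloor>real Q * z i\<rfloor>" "\<lfloor>real Q * z i\<rfloor> < int Q" by (simp_all add: floor_less_iff)
        then show ?thesis using False by auto
      qed
      then have "cell c = {}" by (auto simp: cell_def)
      then show ?thesis by simp
    qed
    note this[of f] this[of "f+1"] this[of "f+2"]
    ultimately show "real (card {i\<in>{i1..<i1+N}. \<lfloor>real Q * real s powr frac (real i * \<alpha> + \<beta>)\<rfloor> = int j}) \<le> 6 * real N / real Q"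
      unfolding z_def by simp
  qed
qed

section \<open>Mean values of Riesz products along logarithmic orbits\<close>

context digit_law
begin

lemma continuous_char_prod: "continuous_on A (char_prod K)"
  unfolding char_prod_def digit_char_def unit_exp_def by (intro continuous_intros)

text \<open>The range from 0 to s consists of s periods, and the grid in one period splits into V
  translates of the grid of spacing 1 / s^K, to each of which \<open>sum_char_prod_squared\<close>
  applies.\<close>

lemma sum_char_prod_squared_grid:
  assumes "V \<ge> 1"
  shows "(\<Sum>j<s * (s ^ K * V). (char_prod K (real j / real (s ^ K * V)))\<^sup>2) = real s * (real (s ^ K * V) * collision ^ K)"
proof -
  let ?Q = "s ^ K * V"
  have Q0: "real ?Q \<noteq> 0" using assms base_ge_2 by simp
  have "(\<Sum>j<s * ?Q. (char_prod K (real j / real ?Q))\<^sup>2)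
     = (\<Sum>x<?Q. \<Sum>b<s. (char_prod K (real (x + ?Q * b) / real ?Q))\<^sup>2)"
    by (subst mult.commute) (rule sum_lessThan_mult)
  also have "\<dots> = (\<Sum>x<?Q. \<Sum>b<s. (char_prod K (real x / real ?Q))\<^sup>2)"
  proof (intro sum.cong refl)
    fix x b
    have "real (x + ?Q * b) / real ?Q = real x / real ?Q + of_int (int b)"
      using Q0 by (simp add: add_divide_distrib)
    then show "(char_prod K (real (x + ?Q * b) / real ?Q))\<^sup>2 = (char_prod K (real x / real ?Q))\<^sup>2"
      by (simp only: char_prod_add_of_int)
  qed
  also have "\<dots> = real s * (\<Sum>x<V * s ^ K. (char_prod K (real x / real ?Q))\<^sup>2)"
    by (simp add: mult.commute flip: sum_distrib_left)
  also have "(\<Sum>x<V * s ^ K. (char_prod K (real x / real ?Q))\<^sup>2)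
     = (\<Sum>v<V. \<Sum>l<s ^ K. (char_prod K (real v / real ?Q + real l / real s ^ K))\<^sup>2)"
    using assms base_ge_2 by (subst sum_lessThan_mult) (intro sum.cong refl, simp add: field_simps)
  also have "\<dots> = real ?Q * collision ^ K"
    by (simp add: sum_char_prod_squared power_mult_distrib)
  finally show ?thesis .
qed

text \<open>A Riemann sum argument: the orbit visits the cells of a fine grid on [1, s) with bounded
  density, and on such a grid the mean square of a Riesz product is a multiple of
  \<open>collision ^ K\<close>. K is fixed before the grid, whose fineness depends on the modulus of
  continuity for K.\<close>

lemma char_prod_orbit:
  assumes "\<alpha> \<notin> \<rat>" and "collision < 1" and "\<kappa> > 0"
  shows "\<exists>K N0. \<forall>N\<ge>N0. \<forall>i1 \<beta>.
    (\<Sum>i\<in>{i1..<i1+N}. char_prod K (real s powr frac (real i * \<alpha> + \<beta>))) \<le> \<kappa> * real N"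
proof -
  \<comment> \<open>The density factor 6, the length factor s and the two errors \<eta> below
    multiply to 12 s \<eta> = \<kappa>^2.\<close>
  define \<eta> where "\<eta> = \<kappa>\<^sup>2 / (12 * real s)"
  have s0: "real s > 0" using base_ge_2 by simp
  have \<eta>: "\<eta> > 0" using assms s0 by (simp add: \<eta>_def)
  have coll0: "collision \<ge> 0" by (simp add: collision_def sum_nonneg)
  obtain K where K: "collision ^ K < \<eta>" using real_arch_pow_inv[OF \<eta> assms(2)] by blast
  have "uniformly_continuous_on {1..real s} (\<lambda>u. (char_prod K u)\<^sup>2)"
    by (intro compact_uniformly_continuous continuous_on_power continuous_char_prod) auto
  then obtain \<delta> where \<delta>: "\<delta> > 0" and unif: "\<And>u u'. u \<in> {1..real s} \<Longrightarrow> u' \<in> {1..real s} \<Longrightarrow> dist u' u < \<delta>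
     \<Longrightarrow> dist ((char_prod K u')\<^sup>2) ((char_prod K u)\<^sup>2) < \<eta>"
    unfolding uniformly_continuous_on_def using \<eta> by metis
  obtain V where V: "V > 0" "inverse (real V) < \<delta>"
    using reals_Archimedean[OF \<delta>] by (metis zero_less_Suc)
  define Q where "Q = s ^ K * V"
  have Q1: "Q \<ge> 1" using V base_ge_2 by (simp add: Q_def Suc_leI)
  have "V \<le> Q" using base_ge_2 by (simp add: Q_def)
  then have "1 / real Q \<le> 1 / real V" using V by (simp add: frac_le)
  then have Qd: "1 / real Q < \<delta>" using V by (simp add: inverse_eq_divide)
  obtain N0 where N0: "\<And>N i1 \<beta> j. N \<ge> N0 \<Longrightarrow> j \<in> {Q..<s * Q} \<Longrightarrow>
    real (card {i\<in>{i1..<i1+N}. \<lfloor>real Q * real s powr frac (real i * \<alpha> + \<beta>)\<rfloor> = int j}) \<le> 6 * real N / real Q"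
    using log_orbit_cells[OF assms(1) base_ge_2 Q1] by blast
  show ?thesis
  proof (rule exI[of _ K], rule exI[of _ N0], intro allI impI)
    fix N i1 \<beta> assume N: "N0 \<le> N"
    define u where "u i = real s powr frac (real i * \<alpha> + \<beta>)" for i :: nat
    define I where "I = {i1..<i1+N}"
    define c where "c i = nat \<lfloor>real Q * u i\<rfloor>" for i
    have u: "1 \<le> u i" "u i < real s" for i
    proof -
      show "1 \<le> u i" using base_ge_2 by (simp add: u_def ge_one_powr_ge_zero frac_ge_0)
      have "u i < real s powr 1" unfolding u_def using base_ge_2
        by (intro powr_less_mono) (auto simp: frac_lt_1)
      then show "u i < real s" using base_ge_2 by simp
    qed
    have fl: "\<lfloor>real Q * u i\<rfloor> = int (c i)" for i using u(1)[of i] by (simp add: c_def)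
    have c_range: "c i \<in> {Q..<s * Q}" for i
    proof -
      have "real Q * 1 \<le> real Q * u i" using u(1)[of i] by (intro mult_left_mono) auto
      moreover have "real Q * u i < real Q * real s" using u(2)[of i] Q1 by (intro mult_strict_left_mono) auto
      ultimately have "int Q \<le> \<lfloor>real Q * u i\<rfloor>" "\<lfloor>real Q * u i\<rfloor> < int (s * Q)"
        by (simp_all add: le_floor_iff floor_less_iff mult.commute)
      then show ?thesis unfolding fl of_nat_le_iff of_nat_less_iff by simp
    qed
    have near: "(char_prod K (u i))\<^sup>2 \<le> (char_prod K (real (c i) / real Q))\<^sup>2 + \<eta>" for i
    proof -
      have b: "real (c i) \<le> real Q * u i" "real Q * u i < real (c i) + 1"
        using fl[of i] by (simp_all add: floor_eq_iff)
      then have b': "real (c i) / real Q \<le> u i" "u i < real (c i) / real Q + 1 / real Q"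
        using Q1 by (simp_all add: field_simps)
      then have "dist (u i) (real (c i) / real Q) < \<delta>" using Qd by (simp add: dist_real_def)
      moreover have "1 \<le> real (c i) / real Q" using c_range[of i] Q1 by simp
      ultimately have "dist ((char_prod K (u i))\<^sup>2) ((char_prod K (real (c i) / real Q))\<^sup>2) < \<eta>"
        using u[of i] b' by (intro unif) auto
      then show ?thesis by (simp add: dist_real_def)
    qed
    have "(\<Sum>i\<in>I. (char_prod K (u i))\<^sup>2) \<le> (\<Sum>i\<in>I. (char_prod K (real (c i) / real Q))\<^sup>2 + \<eta>)"
      by (intro sum_mono near)
    also have "\<dots> = (\<Sum>j\<in>{Q..<s * Q}. \<Sum>i\<in>{i\<in>I. c i = j}. (char_prod K (real (c i) / real Q))\<^sup>2 + \<eta>)"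
      using c_range by (intro sum.group[symmetric]) (auto simp: I_def)
    also have "\<dots> = (\<Sum>j\<in>{Q..<s * Q}. real (card {i\<in>I. c i = j}) * ((char_prod K (real j / real Q))\<^sup>2 + \<eta>))"
      by simp
    also have "\<dots> \<le> (\<Sum>j\<in>{Q..<s * Q}. 6 * real N / real Q * ((char_prod K (real j / real Q))\<^sup>2 + \<eta>))"
    proof (intro sum_mono mult_right_mono)
      fix j assume "j \<in> {Q..<s * Q}"
      moreover have "{i\<in>I. c i = j} = {i\<in>I. \<lfloor>real Q * u i\<rfloor> = int j}" by (simp add: fl)
      ultimately show "real (card {i\<in>I. c i = j}) \<le> 6 * real N / real Q"
        using N0[OF N] by (simp add: I_def u_def)
    qed (use \<eta> in auto)
    also have "\<dots> \<le> (\<Sum>j\<in>{..<s * Q}. 6 * real N / real Q * ((char_prod K (real j / real Q))\<^sup>2 + \<eta>))"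
      using \<eta> by (intro sum_mono2) auto
    also have "\<dots> = 6 * real N / real Q * ((\<Sum>j<s * Q. (char_prod K (real j / real Q))\<^sup>2) + real (s * Q) * \<eta>)"
      by (simp only: sum_distrib_left[symmetric] sum.distrib) simp
    also have "(\<Sum>j<s * Q. (char_prod K (real j / real Q))\<^sup>2) = real s * (real Q * collision ^ K)"
      unfolding Q_def using V by (intro sum_char_prod_squared_grid) auto
    also have "6 * real N / real Q * (real s * (real Q * collision ^ K) + real (s * Q) * \<eta>)
      = 6 * real N * real s * (collision ^ K + \<eta>)" using Q1 by (simp add: field_simps)
    also have "\<dots> \<le> 6 * real N * real s * (\<eta> + \<eta>)" using K by (intro mult_left_mono) auto
    also have "\<dots> = real N * \<kappa>\<^sup>2" using s0 by (simp add: \<eta>_def field_simps)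
    finally have sq: "(\<Sum>i\<in>I. (char_prod K (u i))\<^sup>2) \<le> real N * \<kappa>\<^sup>2" .
    \<comment> \<open>Passes from mean squares to means, so that \<kappa>^2 turns into
      \<kappa>.\<close>
    have amgm: "char_prod K (u i) \<le> \<kappa> / 2 + (char_prod K (u i))\<^sup>2 / (2 * \<kappa>)" for i
    proof -
      have "0 \<le> (char_prod K (u i) - \<kappa>)\<^sup>2" by simp
      then show ?thesis using assms by (simp add: field_simps power2_eq_square)
    qed
    have "(\<Sum>i\<in>I. char_prod K (u i)) \<le> (\<Sum>i\<in>I. \<kappa> / 2 + (char_prod K (u i))\<^sup>2 / (2 * \<kappa>))"
      by (intro sum_mono amgm)
    also have "\<dots> = real N * (\<kappa> / 2) + (\<Sum>i\<in>I. (char_prod K (u i))\<^sup>2) / (2 * \<kappa>)"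
      by (simp add: sum.distrib sum_divide_distrib I_def)
    also have "\<dots> \<le> real N * (\<kappa> / 2) + real N * \<kappa>\<^sup>2 / (2 * \<kappa>)"
      using sq assms by (intro add_left_mono divide_right_mono) auto
    also have "\<dots> = \<kappa> * real N" using assms by (simp add: power2_eq_square)
    finally show "(\<Sum>i\<in>{i1..<i1+N}. char_prod K (real s powr frac (real i * \<alpha> + \<beta>))) \<le> \<kappa> * real N"
      by (simp add: I_def u_def)
  qed
qed

end

section \<open>Mean squares of Weyl sums\<close>

context digit_law
begin

text \<open>Expanding the square leaves, for each pair, a unimodular constant times the Fourier
  transform of w at the difference of the two coefficients.\<close>

lemma average_weyl_sum_le:
  assumes "finite I"
  shows "average L (\<lambda>w. (norm (\<Sum>i\<in>I. unit_exp (a i + b i * real w)))\<^sup>2)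
    \<le> (\<Sum>i\<in>I. \<Sum>j\<in>I. char_prod L (b i - b j))"
proof -
  have "average L (\<lambda>w. (norm (\<Sum>i\<in>I. unit_exp (a i + b i * real w)))\<^sup>2)
     = (\<Sum>i\<in>I. \<Sum>j\<in>I. average L (\<lambda>w. Re (unit_exp (a i + b i * real w - (a j + b j * real w)))))"
    by (simp only: norm_sum_unit_exp_squared average_sum)
  also have "\<dots> \<le> (\<Sum>i\<in>I. \<Sum>j\<in>I. char_prod L (b i - b j))"
  proof (intro sum_mono)
    fix i j
    have "unit_exp (a i + b i * real w - (a j + b j * real w))
       = unit_exp (a i - a j) * unit_exp ((b i - b j) * real w)" for w
      by (simp add: algebra_simps flip: unit_exp_add)
    then have "average L (\<lambda>w. Re (unit_exp (a i + b i * real w - (a j + b j * real w))))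
      = Re (unit_exp (a i - a j) * average L (\<lambda>w. unit_exp ((b i - b j) * real w)))"
      by (simp only: average_Re average_mult)
    also have "\<dots> \<le> norm (unit_exp (a i - a j) * average L (\<lambda>w. unit_exp ((b i - b j) * real w)))"
      by (rule complex_Re_le_cmod)
    also have "\<dots> = char_prod L (b i - b j)" by (simp add: norm_mult norm_average_unit_exp)
    finally show "average L (\<lambda>w. Re (unit_exp (a i + b i * real w - (a j + b j * real w)))) \<le> char_prod L (b i - b j)" .
  qed
  finally show ?thesis .
qed

text \<open>The window is started where the rescaled frequency lies between 1 and s, so that it is s
  to the power of a fractional part. The lower bound on y leaves K factors from there on; the upper
  bound keeps the start within the L digits.\<close>

lemma char_prod_le_orbit:
  assumes "1 \<le> y" and "real s ^ K * 2 \<le> y" and "real h * y \<le> real s ^ L"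
    and "h \<ge> 1" and "1 / 2 \<le> q" and "q \<le> 1"
  shows "char_prod L (real h * y * q / real s ^ L) \<le> char_prod K (real s powr frac (log s (real h * y * q)))"
proof -
  define x where "x = real h * y * q"
  define f where "f = nat \<lfloor>log s x\<rfloor>"
  have s1: "real s > 1" using base_ge_2 by simp
  have "real s ^ K \<le> 1 * y * (1 / 2)" using assms by simp
  also have "\<dots> \<le> x" unfolding x_def using assms by (intro mult_mono) auto
  finally have xl: "real s ^ K \<le> x" .
  have "x \<le> real h * y * 1" unfolding x_def using assms by (intro mult_left_mono) auto
  then have xu: "x \<le> real s ^ L" using assms by simp
  have x0: "x > 0" using xl s1 by (smt (verit) zero_less_power)
  have "real K \<le> log s x" using xl x0 s1 by (simp add: le_log_iff powr_realpow)
  moreover have "log s x \<le> real L" using xu x0 s1 by (simp add: log_le_iff powr_realpow)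
  ultimately have f: "K \<le> f" "f \<le> L" "real f = of_int \<lfloor>log s x\<rfloor>"
    unfolding f_def by linarith+
  have "x / real s ^ L * real s ^ (L - f) = x / real s ^ f"
    using f s1 by (simp add: power_diff)
  also have "\<dots> = real s powr log s x / real s ^ f" using x0 s1 by simp
  also have "\<dots> = real s powr frac (log s x)"
    using s1 f(3) by (simp add: frac_def powr_diff flip: powr_realpow)
  finally have "x / real s ^ L * real s ^ (L - f) = real s powr frac (log s x)" .
  moreover have "char_prod L (x / real s ^ L) \<le> char_prod K (x / real s ^ L * real s ^ (L - f))"
    using f by (intro char_prod_window) auto
  ultimately show ?thesis by (simp add: x_def)
qed

text \<open>For positions at distance d = i - j, h (r^i - r^j) equals h r^i (1 - 1 / r^d), so up to
  an integer the rescaled logarithm to base s is i \<open>log s r\<close> plus a phase that depends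
  on h and d only. Grouping pairs by d gives orbits of one rotation, to which
  \<open>char_prod_orbit\<close> applies uniformly.\<close>

lemma average_weyl_sum_independent:
  assumes "r \<ge> 2" and "log s r \<notin> \<rat>" and "collision < 1" and "\<kappa> > 0"
  shows "\<exists>C N0. \<forall>N\<ge>N0. \<forall>l L j1 a h. 1 \<le> h \<longrightarrow> h \<le> H \<longrightarrow>
     (\<forall>j\<in>{j1..<j1+N}. C * s ^ l \<le> r ^ j \<and> H * r ^ j \<le> s ^ (l + L)) \<longrightarrow>
     average L (\<lambda>w. (norm (\<Sum>j\<in>{j1..<j1+N}. unit_exp (real h * real r ^ j * (a + real w / real s ^ (l + L)))))\<^sup>2)
       \<le> \<kappa> * (real N)\<^sup>2"
proof -
  obtain K N1 where orbit: "\<And>N i1 \<beta>. N \<ge> N1 \<Longrightarrow>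
    (\<Sum>i\<in>{i1..<i1+N}. char_prod K (real s powr frac (real i * log s r + \<beta>))) \<le> \<kappa> / 4 * real N"
    using char_prod_orbit[OF assms(2,3) divide_pos_pos[OF assms(4) zero_less_numeral]] by blast
  obtain N2 :: nat where N2: "2 / \<kappa> \<le> real N2" using real_arch_simple by blast
  \<comment> \<open>The factor 2 compensates for q \<ge> 1 / 2, and s^K makes room for the
    window.\<close>
  define C where "C = 2 * s ^ K"
  have s1: "real s > 1" and r1: "real r > 1" using base_ge_2 assms(1) by simp_all
  show ?thesis
  proof (rule exI[of _ C], rule exI[of _ "max N1 N2"], intro allI impI)
    fix N l L j1 a h
    assume N: "max N1 N2 \<le> N" and h: "1 \<le> h" "h \<le> H"
      and J: "\<forall>j\<in>{j1..<j1+N}. C * s ^ l \<le> r ^ j \<and> H * r ^ j \<le> s ^ (l + L)"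
    define J where "J = {j1..<j1+N}"
    have finJ: "finite J" by (simp add: J_def)
    define b where "b j = real h * real r ^ j / real s ^ (l + L)" for j
    define \<beta> where "\<beta> d = log s (real h * (1 - 1 / real r ^ d))" for d
    define G where "G d i = char_prod K (real s powr frac (real i * log s r + \<beta> d))" for d i
    have G0: "G d i \<ge> 0" for d i by (simp add: G_def char_prod_nonneg)
    have pair: "char_prod L (b i - b j) \<le> G (i - j) i" if "i \<in> J" "j \<in> J" "j < i" for i j
    proof -
      define q where "q = 1 - 1 / real r ^ (i - j)"
      define y where "y = real r ^ i / real s ^ l"
      have "real r ^ 1 \<le> real r ^ (i - j)" using that r1 by (intro power_increasing) auto
      moreover have "real r \<ge> 2" using assms(1) by simp
      ultimately have "real r ^ (i - j) \<ge> 2" by (simp only: power_one_right)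
      then have "1 / real r ^ (i - j) \<le> 1 / 2" using r1 by (intro divide_left_mono) auto
      then have q: "1 / 2 \<le> q" "q \<le> 1" using r1 by (simp_all add: q_def)
      have "C * s ^ l \<le> r ^ i" using J that by (auto simp: J_def)
      then have "real (C * s ^ l) \<le> real (r ^ i)" by (simp only: of_nat_le_iff)
      then have y: "real s ^ K * 2 \<le> y"
        using s1 by (simp add: y_def C_def field_simps)
      then have y1: "1 \<le> y" using s1 one_le_power[of "real s" K] by linarith
      have "H * r ^ i \<le> s ^ (l + L)" using J that by (auto simp: J_def)
      then have "h * r ^ i \<le> s ^ (l + L)" using mult_le_mono1[OF h(2)] order_trans by blast
      then have "real (h * r ^ i) \<le> real (s ^ (l + L))" by (simp only: of_nat_le_iff)
      then have yu: "real h * y \<le> real s ^ L"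
        using s1 by (simp add: y_def field_simps power_add)
      have rq: "real r ^ i * q = real r ^ i - real r ^ j"
        using that r1 by (simp add: q_def right_diff_distrib power_diff)
      have "b i - b j = real h * (real r ^ i - real r ^ j) / real s ^ (l + L)"
        by (simp add: b_def right_diff_distrib diff_divide_distrib)
      then have bb: "b i - b j = real h * y * q / real s ^ L"
        unfolding rq[symmetric] by (simp add: y_def power_add)
      have "log s (real h * y * q) = real i * log s r + \<beta> (i - j) + of_int (- int l)"
      proof -
        have "real h * y * q = (real r ^ i * (real h * q)) / real s ^ l" by (simp add: y_def)
        moreover have "log s (real r ^ i * c / real s ^ l) = real i * log s r + log s c - real l"
          if "c > 0" for c
          using that r1 s1 by (simp add: log_divide log_mult_pos log_nat_power)
        moreover have "real h * q > 0" using h q by simp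
        moreover have "\<beta> (i - j) = log s (real h * q)" by (simp only: \<beta>_def q_def)
        ultimately show ?thesis by simp
      qed
      then have "frac (log s (real h * y * q)) = frac (real i * log s r + \<beta> (i - j))"
        by (simp only: frac_add_of_int_right)
      then show ?thesis
        using char_prod_le_orbit[OF y1 y yu h(1) q] unfolding bb G_def by simp
    qed
    have lower: "(\<Sum>i\<in>J. \<Sum>j\<in>{j\<in>J. j < i}. G (i - j) i) \<le> \<kappa> / 4 * (real N)\<^sup>2"
    proof -
      have "(\<Sum>j\<in>{j\<in>J. j < i}. G (i - j) i) \<le> (\<Sum>d\<in>{1..N}. G d i)" if "i \<in> J" for i
      proof -
        have "(\<Sum>j\<in>{j\<in>J. j < i}. G (i - j) i) = (\<Sum>d\<in>(\<lambda>j. i - j) ` {j\<in>J. j < i}. G d i)"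
          by (subst sum.reindex) (auto simp: inj_on_def)
        also have "\<dots> \<le> (\<Sum>d\<in>{1..N}. G d i)"
          using that by (intro sum_mono2) (auto simp: J_def G0)
        finally show ?thesis .
      qed
      then have "(\<Sum>i\<in>J. \<Sum>j\<in>{j\<in>J. j < i}. G (i - j) i) \<le> (\<Sum>i\<in>J. \<Sum>d\<in>{1..N}. G d i)"
        by (rule sum_mono)
      also have "\<dots> = (\<Sum>d\<in>{1..N}. \<Sum>i\<in>J. G d i)" by (rule sum.swap)
      also have "\<dots> \<le> (\<Sum>d\<in>{1..N}. \<kappa> / 4 * real N)"
        unfolding G_def J_def using N by (intro sum_mono orbit) auto
      finally show ?thesis by (simp add: power2_eq_square mult_ac)
    qed
    have "average L (\<lambda>w. (norm (\<Sum>j\<in>J. unit_exp (real h * real r ^ j * (a + real w / real s ^ (l + L)))))\<^sup>2)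
       = average L (\<lambda>w. (norm (\<Sum>j\<in>J. unit_exp (real h * real r ^ j * a + b j * real w)))\<^sup>2)"
      by (simp add: b_def distrib_left)
    also have "\<dots> \<le> (\<Sum>i\<in>J. \<Sum>j\<in>J. char_prod L (b i - b j))"
      by (rule average_weyl_sum_le) (simp add: J_def)
    also have "\<dots> \<le> (\<Sum>i\<in>J. \<Sum>j\<in>J. (if i = j then 1 else 0) + (if j < i then G (i - j) i else 0)
        + (if i < j then G (j - i) j else 0))"
    proof (intro sum_mono)
      fix i j assume ij: "i \<in> J" "j \<in> J"
      consider "i = j" | "j < i" | "i < j" by linarith
      then show "char_prod L (b i - b j) \<le> (if i = j then 1 else 0) + (if j < i then G (i - j) i else 0)
        + (if i < j then G (j - i) j else 0)"
      proof cases
        case 3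
        then show ?thesis using pair[of j i] ij char_prod_minus[of L "b j - b i"] by simp
      qed (use pair ij char_prod_le_1 in auto)
    qed
    also have "\<dots> = real N + (\<Sum>i\<in>J. \<Sum>j\<in>{j\<in>J. j < i}. G (i - j) i) + (\<Sum>i\<in>J. \<Sum>j\<in>J. if i < j then G (j - i) j else 0)"
      unfolding sum.distrib sum.inter_filter[OF finJ] by (simp add: finJ) (simp add: J_def)
    also have "(\<Sum>i\<in>J. \<Sum>j\<in>J. if i < j then G (j - i) j else 0) = (\<Sum>i\<in>J. \<Sum>j\<in>{j\<in>J. j < i}. G (i - j) i)"
      unfolding sum.inter_filter[OF finJ] by (rule sum.swap)
    also have "real N + (\<Sum>i\<in>J. \<Sum>j\<in>{j\<in>J. j < i}. G (i - j) i) + (\<Sum>i\<in>J. \<Sum>j\<in>{j\<in>J. j < i}. G (i - j) i)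
       \<le> real N + \<kappa> / 4 * (real N)\<^sup>2 + \<kappa> / 4 * (real N)\<^sup>2"
      using lower by simp
    also have "\<dots> \<le> \<kappa> * (real N)\<^sup>2"
    proof -
      have "2 / \<kappa> \<le> real N" using N2 N by (meson max.boundedE of_nat_le_iff order_trans)
      then have "1 \<le> \<kappa> / 2 * real N" using assms(4) by (simp add: field_simps)
      then have "1 * real N \<le> \<kappa> / 2 * real N * real N" by (intro mult_right_mono) auto
      then show ?thesis by (simp add: power2_eq_square)
    qed
    finally show "average L (\<lambda>w. (norm (\<Sum>j\<in>{j1..<j1+N}. unit_exp (real h * real r ^ j * (a + real w / real s ^ (l + L)))))\<^sup>2)
       \<le> \<kappa> * (real N)\<^sup>2" by (simp add: J_def)
  qed
qed

end

text \<open>Here the frequency differences are fractions t / s^L with 0 < t < s^L, so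
  \<open>biased_char_prod\<close> charges \<epsilon> for each pair of distinct positions. Relative
  to N^2 this bound does not tend to 0; the tolerance for the biased base has to be matched to
  \<epsilon>.\<close>

lemma average_weyl_sum_same_base:
  assumes "s \<ge> 2" "0 \<le> \<epsilon>" "\<epsilon> \<le> 1" and "finite J" and "1 \<le> h" and "h \<le> H"
    and J: "\<And>j. j \<in> J \<Longrightarrow> l \<le> j \<and> H * s ^ j \<le> s ^ (l + L)"
  shows "digit_law.average s (biased_law s \<epsilon>) L
      (\<lambda>w. (norm (\<Sum>j\<in>J. unit_exp (real h * real s ^ j * (a + real w / real s ^ (l + L)))))\<^sup>2)
    \<le> real (card J) + \<epsilon> * (real (card J))\<^sup>2"
proof -
  interpret digit_law s "biased_law s \<epsilon>" by (rule digit_law_biased) fact+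
  define b where "b j = real h * real s ^ j / real s ^ (l + L)" for j
  have pair: "char_prod L (b i - b j) \<le> \<epsilon>" if "i \<in> J" "j \<in> J" "j < i" for i j
  proof -
    define t where "t = h * (s ^ (i - l) - s ^ (j - l))"
    have lt: "s ^ (j - l) < s ^ (i - l)"
      using that J[of j] assms(1) by (intro power_strict_increasing) auto
    have "s ^ i = s ^ l * s ^ (i - l)" using J[OF that(1)] by (simp flip: power_add)
    then have "s ^ l * (h * s ^ (i - l)) = h * s ^ i" by (simp add: mult_ac)
    also have "\<dots> \<le> s ^ (l + L)" using J[OF that(1)] assms by (meson mult_le_mono1 order_trans)
    finally have "h * s ^ (i - l) \<le> s ^ L" using assms by (simp add: power_add)
    moreover have "t < h * s ^ (i - l)" unfolding t_def using lt assms by (intro mult_strict_left_mono) auto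
    ultimately have t: "t < s ^ L" by linarith
    have t0: "0 < t" using lt assms by (simp add: t_def)
    have "real t = real h * (real s ^ (i - l) - real s ^ (j - l))"
      using lt by (simp add: t_def of_nat_diff)
    moreover have "real s ^ i = real s ^ l * real s ^ (i - l)" "real s ^ j = real s ^ l * real s ^ (j - l)"
      using J[OF that(1)] J[OF that(2)] by (simp_all flip: power_add)
    ultimately have "b i - b j = real t / real s ^ L"
      using assms by (simp add: b_def power_add field_simps)
    then show ?thesis using biased_char_prod[OF assms(1-3) t0 t] by simp
  qed
  have "average L (\<lambda>w. (norm (\<Sum>j\<in>J. unit_exp (real h * real s ^ j * (a + real w / real s ^ (l + L)))))\<^sup>2)
       = average L (\<lambda>w. (norm (\<Sum>j\<in>J. unit_exp (real h * real s ^ j * a + b j * real w)))\<^sup>2)"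
    by (simp add: b_def distrib_left)
  also have "\<dots> \<le> (\<Sum>i\<in>J. \<Sum>j\<in>J. char_prod L (b i - b j))"
    by (rule average_weyl_sum_le) fact
  also have "\<dots> \<le> (\<Sum>i\<in>J. \<Sum>j\<in>J. (if i = j then 1 else 0) + \<epsilon>)"
  proof (intro sum_mono)
    fix i j assume ij: "i \<in> J" "j \<in> J"
    consider "i = j" | "j < i" | "i < j" by linarith
    then show "char_prod L (b i - b j) \<le> (if i = j then 1 else 0) + \<epsilon>"
    proof cases
      case 1
      then show ?thesis using char_prod_le_1[of L 0] assms(2) by simp
    next
      case 3
      then show ?thesis using pair[of j i] ij char_prod_minus[of L "b j - b i"] by simp
    qed (use pair ij in auto)
  qed
  also have "\<dots> = real (card J) + \<epsilon> * (real (card J))\<^sup>2"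
    using assms by (simp add: sum.distrib power2_eq_square algebra_simps)
  finally show ?thesis .
qed

text \<open>
  The bias is so small that the squared Weyl sums in the biased base itself, summed over all
  frequencies below \<open>weyl_order k\<close>, stay within the tolerance of lemma \<open>weyl_cell_count\<close>.
\<close>

definition bias_scale :: "nat \<Rightarrow> nat" where
  "bias_scale k = 4 * (32 * weyl_order k * (32 * k * weyl_order k)\<^sup>2)"

text \<open>The numerator 4 pays for successive losses, counted in units of 1 /
  \<open>bias_scale k\<close>: as s \<ge> 2, the excess of digit 0 is at least 2; random fluctuation
  leaves 3/2, and the ends of the block leave 1, the amount required by
  \<open>biased_block\<close>.\<close>

definition bias :: "nat \<Rightarrow> real" where
  "bias k = 4 / real (bias_scale k)"

lemma bias_eq: "bias k = (weyl_tol k)\<^sup>2 / (32 * real (weyl_order k))"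
  by (simp add: bias_def bias_scale_def weyl_tol_def power_divide power_mult_distrib)

lemma weyl_order_pos: "k \<ge> 1 \<Longrightarrow> weyl_order k > 0"
  by (simp add: weyl_order_def)

lemma weyl_tol_pos: "k \<ge> 1 \<Longrightarrow> weyl_tol k > 0"
  by (simp add: weyl_tol_def weyl_order_def)

lemma bias_scale_ge:
  assumes "k \<ge> 1"
  shows "bias_scale k \<ge> 8"
proof -
  have "1 \<le> weyl_order k" using weyl_order_pos[OF assms] by simp
  moreover have "1 \<le> (32 * k * weyl_order k)\<^sup>2" using assms weyl_order_pos[OF assms] by simp
  ultimately have "32 * 1 * 1 \<le> 32 * weyl_order k * (32 * k * weyl_order k)\<^sup>2" by (intro mult_mono) auto
  then show ?thesis by (simp add: bias_scale_def)
qed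

lemma bias_bounds:
  assumes "k \<ge> 1"
  shows "0 < bias k" "bias k \<le> 1 / 2"
proof -
  have "real (bias_scale k) \<ge> 8" using bias_scale_ge[OF assms] by simp
  then show "0 < bias k" "bias k \<le> 1 / 2" by (simp_all add: bias_def field_simps)
qed

text \<open>A union bound by first moments: at a w where the sum of the nonnegative penalties is at
  most its average, hence below 1, every single penalty is below 1.\<close>

lemma (in digit_law) average_selection:
  fixes f :: "'i \<Rightarrow> nat \<Rightarrow> real"
  assumes "finite I" and "\<And>i w. i \<in> I \<Longrightarrow> f i w \<ge> 0"
    and "\<And>i. i \<in> I \<Longrightarrow> average L (f i) \<le> c i" and "(\<Sum>i\<in>I. c i) < 1"
  shows "\<exists>w < s ^ L. \<forall>i\<in>I. f i w < 1"
proof -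
  obtain w where w: "w < s ^ L" "(\<Sum>i\<in>I. f i w) \<le> average L (\<lambda>w. \<Sum>i\<in>I. f i w)"
    using average_witness[of L "\<lambda>w. \<Sum>i\<in>I. f i w"] by blast
  note w(2)
  also have "average L (\<lambda>w. \<Sum>i\<in>I. f i w) = (\<Sum>i\<in>I. average L (f i))"
    by (rule average_sum)
  also have "\<dots> \<le> (\<Sum>i\<in>I. c i)" using assms by (intro sum_mono) auto
  also have "\<dots> < 1" by fact
  finally have less: "(\<Sum>i\<in>I. f i w) < 1" .
  have "f i w < 1" if "i \<in> I" for i
    using member_le_sum[OF that, of "\<lambda>i. f i w"] assms less by force
  then show ?thesis using w(1) by blast
qed

lemma biased_collision_less_1:
  assumes "s \<ge> 2" "0 \<le> \<epsilon>" "\<epsilon> < 1"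
  shows "digit_law.collision s (biased_law s \<epsilon>) < 1"
proof -
  interpret digit_law s "biased_law s \<epsilon>" by (rule digit_law_biased) (use assms in auto)
  let ?p = "biased_law s \<epsilon>"
  have p0: "?p 0 < 1"
  proof -
    have "(1 - \<epsilon>) / real s \<le> (1 - \<epsilon>) / 2" using assms by (intro divide_left_mono) auto
    then show ?thesis using assms by (simp add: biased_law_def field_simps)
  qed
  have "?p 0 > 0" using assms by (simp add: biased_law_def add_pos_nonneg)
  have le: "?p d \<le> 1" if "d < s" for d
    using member_le_sum[of d "{..<s}" ?p] that p_nonneg p_sum by simp
  have "(\<Sum>d<s. (?p d)\<^sup>2) < (\<Sum>d<s. ?p d)"
  proof (rule sum_strict_mono_ex1)
    show "\<forall>d\<in>{..<s}. (?p d)\<^sup>2 \<le> ?p d"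
      using le p_nonneg by (auto simp: power2_eq_square intro!: mult_left_le)
    show "\<exists>d\<in>{..<s}. (?p d)\<^sup>2 < ?p d"
      using p0 \<open>?p 0 > 0\<close> assms by (intro bexI[of _ 0]) (auto simp: power2_eq_square)
  qed simp
  then show ?thesis using p_sum by (simp add: collision_def)
qed

text \<open>One choice of digits has to serve all bases and the bias at once. The penalties have a
  budget of 1/4 for the frequencies in base s, 1/8 for the other bases together and 1/4 for the
  number of zeros. \<open>C\<close>, \<open>N0\<close> and \<open>L0\<close> do not depend on the
  position l.\<close>

lemma weyl_sum_selection:
  fixes R :: "nat set" and m :: "nat \<Rightarrow> nat"
  assumes "s \<ge> 2" and "m s = k" and "finite R" and "s \<in> R"
    and R: "\<And>r. r \<in> R \<Longrightarrow> r \<ge> 2 \<and> m r \<ge> 1 \<and> weyl_order (m r) \<le> H"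
    and indep: "\<And>r. \<lbrakk>r \<in> R; r \<noteq> s\<rbrakk> \<Longrightarrow> log s r \<notin> \<rat>"
  shows "\<exists>C N0 L0. C \<ge> 1 \<and> (\<forall>l L a j1 N. L \<ge> L0 \<longrightarrow>
      (\<forall>r\<in>R. N r \<ge> N0 \<and> (\<forall>j\<in>{j1 r..<j1 r + N r}. l \<le> j \<or> r \<noteq> s) \<and>
         (\<forall>j\<in>{j1 r..<j1 r + N r}. C * s ^ l \<le> r ^ j \<and> H * r ^ j \<le> s ^ (l + L))) \<longrightarrow>
      (\<exists>w < s ^ L.
        (\<forall>r\<in>R. \<forall>h\<in>{1..<weyl_order (m r)}.
          norm (\<Sum>j\<in>{j1 r..<j1 r + N r}. unit_exp (real h * real r ^ j * (a + real w / real s ^ (l + L))))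
            \<le> weyl_tol (m r) / 2 * real (N r)) \<and>
        real L * (1 / real s + 3 / (2 * real (bias_scale k))) \<le> real (digit_law.zero_digits s L w)))"
proof -
  define \<epsilon> where "\<epsilon> = bias k"
  have k1: "k \<ge> 1" using R[OF assms(4)] assms(2) by simp
  have \<epsilon>: "0 < \<epsilon>" "\<epsilon> \<le> 1 / 2" using bias_bounds[OF k1] by (simp_all add: \<epsilon>_def)
  interpret digit_law s "biased_law s \<epsilon>" by (rule digit_law_biased) (use assms \<epsilon> in auto)
  have coll: "collision < 1" by (rule biased_collision_less_1) (use assms \<epsilon> in auto)
  define T where "T r = weyl_tol (m r)" for r
  define K where "K r = weyl_order (m r)" for r
  have T: "T r > 0" and K: "K r > 0" if "r \<in> R" for r
    using R[OF that] weyl_tol_pos weyl_order_pos by (auto simp: T_def K_def)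
  have cR: "card R > 0" using assms by (auto simp: card_gt_0_iff)
  \<comment> \<open>With this value the frequencies below K r cost at most 1 / (8 card R) for each
    base r other than s.\<close>
  define \<kappa> where "\<kappa> r = (T r)\<^sup>2 / (32 * real (card R) * real (K r))" for r
  have \<kappa>: "\<kappa> r > 0" if "r \<in> R" for r using T[OF that] K[OF that] cR by (simp add: \<kappa>_def)
  define P where "P r C N0 \<longleftrightarrow> (\<forall>N\<ge>N0. \<forall>l L j1 a h. 1 \<le> h \<longrightarrow> h \<le> H \<longrightarrow>
     (\<forall>j\<in>{j1..<j1+N}. C * s ^ l \<le> r ^ j \<and> H * r ^ j \<le> s ^ (l + L)) \<longrightarrow>
     average L (\<lambda>w. (norm (\<Sum>j\<in>{j1..<j1+N}. unit_exp (real h * real r ^ j * (a + real w / real s ^ (l + L)))))\<^sup>2)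
       \<le> \<kappa> r * (real N)\<^sup>2)" for r C N0
  have "\<exists>C N0. P r C N0" if "r \<in> R - {s}" for r
    using average_weyl_sum_independent[of r "\<kappa> r" H] that R[of r] indep[of r] \<kappa>[of r] coll
    unfolding P_def by blast
  then obtain Cf Nf where CN: "\<And>r. r \<in> R - {s} \<Longrightarrow> P r (Cf r) (Nf r)" by metis
  define C where "C = 1 + (\<Sum>r\<in>R. Cf r)"
  \<comment> \<open>From N \<ge> 1 / \<epsilon> on, the diagonal N is at most \<epsilon> N^2, which
    explains the value 2 \<epsilon> of \<open>\<mu>\<close> at s.\<close>
  obtain Ne :: nat where Ne: "1 / \<epsilon> \<le> real Ne" using real_arch_simple by blast
  define N0 where "N0 = 1 + Ne + (\<Sum>r\<in>R. Nf r)"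
  define \<zeta> where "\<zeta> = \<epsilon> / 8"
  have \<zeta>: "\<zeta> > 0" using \<epsilon> by (simp add: \<zeta>_def)
  \<comment> \<open>Chebyshev: the variance is at most L / 4 and a deviation \<zeta> L is allowed,
    so this L makes the average penalty at most 1/4.\<close>
  obtain L0 :: nat where L0: "1 / \<zeta>\<^sup>2 \<le> real L0" using real_arch_simple by blast
  have Cle: "Cf r \<le> C" and Nle: "Nf r \<le> N0" if "r \<in> R" for r
    using member_le_sum[OF that, of Cf] member_le_sum[OF that, of Nf] assms
    by (simp_all add: C_def N0_def)
  show ?thesis
  proof (rule exI[of _ C], rule exI[of _ N0], rule exI[of _ "Suc L0"], intro conjI allI impI)
    show "1 \<le> C" by (simp add: C_def)
    fix l L a j1 N
    assume L: "Suc L0 \<le> L"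
      and J: "\<forall>r\<in>R. N r \<ge> N0 \<and> (\<forall>j\<in>{j1 r..<j1 r + N r}. l \<le> j \<or> r \<noteq> s) \<and>
         (\<forall>j\<in>{j1 r..<j1 r + N r}. C * s ^ l \<le> r ^ j \<and> H * r ^ j \<le> s ^ (l + L))"
    define S where "S r h w = (norm (\<Sum>j\<in>{j1 r..<j1 r + N r}. unit_exp (real h * real r ^ j * (a + real w / real s ^ (l + L)))))\<^sup>2" for r h w
    define \<mu> where "\<mu> r = (if r = s then 2 * \<epsilon> else \<kappa> r)" for r
    have N1: "N r \<ge> 1" if "r \<in> R" for r using J that by (force simp: N0_def)
    have S: "average L (S r h) \<le> \<mu> r * (real (N r))\<^sup>2" if "r \<in> R" "1 \<le> h" "h < K r" for r h
    proof (cases "r = s")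
      case True
      have "h \<le> H" using R[OF that(1)] that by (simp add: K_def)
      then have "average L (S r h) \<le> real (card {j1 r..<j1 r + N r}) + \<epsilon> * (real (card {j1 r..<j1 r + N r}))\<^sup>2"
        unfolding S_def True using assms(1) \<epsilon> that J assms(4)
        by (intro average_weyl_sum_same_base) auto
      also have "\<dots> = real (N r) * 1 + \<epsilon> * (real (N r))\<^sup>2" by simp
      also have "\<dots> \<le> real (N r) * (\<epsilon> * real (N r)) + \<epsilon> * (real (N r))\<^sup>2"
      proof (intro add_right_mono mult_left_mono)
        have "1 / \<epsilon> \<le> real (N r)" using Ne J that by (force simp: N0_def)
        then show "1 \<le> \<epsilon> * real (N r)" using \<epsilon> by (simp add: field_simps)
      qed simp
      finally show ?thesis by (simp add: \<mu>_def True power2_eq_square mult_ac)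
    next
      case False
      have "P r (Cf r) (Nf r)" using CN that False by blast
      moreover have "N r \<ge> Nf r" using J Nle that order_trans by blast
      moreover have "h \<le> H" using R[OF that(1)] that by (simp add: K_def)
      moreover have "Cf r * s ^ l \<le> r ^ j \<and> H * r ^ j \<le> s ^ (l + L)" if "j \<in> {j1 r..<j1 r + N r}" for j
        using J \<open>r \<in> R\<close> that mult_le_mono1[OF Cle[OF \<open>r \<in> R\<close>], of "s ^ l"] by (meson order_trans)
      ultimately show ?thesis using that(2) False unfolding P_def S_def \<mu>_def by simp
    qed
    have T\<mu>: "\<mu> r * (4 / (T r)\<^sup>2) * real (K r) \<le> (if r = s then 1 / 4 else 0) + 1 / (8 * real (card R))" if "r \<in> R" for r
    proof (cases "r = s")
      case True
      have "\<mu> r = (T r)\<^sup>2 / (16 * real (K r))"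
        using bias_eq[of k] assms(2) by (simp add: \<mu>_def True \<epsilon>_def T_def K_def)
      then have "\<mu> r * (4 / (T r)\<^sup>2) * real (K r) = 1 / 4" using T[OF that] K[OF that] by (simp add: field_simps)
      then show ?thesis using True by simp
    next
      case False
      then have "\<mu> r * (4 / (T r)\<^sup>2) * real (K r) = 1 / (8 * real (card R))"
        using T[OF that] K[OF that] cR by (simp add: \<mu>_def \<kappa>_def field_simps)
      then show ?thesis using False by simp
    qed
    define Z where "Z w = (0 + real (zero_digits L w) - real L * biased_law s \<epsilon> 0)\<^sup>2" for w
    define I where "I = insert None (Some ` (SIGMA r:R. {1..<K r}))"
    \<comment> \<open>A penalty below 1 means a Weyl sum of at most half the tolerance; the other
      half is reserved for rounding to a dyadic rational.\<close>
    define f where "f i w = (case i of None \<Rightarrow> Z w * (1 / (\<zeta> * real L)\<^sup>2)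
       | Some rh \<Rightarrow> (case rh of (r, h) \<Rightarrow> S r h w * (4 / (T r * real (N r))\<^sup>2)))" for i w
    define c where "c i = (case i of None \<Rightarrow> 1 / 4 | Some rh \<Rightarrow> (case rh of (r, h::nat) \<Rightarrow> \<mu> r * (4 / (T r)\<^sup>2)))" for i
    have "\<exists>w < s ^ L. \<forall>i\<in>I. f i w < 1"
    proof (rule average_selection[where c = c])
      show "finite I" using assms by (simp add: I_def)
      show "f i w \<ge> 0" if "i \<in> I" for i w
        by (auto simp: f_def Z_def S_def split: option.split prod.split)
      show "average L (f i) \<le> c i" if iI: "i \<in> I" for i
      proof (cases i)
        case None
        let ?p = "biased_law s \<epsilon> 0"
        have L0': "real L > 0" using L by simp
        have "average L Z = real L * (?p * (1 - ?p))"
          using average_zero_digits_variance[of L 0] by (simp add: Z_def[abs_def])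
        also have "\<dots> \<le> real L * (1 / 4)"
        proof (rule mult_left_mono)
          have "0 \<le> (?p - 1 / 2)\<^sup>2" by simp
          then show "?p * (1 - ?p) \<le> 1 / 4" by (simp add: power2_eq_square algebra_simps)
        qed simp
        finally have Zle: "average L Z \<le> real L * (1 / 4)" .
        have "average L (f i) = average L (\<lambda>w. (1 / (\<zeta> * real L)\<^sup>2) *\<^sub>R Z w)"
          by (simp add: None f_def[abs_def])
        also have "\<dots> = (1 / (\<zeta> * real L)\<^sup>2) *\<^sub>R average L Z" by (rule average_scaleR)
        also have "\<dots> \<le> (1 / (\<zeta> * real L)\<^sup>2) * (real L * (1 / 4))"
          unfolding real_scaleR_def using Zle by (intro mult_left_mono) auto
        also have "\<dots> = (1 / \<zeta>\<^sup>2) / real L * (1 / 4)"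
          using L0' \<zeta> by (simp add: power_mult_distrib power2_eq_square)
        also have "\<dots> \<le> 1 * (1 / 4)"
        proof (rule mult_right_mono)
          have "1 / \<zeta>\<^sup>2 \<le> real L" using L0 L by linarith
          then show "1 / \<zeta>\<^sup>2 / real L \<le> 1" using L0' by (simp only: divide_le_eq_1_pos)
        qed simp
        finally show ?thesis by (simp add: None c_def)
      next
        case (Some rh)
        then obtain r h where rh: "rh = (r, h)" "r \<in> R" "1 \<le> h" "h < K r" using iI by (auto simp: I_def)
        have "average L (f i) = average L (\<lambda>w. (4 / (T r * real (N r))\<^sup>2) *\<^sub>R S r h w)"
          by (simp add: Some rh f_def[abs_def] mult.commute)
        also have "\<dots> = (4 / (T r * real (N r))\<^sup>2) *\<^sub>R average L (S r h)" by (rule average_scaleR)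
        also have "\<dots> \<le> (4 / (T r * real (N r))\<^sup>2) * (\<mu> r * (real (N r))\<^sup>2)"
          unfolding real_scaleR_def using S rh by (intro mult_left_mono) auto
        also have "\<dots> = \<mu> r * (4 / (T r)\<^sup>2)" using N1[OF rh(2)] T[OF rh(2)]
          by (simp add: power_mult_distrib)
        finally show ?thesis by (simp add: Some rh c_def)
      qed
      have "(\<Sum>i\<in>I. c i) = 1 / 4 + (\<Sum>x\<in>(SIGMA r:R. {1..<K r}). c (Some x))"
        unfolding I_def using assms by (subst sum.insert) (auto simp: sum.reindex c_def[of None])
      also have "(\<Sum>x\<in>(SIGMA r:R. {1..<K r}). c (Some x)) = (\<Sum>r\<in>R. \<Sum>h\<in>{1..<K r}. \<mu> r * (4 / (T r)\<^sup>2))"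
        using assms by (subst sum.Sigma) (auto simp: c_def)
      also have "\<dots> \<le> (\<Sum>r\<in>R. (if r = s then 1 / 4 else 0) + 1 / (8 * real (card R)))"
      proof (rule sum_mono)
        fix r assume r: "r \<in> R"
        have \<mu>0: "\<mu> r * (4 / (T r)\<^sup>2) \<ge> 0" using \<epsilon> \<kappa>[OF r] by (simp add: \<mu>_def)
        have "(\<Sum>h\<in>{1..<K r}. \<mu> r * (4 / (T r)\<^sup>2)) = real (K r - 1) * (\<mu> r * (4 / (T r)\<^sup>2))" by simp
        also have "\<dots> \<le> real (K r) * (\<mu> r * (4 / (T r)\<^sup>2))" using \<mu>0 by (intro mult_right_mono) auto
        finally show "(\<Sum>h\<in>{1..<K r}. \<mu> r * (4 / (T r)\<^sup>2)) \<le> (if r = s then 1 / 4 else 0) + 1 / (8 * real (card R))"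
          using T\<mu>[OF r] by (simp add: mult_ac)
      qed
      also have "\<dots> = 1 / 4 + 1 / 8" using assms(3,4) by (simp add: sum.distrib card_gt_0_iff) auto
      finally show "(\<Sum>i\<in>I. c i) < 1" by simp
    qed
    then obtain w where w: "w < s ^ L" "\<And>i. i \<in> I \<Longrightarrow> f i w < 1" by blast
    have weyl: "norm (\<Sum>j\<in>{j1 r..<j1 r + N r}. unit_exp (real h * real r ^ j * (a + real w / real s ^ (l + L))))
            \<le> weyl_tol (m r) / 2 * real (N r)" if r: "r \<in> R" and h: "h \<in> {1..<weyl_order (m r)}" for r h
    proof -
      have "real (N r) > 0" using N1[OF r] by linarith
      then have TN: "T r * real (N r) > 0" by (rule mult_pos_pos[OF T[OF r]])
      have "f (Some (r, h)) w < 1" using r h by (intro w(2)) (auto simp: I_def K_def)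
      then have "S r h w * (4 / (T r * real (N r))\<^sup>2) < 1" by (simp add: f_def)
      moreover have "(T r * real (N r))\<^sup>2 > 0" using TN by (rule zero_less_power)
      ultimately have "S r h w * 4 < (T r * real (N r))\<^sup>2" by (simp add: divide_less_eq)
      also have "\<dots> = (T r / 2 * real (N r))\<^sup>2 * 4" by (simp add: power2_eq_square)
      finally have "S r h w \<le> (T r / 2 * real (N r))\<^sup>2" by linarith
      moreover have "0 \<le> T r / 2 * real (N r)" using TN by linarith
      ultimately show ?thesis unfolding S_def T_def by (rule power2_le_imp_le)
    qed
    have zero: "real L * (1 / real s + 3 / (2 * real (bias_scale k))) \<le> real (zero_digits L w)"
    proof -
      have L0': "\<zeta> * real L > 0" using L \<zeta> by simp
      have "f None w < 1" by (intro w(2)) (simp add: I_def)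
      then have "Z w * (1 / (\<zeta> * real L)\<^sup>2) < 1" by (simp add: f_def)
      moreover have "(\<zeta> * real L)\<^sup>2 > 0" using L0' by (rule zero_less_power)
      ultimately have "Z w < (\<zeta> * real L)\<^sup>2" by (simp add: divide_less_eq)
      then have "\<bar>0 + real (zero_digits L w) - real L * biased_law s \<epsilon> 0\<bar>\<^sup>2 < (\<zeta> * real L)\<^sup>2"
        by (simp only: Z_def power2_abs)
      then have "\<bar>0 + real (zero_digits L w) - real L * biased_law s \<epsilon> 0\<bar> < \<zeta> * real L"
        by (rule power2_less_imp_less) (rule less_imp_le[OF L0'])
      then have "real L * (biased_law s \<epsilon> 0 - \<zeta>) \<le> real (zero_digits L w)" by (simp add: algebra_simps)
      moreover have "1 / real s + 3 / (2 * real (bias_scale k)) \<le> biased_law s \<epsilon> 0 - \<zeta>"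
      proof -
        have "\<epsilon> / real s \<le> \<epsilon> / 2" using base_ge_2 \<epsilon> by (intro divide_left_mono) auto
        moreover have "biased_law s \<epsilon> 0 = 1 / real s - \<epsilon> / real s + \<epsilon>"
          by (simp add: biased_law_def diff_divide_distrib)
        ultimately have "1 / real s + 3 * \<epsilon> / 8 \<le> biased_law s \<epsilon> 0 - \<zeta>"
          unfolding \<zeta>_def by linarith
        then show ?thesis by (simp add: \<epsilon>_def bias_def)
      qed
      ultimately show ?thesis
        by (meson mult_left_mono of_nat_0_le_iff order_trans)
    qed
    show "\<exists>w < s ^ L.
        (\<forall>r\<in>R. \<forall>h\<in>{1..<weyl_order (m r)}.
          norm (\<Sum>j\<in>{j1 r..<j1 r + N r}. unit_exp (real h * real r ^ j * (a + real w / real s ^ (l + L))))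
            \<le> weyl_tol (m r) / 2 * real (N r)) \<and>
        real L * (1 / real s + 3 / (2 * real (bias_scale k))) \<le> real (zero_digits L w)"
      by (rule exI[of _ w], rule conjI, rule w(1), rule conjI, intro ballI, erule (1) weyl, rule zero)
  qed
qed

section \<open>Blocks of digits\<close>

definition ilog :: "nat \<Rightarrow> nat \<Rightarrow> nat" where
  "ilog r x = (LEAST j. x \<le> r ^ j)"

lemma self_le_power: "x \<le> r ^ x" if "r \<ge> 2" for r x :: nat
proof -
  have "x \<le> 2 ^ x" using less_exp[of x] by simp
  also have "\<dots> \<le> r ^ x" using that by (intro power_mono) auto
  finally show ?thesis .
qed

lemma ilog_le_iff:
  assumes "r \<ge> 2"
  shows "ilog r x \<le> j \<longleftrightarrow> x \<le> r ^ j"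
proof
  assume "ilog r x \<le> j"
  have "x \<le> r ^ ilog r x" unfolding ilog_def by (rule LeastI[of "\<lambda>j. x \<le> r ^ j" x, OF self_le_power[OF assms]])
  also have "\<dots> \<le> r ^ j" using assms \<open>ilog r x \<le> j\<close> by (intro power_increasing) auto
  finally show "x \<le> r ^ j" .
qed (simp add: ilog_def Least_le)

lemma less_ilog_iff: "r \<ge> 2 \<Longrightarrow> j < ilog r x \<longleftrightarrow> r ^ j < x"
  using ilog_le_iff[of r x j] by linarith

lemma ilog_mono: "r \<ge> 2 \<Longrightarrow> x \<le> y \<Longrightarrow> ilog r x \<le> ilog r y"
  by (meson ilog_le_iff order_refl order_trans)

lemma ilog_le_self: "r \<ge> 2 \<Longrightarrow> ilog r x \<le> x"
  by (simp add: ilog_le_iff self_le_power)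

lemma ilog_mult_le: "r \<ge> 2 \<Longrightarrow> ilog r (c * x) \<le> ilog r c + ilog r x"
  by (metis ilog_le_iff mult_le_mono order_refl power_add)

lemma ilog_power_mult_ge:
  assumes "r \<ge> 2" "x \<ge> 1"
  shows "i + ilog r x \<le> ilog r (r ^ i * x)"
proof -
  define J where "J = ilog r (r ^ i * x)"
  have le: "r ^ i * x \<le> r ^ J" using ilog_le_iff[OF assms(1)] J_def by blast
  have "r ^ i * 1 \<le> r ^ i * x" using assms by (intro mult_left_mono) auto
  then have "r ^ i \<le> r ^ J" using le by linarith
  then have iJ: "i \<le> J" using assms by (simp add: power_le_imp_le_exp)
  then have "r ^ J = r ^ i * r ^ (J - i)" by (simp flip: power_add)
  then have "x \<le> r ^ (J - i)" using le assms by simp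
  then have "ilog r x \<le> J - i" using ilog_le_iff[OF assms(1)] by blast
  then show ?thesis using iJ by (simp add: J_def)
qed

lemma power_div_le:
  fixes r L :: nat
  shows "r ^ (L div r) \<le> 2 ^ L"
proof -
  have "r ^ (L div r) \<le> (2 ^ r) ^ (L div r)" using less_exp[of r] by (intro power_mono) auto
  also have "\<dots> = 2 ^ (r * (L div r))" by (simp add: power_mult)
  also have "\<dots> \<le> 2 ^ L" by (intro power_increasing) auto
  finally show ?thesis .
qed

text \<open>As r \<le> 2^r, every r further binary digits account for at least one more digit to
  base r. The crude rate is enough, since L may be chosen large.\<close>

lemma ilog_two_power_add_ge:
  assumes "r \<ge> 2"
  shows "ilog r (2 ^ n) + L div r \<le> ilog r (2 ^ (n + L))"
proof -
  have "L div r + ilog r (2 ^ n) \<le> ilog r (r ^ (L div r) * 2 ^ n)"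
    using assms by (intro ilog_power_mult_ge) auto
  also have "\<dots> \<le> ilog r (2 ^ (n + L))"
    using assms power_div_le[of r L] by (intro ilog_mono) (simp_all add: power_add)
  finally show ?thesis by simp
qed

text \<open>
  If the number is known with precision \<open>2 ^ -n\<close>, then the digits to base \<open>r\<close> at the
  positions below \<open>digits_known r n\<close> can be considered as decided.
\<close>

definition digits_known :: "nat \<Rightarrow> nat \<Rightarrow> nat" where
  "digits_known r n = card {j. j < n \<and> r ^ j < 2 ^ n}"

text \<open>The bounded count is the form in which the quantity is computed; estimates use the
  logarithm.\<close>

lemma digits_known_eq: "r \<ge> 2 \<Longrightarrow> digits_known r n = ilog r (2 ^ n)"
proof -
  assume r: "r \<ge> 2"
  have "j < n" if "r ^ j < 2 ^ n" for j
  proof -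
    have "2 ^ j \<le> r ^ j" using r by (intro power_mono) auto
    also have "\<dots> < 2 ^ n" by fact
    finally show ?thesis by simp
  qed
  then have "{j. j < n \<and> r ^ j < 2 ^ n} = {..<ilog r (2 ^ n)}"
    using less_ilog_iff[OF r] by auto
  then show ?thesis by (simp add: digits_known_def)
qed

lemma less_digits_known_iff: "r \<ge> 2 \<Longrightarrow> j < digits_known r n \<longleftrightarrow> r ^ j < 2 ^ n"
  by (simp add: digits_known_eq less_ilog_iff)

text \<open>The index of the interval of length 1 / m containing the fractional part of r^j a / 2^n,
  in integer arithmetic so that it is computable; for m = r it is a digit.\<close>

definition cell :: "nat \<Rightarrow> nat \<Rightarrow> nat \<Rightarrow> nat \<Rightarrow> nat \<Rightarrow> nat" where
  "cell r m a n j = m * (r ^ j * a mod 2 ^ n) div 2 ^ n"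

lemma frac_of_nat_div: "frac (real y / real q) = real (y mod q) / real q" if "q > 0"
proof -
  have "real y = real q * real (y div q) + real (y mod q)" by (simp flip: of_nat_mult of_nat_add)
  then have "real y / real q = real (y div q) + real (y mod q) / real q"
    using that by (simp add: field_simps)
  then show ?thesis
    unfolding frac_def floor_divide_of_nat_eq by simp
qed

lemma cell_eq_floor: "int (cell r m a n j) = \<lfloor>real m * frac (real r ^ j * (real a / 2 ^ n))\<rfloor>"
proof -
  have "frac (real r ^ j * (real a / 2 ^ n)) = frac (real (r ^ j * a) / real (2 ^ n))" by simp
  also have "\<dots> = real (r ^ j * a mod 2 ^ n) / real (2 ^ n)" by (rule frac_of_nat_div) simp
  finally have "real m * frac (real r ^ j * (real a / 2 ^ n)) = real (m * (r ^ j * a mod 2 ^ n)) / real (2 ^ n)"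
    by simp
  then show ?thesis by (simp only: cell_def floor_divide_of_nat_eq)
qed

definition block :: "nat \<Rightarrow> nat \<Rightarrow> nat \<Rightarrow> nat set" where
  "block r n n' = {digits_known r n..<digits_known r n'}"

text \<open>The lower bound q^2 makes the at most q final positions, whose cells are unreliable, a
  fraction of at most 1 / q of the block. The upper bound makes the block a fraction of at most 1 /
  q of the past. Counts may exceed the expected value by the factor 1 + 1 / m.\<close>

definition even_block :: "nat \<Rightarrow> nat \<Rightarrow> nat \<Rightarrow> nat \<Rightarrow> nat \<Rightarrow> nat \<Rightarrow> bool" where
  "even_block r m q a' n n' \<longleftrightarrow>
     q\<^sup>2 \<le> card (block r n n') \<and> q * card (block r n n') \<le> digits_known r n \<and>
     (\<forall>c<m. m\<^sup>2 * card {j \<in> block r n n'. cell r m a' n' j = c} \<le> (m + 1) * card (block r n n'))"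

text \<open>The lower bound 1 / s + 1 / \<open>bias_scale k\<close> for the frequency of the digit
  0, with denominators cleared for the sake of decidability.\<close>

definition biased_block :: "nat \<Rightarrow> nat \<Rightarrow> nat \<Rightarrow> nat \<Rightarrow> nat \<Rightarrow> bool" where
  "biased_block s k a' n n' \<longleftrightarrow>
     (bias_scale k + s) * card (block s n n')
       \<le> bias_scale k * s * card {j \<in> block s n n'. cell s s a' n' j = 0}"

lemma floor_div_of_interval:
  assumes "real V \<le> t" "t < real V + 1" "q > 0"
  shows "\<lfloor>t / real q\<rfloor> = int (V div q)"
proof (rule floor_unique)
  have V: "V = q * (V div q) + V mod q" by simp
  have "V mod q + 1 \<le> q" using assms(3) by (simp add: Suc_leI)
  then have "V + 1 \<le> q * (V div q) + q" using V by linarith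
  then have "real (V + 1) \<le> real (q * (V div q) + q)" by (simp only: of_nat_le_iff)
  then have "t < real q * (real (V div q) + 1)" using assms by (simp add: distrib_left)
  then show "t / real q < real_of_int (int (V div q)) + 1" using assms by (simp add: divide_less_eq mult.commute)
  have "q * (V div q) \<le> V" by simp
  then have "real (q * (V div q)) \<le> real V" by (simp only: of_nat_le_iff)
  then have "real q * real (V div q) \<le> t" using assms by simp
  then show "real_of_int (int (V div q)) \<le> t / real q" using assms by (simp add: le_divide_eq mult.commute)
qed

text \<open>The dyadic number lies in the s-adic interval with numerator V = A s^L + w, so it shares
  the digits of V. Positions are counted from the most significant digit and the digits of w from
  the least significant one, hence the exponent L - 1 - i.\<close>

lemma cell_eq_digit:
  fixes s l L A w :: nat
  assumes "s \<ge> 2" and "i < L"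
    and "real (A * s ^ L + w) \<le> real a' / 2 ^ n' * real s ^ (l + L)"
    and "real a' / 2 ^ n' * real s ^ (l + L) < real (A * s ^ L + w) + 1"
  shows "cell s s a' n' (l + i) = (w div s ^ (L - 1 - i)) mod s"
proof -
  define e where "e = L - 1 - i"
  define V where "V = A * s ^ L + w"
  define t where "t = real a' / 2 ^ n' * real s ^ (l + L)"
  define y where "y = real s ^ (l + i) * (real a' / 2 ^ n')"
  have L: "L = i + 1 + e" using assms(2) by (simp add: e_def)
  have s0: "s > 0" using assms(1) by simp
  have sy: "real s * y = t / real (s ^ e)" using s0 by (simp add: y_def t_def L power_add)
  have y: "y = t / real (s ^ e * s)" using s0 by (simp add: y_def t_def L power_add)
  have fsy: "\<lfloor>real s * y\<rfloor> = int (V div s ^ e)"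
    unfolding sy using assms s0 by (intro floor_div_of_interval) (simp_all add: V_def t_def)
  have fy: "\<lfloor>y\<rfloor> = int (V div (s ^ e * s))"
    unfolding y using assms s0 by (intro floor_div_of_interval) (simp_all add: V_def t_def)
  have "real s * frac y = real s * y + of_int (- (int s * \<lfloor>y\<rfloor>))" by (simp add: frac_def right_diff_distrib)
  then have "\<lfloor>real s * frac y\<rfloor> = \<lfloor>real s * y\<rfloor> + (- (int s * \<lfloor>y\<rfloor>))" by (simp only: floor_add_int)
  also have "\<dots> = int (V div s ^ e) - int s * int (V div s ^ e div s)"
    by (simp add: fsy fy div_mult2_eq)
  also have "\<dots> = int ((V div s ^ e) mod s)" by (simp add: zmod_int minus_div_mult_eq_mod[symmetric] zdiv_int)
  finally have "cell s s a' n' (l + i) = (V div s ^ e) mod s"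
    using cell_eq_floor[of s s a' n' "l + i"] by (simp add: y_def)
  also have "V = w + (A * s ^ i * s) * s ^ e" by (simp add: V_def L power_add mult_ac)
  also have "(w + (A * s ^ i * s) * s ^ e) div s ^ e = A * s ^ i * s + w div s ^ e"
    using s0 by (simp only: div_mult_self1[OF power_not_zero[OF gr_implies_not_zero]])
  finally show ?thesis by (simp add: e_def)
qed

lemma zero_cells_ge_zero_digits:
  fixes s l L A w :: nat
  assumes "s \<ge> 2" and "{l..<l+L} \<subseteq> B" and "finite B"
    and "real (A * s ^ L + w) \<le> real a' / 2 ^ n' * real s ^ (l + L)"
    and "real a' / 2 ^ n' * real s ^ (l + L) < real (A * s ^ L + w) + 1"
  shows "digit_law.zero_digits s L w \<le> card {j \<in> B. cell s s a' n' j = 0}"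
proof -
  interpret digit_law s "biased_law s 0" by (rule digit_law_biased) (use assms in auto)
  let ?f = "\<lambda>i. l + (L - 1 - i)"
  let ?I = "{i. i < L \<and> (w div s ^ i) mod s = 0}"
  have "inj_on ?f ?I" by (auto simp: inj_on_def)
  moreover have "?f ` ?I \<subseteq> {j \<in> B. cell s s a' n' j = 0}"
  proof
    fix j assume "j \<in> ?f ` ?I"
    then obtain i where i: "i < L" "(w div s ^ i) mod s = 0" "j = l + (L - 1 - i)" by auto
    have "cell s s a' n' j = (w div s ^ (L - 1 - (L - 1 - i))) mod s"
      unfolding i(3) using i assms by (intro cell_eq_digit[OF assms(1) _ assms(4,5)]) auto
    then have "cell s s a' n' j = 0" using i by simp
    moreover have "j \<in> B" using i assms(2) by auto
    ultimately show "j \<in> {j \<in> B. cell s s a' n' j = 0}" by simp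
  qed
  moreover have "finite {j \<in> B. cell s s a' n' j = 0}" using assms(3) by simp
  ultimately show ?thesis unfolding zero_digits_def by (rule card_inj_on_le)
qed

lemma weyl_sum_perturb:
  fixes x x' :: real
  assumes "x \<le> x'" "x' \<le> x + \<theta>" and "\<And>j. j \<in> J \<Longrightarrow> 2 * pi * (real h * real r ^ j * \<theta>) \<le> \<eta>"
  shows "norm (\<Sum>j\<in>J. unit_exp (real h * (real r ^ j * x')))
     \<le> norm (\<Sum>j\<in>J. unit_exp (real h * (real r ^ j * x))) + \<eta> * real (card J)"
proof -
  have "norm (\<Sum>j\<in>J. unit_exp (real h * (real r ^ j * x')) - unit_exp (real h * (real r ^ j * x)))
     \<le> (\<Sum>j\<in>J. norm (unit_exp (real h * (real r ^ j * x')) - unit_exp (real h * (real r ^ j * x))))"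
    by (rule norm_sum)
  also have "\<dots> \<le> (\<Sum>j\<in>J. \<eta>)"
  proof (rule sum_mono)
    fix j assume j: "j \<in> J"
    have "norm (unit_exp (real h * (real r ^ j * x')) - unit_exp (real h * (real r ^ j * x)))
       \<le> 2 * pi * \<bar>real h * (real r ^ j * x') - real h * (real r ^ j * x)\<bar>"
      by (rule norm_unit_exp_diff_le)
    also have "real h * (real r ^ j * x') - real h * (real r ^ j * x) = real h * real r ^ j * (x' - x)"
      by (simp add: algebra_simps)
    also have "2 * pi * \<bar>real h * real r ^ j * (x' - x)\<bar> \<le> 2 * pi * (real h * real r ^ j * \<theta>)"
      using assms(1,2) by (intro mult_left_mono) (auto simp: abs_mult intro!: mult_left_mono)
    also have "\<dots> \<le> \<eta>" using assms j by blast
    finally show "norm (unit_exp (real h * (real r ^ j * x')) - unit_exp (real h * (real r ^ j * x))) \<le> \<eta>" .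
  qed
  finally have "norm ((\<Sum>j\<in>J. unit_exp (real h * (real r ^ j * x'))) - (\<Sum>j\<in>J. unit_exp (real h * (real r ^ j * x))))
     \<le> \<eta> * real (card J)" by (simp add: sum_subtractf mult.commute)
  then show ?thesis by (smt (verit) norm_triangle_sub)
qed

text \<open>The Weyl estimate on J costs 1/(2 m^2) and the positions outside J cost another 1/(2
  m^2); after multiplication by m^2 the two halves give the 1 in m + 1.\<close>

lemma cell_count_le_of_weyl:
  assumes "m \<ge> 1" "c < m" "finite B" "J \<subseteq> B" "2 * m\<^sup>2 * card (B - J) \<le> card B"
    and "\<And>h. \<lbrakk>1 \<le> h; h < weyl_order m\<rbrakk> \<Longrightarrow>
      norm (\<Sum>j\<in>J. unit_exp (real h * (real r ^ j * (real a' / 2 ^ n')))) \<le> weyl_tol m * real (card J)"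
  shows "m\<^sup>2 * card {j \<in> B. cell r m a' n' j = c} \<le> (m + 1) * card B"
proof -
  have finJ: "finite J" using assms finite_subset by blast
  have eq: "{j\<in>J. cell r m a' n' j = c} = {j\<in>J. \<lfloor>real m * frac (real r ^ j * (real a' / 2 ^ n'))\<rfloor> = int c}"
    by (simp only: cell_eq_floor[symmetric] of_nat_eq_iff)
  have "real (card {j\<in>J. cell r m a' n' j = c}) \<le> real (card J) * (1 / real m + 1 / (2 * (real m)\<^sup>2))"
    unfolding eq using assms finJ by (intro weyl_cell_count) auto
  also have "\<dots> \<le> real (card B) * (1 / real m + 1 / (2 * (real m)\<^sup>2))"
    using assms card_mono[OF assms(3,4)] by (intro mult_right_mono) auto
  finally have J: "real (card {j\<in>J. cell r m a' n' j = c}) \<le> real (card B) * (1 / real m + 1 / (2 * (real m)\<^sup>2))" .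
  have "{j \<in> B. cell r m a' n' j = c} \<subseteq> {j \<in> J. cell r m a' n' j = c} \<union> (B - J)" by auto
  then have "card {j \<in> B. cell r m a' n' j = c} \<le> card ({j \<in> J. cell r m a' n' j = c} \<union> (B - J))"
    using finJ assms by (intro card_mono) auto
  also have "\<dots> \<le> card {j \<in> J. cell r m a' n' j = c} + card (B - J)" by (rule card_Un_le)
  finally have "real (card {j \<in> B. cell r m a' n' j = c}) \<le> real (card B) * (1 / real m + 1 / (2 * (real m)\<^sup>2)) + real (card (B - J))"
    using J by linarith
  then have "(real m)\<^sup>2 * real (card {j \<in> B. cell r m a' n' j = c})
     \<le> (real m)\<^sup>2 * (real (card B) * (1 / real m + 1 / (2 * (real m)\<^sup>2)) + real (card (B - J)))"
    by (intro mult_left_mono) auto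
  also have "\<dots> = real m * real (card B) + real (card B) / 2 + (real m)\<^sup>2 * real (card (B - J))"
    using assms(1) by (simp add: field_simps power2_eq_square)
  also have "\<dots> \<le> real m * real (card B) + real (card B)"
  proof -
    have "real (2 * m\<^sup>2 * card (B - J)) \<le> real (card B)" using assms(5) by (simp only: of_nat_le_iff)
    then show ?thesis by simp
  qed
  finally have "real (m\<^sup>2 * card {j \<in> B. cell r m a' n' j = c}) \<le> real ((m + 1) * card B)"
    by (simp add: algebra_simps)
  then show ?thesis by (simp only: of_nat_le_iff)
qed

lemma log_minimal_bases_irrational:
  assumes "r \<in> minimal_bases" "s \<in> minimal_bases" "r \<noteq> s"
  shows "log s r \<notin> \<rat>"
proof
  assume Q: "log s r \<in> \<rat>"
  have rs: "2 \<le> r" "2 \<le> s" using assms by (auto simp: minimal_bases_def)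
  then have "real r = real s powr log s r" by simp
  then have "mult_dependent r s" "mult_dependent s r" using Q by (auto simp: mult_dependent_def)
  then have "s \<le> r" "r \<le> s" using assms rs by (auto simp: minimal_bases_def)
  then show False using assms by simp
qed

text \<open>The condition n' \<le> 2 n makes the search finite. The strict inequality for a' + 1
  keeps the limit off the right end points, where binary expansions are ambiguous. The bound
  \<open>max q s\<close> makes the quantifier over bases visibly bounded. Level 0 stands for no bias
  at all.\<close>

definition good_block :: "nat \<Rightarrow> nat \<Rightarrow> nat \<Rightarrow> nat \<Rightarrow> nat \<Rightarrow> nat \<Rightarrow> nat \<Rightarrow> bool" where
  "good_block s k q a n a' n' \<longleftrightarrow>
     n < n' \<and> n' \<le> 2 * n \<and> a * 2 ^ (n' - n) \<le> a' \<and> a' + 1 < (a + 1) * 2 ^ (n' - n) \<and>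
     (\<forall>r \<le> max q s. r \<in> minimal_bases \<longrightarrow> r \<le> q \<or> r = s \<longrightarrow>
        even_block r (if r = s then k else q) q a' n n') \<and>
     (k > 0 \<longrightarrow> biased_block s k a' n n')"

section \<open>Existence of good blocks\<close>

lemma block_card_bounds:
  assumes r: "r \<ge> 2" and n': "n + L \<le> n'" "2 ^ n' \<le> U * 2 ^ n"
  shows "L div r \<le> card (block r n n')" "card (block r n n') \<le> ilog r U"
proof -
  have "ilog r (2 ^ (n + L)) \<le> ilog r (2 ^ n')" using r n' by (intro ilog_mono power_increasing) auto
  then show "L div r \<le> card (block r n n')"
    using ilog_two_power_add_ge[OF r, of n L] by (simp add: block_def digits_known_eq r)
  have "ilog r (2 ^ n') \<le> ilog r U + ilog r (2 ^ n)"
    using ilog_mono[OF r n'(2)] ilog_mult_le[OF r, of U "2 ^ n"] by linarith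
  then show "card (block r n n') \<le> ilog r U" by (simp add: block_def digits_known_eq r)
qed

lemma digits_known_ge_div: "r \<ge> 2 \<Longrightarrow> n div r \<le> digits_known r n"
  using ilog_two_power_add_ge[of r 0 n] by (simp add: digits_known_eq)

text \<open>The central part of a block, on which the Weyl sums can be controlled.\<close>

definition core_start :: "nat \<Rightarrow> nat \<Rightarrow> nat \<Rightarrow> nat" where
  "core_start C r n = ilog r (C * 2 ^ n)"

text \<open>C keeps the core away from the digits fixed before, G from the limit of precision; the
  summand 1 makes the core end before the first j with G r^j > 2^n'.\<close>

definition core_length :: "nat \<Rightarrow> nat \<Rightarrow> nat \<Rightarrow> nat \<Rightarrow> nat \<Rightarrow> nat" where
  "core_length C G r n n' = ilog r (2 ^ n' div G + 1) - core_start C r n"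

lemma core_bounds:
  fixes r C G n n' :: nat
  assumes r: "r \<ge> 2" and C: "C \<ge> 1" and G: "G \<ge> 2" and n': "n' \<ge> 1"
  defines "J \<equiv> {core_start C r n..<core_start C r n + core_length C G r n n'}"
  shows "j \<in> J \<Longrightarrow> C * 2 ^ n \<le> r ^ j \<and> G * r ^ j \<le> 2 ^ n'"
    and "J \<subseteq> block r n n'"
    and "card (block r n n' - J) \<le> C + G"
    and "card (block r n n') \<le> card J + (C + G)"
proof -
  let ?j1 = "core_start C r n" and ?j2 = "ilog r (2 ^ n' div G + 1)"
  have J: "J = {?j1..<?j2}" by (auto simp: J_def core_length_def)
  have B: "block r n n' = {ilog r (2 ^ n)..<ilog r (2 ^ n')}" by (simp add: block_def digits_known_eq r)
  show "C * 2 ^ n \<le> r ^ j \<and> G * r ^ j \<le> 2 ^ n'" if "j \<in> J"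
  proof
    show "C * 2 ^ n \<le> r ^ j" using that by (auto simp: J core_start_def ilog_le_iff r)
    have "r ^ j \<le> 2 ^ n' div G" using that by (auto simp: J less_ilog_iff r)
    then have "G * r ^ j \<le> G * (2 ^ n' div G)" by (rule mult_le_mono2)
    also have "\<dots> \<le> 2 ^ n'" by simp
    finally show "G * r ^ j \<le> 2 ^ n'" .
  qed
  have start: "ilog r (2 ^ n) \<le> ?j1" unfolding core_start_def using r C by (intro ilog_mono) auto
  have "(2::nat) \<le> 2 ^ n'" using power_increasing[of 1 n' "2::nat"] n' by simp
  moreover have "2 ^ n' div G \<le> (2::nat) ^ n' div 2" using G by (intro div_le_mono2) auto
  ultimately have "2 ^ n' div G + 1 \<le> (2::nat) ^ n'" by linarith
  then have stop: "?j2 \<le> ilog r (2 ^ n')" using r by (intro ilog_mono)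
  show sub: "J \<subseteq> block r n n'" unfolding J B using start stop by auto
  have "?j1 \<le> ilog r C + ilog r (2 ^ n)" unfolding core_start_def by (rule ilog_mult_le[OF r])
  then have s1: "?j1 \<le> C + ilog r (2 ^ n)" using ilog_le_self[OF r, of C] by linarith
  have "2 ^ n' = G * (2 ^ n' div G) + 2 ^ n' mod G" by simp
  also have "2 ^ n' mod G \<le> G" using G by (simp add: less_imp_le)
  finally have "2 ^ n' \<le> G * (2 ^ n' div G + 1)" by simp
  then have "ilog r (2 ^ n') \<le> ilog r (G * (2 ^ n' div G + 1))" using r by (intro ilog_mono)
  also have "\<dots> \<le> ilog r G + ?j2" by (rule ilog_mult_le[OF r])
  finally have s2: "ilog r (2 ^ n') \<le> G + ?j2" using ilog_le_self[OF r, of G] by linarith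
  have "block r n n' - J \<subseteq> {ilog r (2 ^ n)..<?j1} \<union> {?j2..<ilog r (2 ^ n')}" unfolding J B by auto
  then have "card (block r n n' - J) \<le> card ({ilog r (2 ^ n)..<?j1} \<union> {?j2..<ilog r (2 ^ n')})"
    by (intro card_mono) auto
  also have "\<dots> \<le> card {ilog r (2 ^ n)..<?j1} + card {?j2..<ilog r (2 ^ n')}" by (rule card_Un_le)
  also have "\<dots> \<le> C + G" using s1 s2 by simp
  finally show le: "card (block r n n' - J) \<le> C + G" .
  have "card (block r n n') \<le> card (J \<union> (block r n n' - J))"
    by (intro card_mono) (auto simp: J_def block_def)
  also have "\<dots> \<le> card J + card (block r n n' - J)" by (rule card_Un_le)
  finally show "card (block r n n') \<le> card J + (C + G)" using le by linarith
qed

text \<open>From a / 2^n pass up to an s-adic grid point A / s^l, append L digits supplied by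
  \<open>weyl_sum_selection\<close>, and round up to a dyadic rational. L depends only on s, k and
  q, so the number of new positions stays bounded while n grows, and the block becomes short
  relative to the past.\<close>

lemma good_block_exists:
  assumes "s \<in> minimal_bases" and k: "1 \<le> k" "k \<le> q"
  shows "\<exists>n0. \<forall>n\<ge>n0. \<forall>a. \<exists>a' n'. good_block s k q a n a' n'"
proof -
  have s2: "s \<ge> 2" using assms by (auto simp: minimal_bases_def)
  define R where "R = {r \<in> minimal_bases. r \<le> q} \<union> {s}"
  define m where "m r = (if r = s then k else q)" for r
  have finR: "finite R" by (simp add: R_def)
  have R: "r \<ge> 2 \<and> 1 \<le> m r \<and> m r \<le> q \<and> r \<le> q + s \<and> r \<in> minimal_bases" if "r \<in> R" for r
    using that k assms by (auto simp: R_def m_def minimal_bases_def)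
  define H where "H = Max ((weyl_order \<circ> m) ` R)"
  have HR: "weyl_order (m r) \<le> H" if "r \<in> R" for r
    unfolding H_def using that finR by (intro Max_ge) auto
  obtain C0 N0 L0 where C0: "C0 \<ge> 1" and sel: "\<forall>l L a j1 N. L \<ge> L0 \<longrightarrow>
      (\<forall>r\<in>R. N r \<ge> N0 \<and> (\<forall>j\<in>{j1 r..<j1 r + N r}. l \<le> j \<or> r \<noteq> s) \<and>
         (\<forall>j\<in>{j1 r..<j1 r + N r}. C0 * s ^ l \<le> r ^ j \<and> H * r ^ j \<le> s ^ (l + L))) \<longrightarrow>
      (\<exists>w < s ^ L.
        (\<forall>r\<in>R. \<forall>h\<in>{1..<weyl_order (m r)}.
          norm (\<Sum>j\<in>{j1 r..<j1 r + N r}. unit_exp (real h * real r ^ j * (a + real w / real s ^ (l + L))))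
            \<le> weyl_tol (m r) / 2 * real (N r)) \<and>
        real L * (1 / real s + 3 / (2 * real (bias_scale k))) \<le> real (digit_law.zero_digits s L w))"
  proof -
    have "m s = k" "s \<in> R" by (simp_all add: m_def R_def)
    have RH: "r \<ge> 2 \<and> m r \<ge> 1 \<and> weyl_order (m r) \<le> H" if "r \<in> R" for r
      using R[OF that] HR[OF that] by blast
    have indep: "log s r \<notin> \<rat>" if "r \<in> R" "r \<noteq> s" for r
      using log_minimal_bases_irrational[OF _ assms(1) that(2)] R[OF that(1)] by blast
    show ?thesis
      by (rule exE[OF weyl_sum_selection[where m = m and H = H, OF s2 \<open>m s = k\<close> finR \<open>s \<in> R\<close>]],
          erule RH, erule (1) indep, elim exE conjE, erule (1) that)
  qed
  \<comment> \<open>Core positions must be so far from the precision 2^-n' that rounding changes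
    each term of a Weyl sum by at most half the tolerance.\<close>
  have "\<exists>g :: nat \<Rightarrow> nat. \<forall>r. 4 * pi * real H / weyl_tol (m r) \<le> real (g r)"
    by (intro choice allI real_arch_simple)
  then obtain g :: "nat \<Rightarrow> nat" where g: "\<And>r. 4 * pi * real H / weyl_tol (m r) \<le> real (g r)"
    by blast
  define G where "G = 2 + 2 * H + (\<Sum>r\<in>R. g r)"
  have gG: "g r \<le> G" if "r \<in> R" for r
    using member_le_sum[OF that, of g] finR by (simp add: G_def)
  \<comment> \<open>The factor 4 s is needed because s^l may be as large as s 2^(n + 2).\<close>
  define C where "C = 4 * s * C0"
  have C1: "C \<ge> 1" using C0 s2 by (simp add: C_def)
  have G2: "G \<ge> 2" by (simp add: G_def)
  \<comment> \<open>Minimal length of a block: q^2 for evenness, N0 for the core, and enough to make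
    the C + G boundary positions a fraction of at most 1/(2 q^2).\<close>
  define b where "b = q\<^sup>2 + N0 + (2 * q\<^sup>2 + 1) * (C + G)"
  \<comment> \<open>The first summand yields b positions in every base up to q + s; the second
    outweighs the up to 4 additional positions of base s in the bias estimate.\<close>
  define L where "L = (q + s) * b + 5 * (bias_scale k + s) + L0"
  define U where "U = 8 * s ^ (L + 1)"
  have bL: "b \<le> L div r" if "r \<in> R" for r
  proof -
    have r: "0 < r" "r \<le> q + s" using R[OF that] by auto
    have "b * r \<le> (q + s) * b" using r by simp
    also have "\<dots> \<le> L" by (simp add: L_def)
    finally show ?thesis using r by (simp add: less_eq_div_iff_mult_less_eq)
  qed
  \<comment> \<open>The threshold serves two purposes: q times the block length becomes at most n
    div r, and n' \<le> U + n becomes at most 2 n.\<close>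
  show ?thesis
  proof (rule exI[of _ "(q + s + 1) * (q + 1) * U"], intro allI impI)
    fix n a assume n: "(q + s + 1) * (q + 1) * U \<le> n"
    \<comment> \<open>The 2 in the exponent leaves at least four s-adic steps in the given interval:
      one for rounding a / 2^n up, one for the appended digits, the rest for rounding to precision
      n'.\<close>
    define l where "l = ilog s (2 ^ (n + 2))"
    define n' where "n' = ilog 2 (s ^ (l + L))"
    define A where "A = a * s ^ l div 2 ^ n + 1"
    have l1: "2 ^ (n + 2) \<le> s ^ l" using ilog_le_iff[OF s2] l_def by blast
    have l2: "s ^ l \<le> s * 2 ^ (n + 2)"
    proof (cases l)
      case (Suc i)
      then have "s ^ i < 2 ^ (n + 2)" using less_ilog_iff[OF s2] l_def by (metis lessI)
      then show ?thesis using Suc by simp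
    qed (use s2 in simp)
    have n'1: "s ^ (l + L) \<le> 2 ^ n'" using ilog_le_iff[of 2] n'_def by blast
    have n'2: "2 ^ n' \<le> 2 * s ^ (l + L)"
    proof (cases n')
      case (Suc i)
      then have "2 ^ i < s ^ (l + L)" using less_ilog_iff[of 2] n'_def by (metis lessI order_refl)
      then show ?thesis using Suc by simp
    qed (use s2 in simp)
    have "(2::nat) ^ (n + 2 + L) \<le> 2 ^ n'"
    proof -
      have "2 ^ (n + 2 + L) = 2 ^ (n + 2) * (2::nat) ^ L" by (simp add: power_add)
      also have "\<dots> \<le> s ^ l * s ^ L" using l1 s2 by (intro mult_mono power_mono) auto
      also have "\<dots> \<le> 2 ^ n'" using n'1 by (simp add: power_add)
      finally show ?thesis .
    qed
    then have nL: "n + 2 + L \<le> n'" by (rule power_le_imp_le_exp[rotated]) simp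
    have nU: "2 ^ n' \<le> U * 2 ^ n"
    proof -
      have "2 * s ^ (l + L) \<le> 2 * ((s * 2 ^ (n + 2)) * s ^ L)"
        unfolding power_add using l2 by (intro mult_mono) auto
      also have "\<dots> = U * 2 ^ n" by (simp add: U_def)
      finally show ?thesis using n'2 by linarith
    qed
    have n2n: "n' \<le> 2 * n"
    proof -
      have "U * 2 ^ n \<le> 2 ^ U * 2 ^ n" using less_exp[of U] by simp
      then have "(2::nat) ^ n' \<le> 2 ^ (U + n)" using nU unfolding power_add by (rule order_trans[rotated])
      then have "n' \<le> U + n" by (rule power_le_imp_le_exp[rotated]) simp
      also have "U \<le> (q + s + 1) * (q + 1) * U" by simp
      finally show ?thesis using n by linarith
    qed
    define j1 where "j1 r = core_start C r n" for r
    define N where "N r = core_length C G r n n'" for r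
    have n'0: "n' \<ge> 1" using nL by linarith
    note core = core_bounds[OF _ C1 G2 n'0, where n = n, folded j1_def N_def]
    have card_lower: "b \<le> card (block r n n')" if "r \<in> R" for r
      using block_card_bounds(1)[of r n L n' U] bL[OF that] R[OF that] nL nU by linarith
    have card_upper: "card (block r n n') \<le> ilog r U" if "r \<in> R" for r
      using block_card_bounds(2)[of r n L n' U] R[OF that] nL nU by linarith
    have N: "N r \<ge> N0" if "r \<in> R" for r
    proof -
      have "card (block r n n') \<le> N r + (C + G)" using core(4)[of r] R[OF that] by simp
      then show ?thesis using card_lower[OF that] by (simp add: b_def)
    qed
    have J: "C0 * s ^ l \<le> r ^ j \<and> H * r ^ j \<le> s ^ (l + L)" if "r \<in> R" "j \<in> {j1 r..<j1 r + N r}" for r j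
    proof
      have cj: "C * 2 ^ n \<le> r ^ j" "G * r ^ j \<le> 2 ^ n'" using core(1)[of r j] R[OF that(1)] that(2) by auto
      have "C0 * s ^ l \<le> C0 * (s * 2 ^ (n + 2))" using l2 by (rule mult_le_mono2)
      also have "\<dots> = C * 2 ^ n" by (simp add: C_def)
      finally show "C0 * s ^ l \<le> r ^ j" using cj by linarith
      have "2 * H * r ^ j \<le> G * r ^ j" by (rule mult_le_mono1) (simp add: G_def)
      then show "H * r ^ j \<le> s ^ (l + L)" using cj n'2 by linarith
    qed
    have Js: "l \<le> j" if "j \<in> {j1 s..<j1 s + N s}" for j
    proof -
      have "s ^ l \<le> C0 * s ^ l" using C0 by simp
      also have "\<dots> \<le> s ^ j" using J[of s j] that by (simp add: R_def)
      finally show ?thesis using s2 by (simp add: power_le_imp_le_exp)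
    qed
    have "L \<ge> L0" by (simp add: L_def)
    note sel[THEN spec, of l, THEN spec, of L, THEN spec, of "real A / real s ^ l",
        THEN spec, of j1, THEN spec, of N, THEN mp, OF this, THEN mp]
    then obtain w where w: "w < s ^ L"
      and weyl: "\<And>r h. \<lbrakk>r \<in> R; h \<in> {1..<weyl_order (m r)}\<rbrakk> \<Longrightarrow>
          norm (\<Sum>j\<in>{j1 r..<j1 r + N r}. unit_exp (real h * real r ^ j * (real A / real s ^ l + real w / real s ^ (l + L))))
            \<le> weyl_tol (m r) / 2 * real (N r)"
      and zero: "real L * (1 / real s + 3 / (2 * real (bias_scale k))) \<le> real (digit_law.zero_digits s L w)"
      using N J Js by blast
    define X where "X = real A / real s ^ l + real w / real s ^ (l + L)"
    define a' where "a' = nat \<lceil>2 ^ n' * X\<rceil>"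
    define x' where "x' = real a' / 2 ^ n'"
    have X0: "X \<ge> 0" by (simp add: X_def)
    have a'1: "2 ^ n' * X \<le> real a'" using X0 by (simp add: a'_def)
    have a'2: "real a' < 2 ^ n' * X + 1"
    proof -
      have "real a' = real_of_int \<lceil>2 ^ n' * X\<rceil>" using X0 by (simp add: a'_def)
      then show ?thesis using ceiling_correct[of "2 ^ n' * X"] by linarith
    qed
    have x'1: "X \<le> x'" using a'1 by (simp add: x'_def field_simps)
    have x'2: "x' < X + 1 / 2 ^ n'" using a'2 by (simp add: x'_def field_simps)
    have s0: "real s > 0" using s2 by simp
    have n's: "1 / 2 ^ n' \<le> 1 / real s ^ (l + L)"
    proof -
      have "real (s ^ (l + L)) \<le> real (2 ^ n')" using n'1 by (simp only: of_nat_le_iff)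
      then show ?thesis using s0 by (intro divide_left_mono) auto
    qed
    have XV: "X * real s ^ (l + L) = real (A * s ^ L + w)"
      using s0 unfolding X_def power_add by (simp add: distrib_right)
    have V1: "real (A * s ^ L + w) \<le> real a' / 2 ^ n' * real s ^ (l + L)"
      unfolding XV[symmetric] x'_def[symmetric] using x'1 by (intro mult_right_mono) auto
    have V2: "real a' / 2 ^ n' * real s ^ (l + L) < real (A * s ^ L + w) + 1"
    proof -
      have "x' < X + 1 / real s ^ (l + L)" using x'2 n's by linarith
      then have "x' * real s ^ (l + L) < (X + 1 / real s ^ (l + L)) * real s ^ (l + L)"
        using s0 by (intro mult_strict_right_mono) auto
      also have "\<dots> = real (A * s ^ L + w) + 1" using s0 by (simp add: XV distrib_right)
      finally show ?thesis by (simp add: x'_def)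
    qed
    have s_block: "{l..<l+L} \<subseteq> block s n n'"
    proof
      fix j assume j: "j \<in> {l..<l+L}"
      have "2 ^ n \<le> (2::nat) ^ (n + 2)" by simp
      also have "\<dots> \<le> s ^ j" using l1 j s2 by (meson atLeastLessThan_iff le_trans one_le_numeral order_trans power_increasing)
      finally have "\<not> s ^ j < 2 ^ n" by simp
      moreover have "s ^ j < s ^ (l + L)" using j s2 by (intro power_strict_increasing) auto
      ultimately show "j \<in> block s n n'" using n'1 less_digits_known_iff[OF s2]
        by (auto simp: block_def not_less[symmetric])
    qed
    have sR: "s \<in> R" by (simp add: R_def)
    have "good_block s k q a n a' n'"
      unfolding good_block_def
    proof (intro conjI allI impI)
      show "n < n'" using nL by linarith
      show "n' \<le> 2 * n" by (rule n2n)
      have A1: "real a / 2 ^ n \<le> real A / real s ^ l" and A2: "real A / real s ^ l \<le> real a / 2 ^ n + 1 / real s ^ l"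
      proof -
        have "real (a * s ^ l div 2 ^ n) = of_int \<lfloor>real (a * s ^ l) / real (2 ^ n)\<rfloor>"
          by (simp only: floor_divide_of_nat_eq of_int_of_nat_eq)
        then have "real (a * s ^ l) / real (2 ^ n) \<le> real A" "real A \<le> real (a * s ^ l) / real (2 ^ n) + 1"
          unfolding A_def by (simp_all del: of_nat_mult of_nat_power) linarith+
        then show "real a / 2 ^ n \<le> real A / real s ^ l" "real A / real s ^ l \<le> real a / 2 ^ n + 1 / real s ^ l"
          using s0 by (simp_all add: field_simps)
      qed
      have n_split: "(2::real) ^ n' = 2 ^ n * 2 ^ (n' - n)" using nL by (simp flip: power_add)
      show "a * 2 ^ (n' - n) \<le> a'"
      proof -
        have "real A / real s ^ l \<le> X" by (simp add: X_def)
        then have "real a / 2 ^ n * 2 ^ n' \<le> X * 2 ^ n'" using A1 by (intro mult_right_mono) auto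
        moreover have "real (a * 2 ^ (n' - n)) = real a / 2 ^ n * 2 ^ n'" by (simp add: n_split)
        ultimately have "real (a * 2 ^ (n' - n)) \<le> real a'" using a'1 by (simp only: mult.commute[of X])
        then show ?thesis by (simp only: of_nat_le_iff)
      qed
      show "a' + 1 < (a + 1) * 2 ^ (n' - n)"
      proof -
        have lin: "x < y + b + d \<Longrightarrow> y \<le> a + v \<Longrightarrow> b \<le> v \<Longrightarrow> d \<le> v * (1 / 4) \<Longrightarrow> v \<le> u * (1 / 4)
            \<Longrightarrow> 0 < u \<Longrightarrow> x + d < a + u" for x y b d a v u :: real by linarith
        have w1: "real w / real s ^ (l + L) \<le> 1 / real s ^ l"
        proof -
          have "real w \<le> real (s ^ L)" using w by (simp only: of_nat_le_iff)
          then show ?thesis using s0 by (simp add: field_simps power_add)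
        qed
        have w2: "1 / 2 ^ n' \<le> 1 / real s ^ l * (1 / 4)"
        proof -
          have "1 / (2::real) ^ n' \<le> 1 / (real s ^ l * 4)"
          proof (rule divide_left_mono)
            have "L \<ge> 2" using s2 by (simp add: L_def)
            then have "(2::nat) ^ 2 \<le> 2 ^ L" by (rule power_increasing) simp
            also have "2 ^ L \<le> s ^ L" using s2 by (rule power_mono) simp
            finally have "s ^ l * 4 \<le> s ^ l * s ^ L" by simp
            then have "s ^ l * 4 \<le> 2 ^ n'" using n'1 unfolding power_add by linarith
            then have "real (s ^ l * 4) \<le> real (2 ^ n')" by (simp only: of_nat_le_iff)
            then show "real s ^ l * 4 \<le> 2 ^ n'" by simp
          qed (use s0 in auto)
          then show ?thesis by simp
        qed
        have w3: "1 / real s ^ l \<le> 1 / 2 ^ n * (1 / 4)"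
        proof -
          have "real (2 ^ (n + 2)) \<le> real (s ^ l)" using l1 by (simp only: of_nat_le_iff)
          then have "1 / real s ^ l \<le> 1 / (2 ^ n * 4)" using s0 by (intro divide_left_mono) (auto simp: power_add)
          then show ?thesis by simp
        qed
        have "x' + 1 / 2 ^ n' < real a / 2 ^ n + 1 / 2 ^ n"
          by (rule lin[OF x'2[unfolded X_def] A2 w1 w2 w3]) simp
        then have "(x' + 1 / 2 ^ n') * 2 ^ n' < (real a / 2 ^ n + 1 / 2 ^ n) * 2 ^ n'"
          by (intro mult_strict_right_mono) auto
        then have "real a' + 1 < (real a + 1) * 2 ^ (n' - n)"
          by (simp add: x'_def n_split distrib_right)
        then have "real (a' + 1) < real ((a + 1) * 2 ^ (n' - n))" by (simp add: distrib_right)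
        then show ?thesis by (simp only: of_nat_less_iff)
      qed
    next
      fix r assume "r \<le> max q s" "r \<in> minimal_bases" "r \<le> q \<or> r = s"
      then have r: "r \<in> R" by (auto simp: R_def)
      let ?B = "block r n n'" and ?J = "{j1 r..<j1 r + N r}"
      have r2: "r \<ge> 2" and m1: "m r \<ge> 1" and mq: "m r \<le> q" using R[OF r] by auto
      have weyl': "norm (\<Sum>j\<in>?J. unit_exp (real h * (real r ^ j * (real a' / 2 ^ n')))) \<le> weyl_tol (m r) * real (card ?J)"
        if h: "1 \<le> h" "h < weyl_order (m r)" for h
      proof -
        have "2 * pi * (real h * real r ^ j * (1 / 2 ^ n')) \<le> weyl_tol (m r) / 2" if j: "j \<in> ?J" for j
        proof -
          have "G * r ^ j \<le> 2 ^ n'" using core(1)[OF r2 j] by blast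
          then have "real (G * r ^ j) \<le> real (2 ^ n')" by (simp only: of_nat_le_iff)
          then have Gj: "real G * (real r ^ j / 2 ^ n') \<le> 1" by (simp add: field_simps)
          have "real h \<le> real H" using h HR[OF r] by simp
          then have "4 * pi * real h / weyl_tol (m r) \<le> 4 * pi * real H / weyl_tol (m r)"
            using weyl_tol_pos[OF m1] by (intro divide_right_mono mult_left_mono) auto
          also have "\<dots> \<le> real G" using g[of r] gG[OF r] by linarith
          finally have "4 * pi * real h \<le> real G * weyl_tol (m r)"
            using weyl_tol_pos[OF m1] by (simp add: divide_le_eq)
          then have "4 * pi * real h * (real r ^ j / 2 ^ n') \<le> real G * weyl_tol (m r) * (real r ^ j / 2 ^ n')"
            by (intro mult_right_mono) auto
          also have "\<dots> = weyl_tol (m r) * (real G * (real r ^ j / 2 ^ n'))" by (simp add: mult_ac)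
          also have "\<dots> \<le> weyl_tol (m r) * 1"
            using Gj weyl_tol_pos[OF m1] by (intro mult_left_mono) auto
          finally show ?thesis by simp
        qed
        then have "norm (\<Sum>j\<in>?J. unit_exp (real h * (real r ^ j * x')))
           \<le> norm (\<Sum>j\<in>?J. unit_exp (real h * (real r ^ j * X))) + weyl_tol (m r) / 2 * real (card ?J)"
          using x'1 x'2 by (intro weyl_sum_perturb[where \<theta> = "1 / 2 ^ n'"]) auto
        moreover have "norm (\<Sum>j\<in>?J. unit_exp (real h * (real r ^ j * X))) \<le> weyl_tol (m r) / 2 * real (card ?J)"
          using weyl[OF r, of h] h by (simp add: X_def mult.assoc)
        ultimately show ?thesis by (simp add: x'_def)
      qed
      show "even_block r (if r = s then k else q) q a' n n'"
        unfolding even_block_def m_def[symmetric]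
      proof (intro conjI allI impI)
        show "q\<^sup>2 \<le> card ?B" using card_lower[OF r] by (simp add: b_def)
        have "card ?B \<le> U" using card_upper[OF r] ilog_le_self[OF r2, of U] by linarith
        then have "q * card ?B * r \<le> (q + 1) * U * (q + s + 1)"
          using R[OF r] by (intro mult_mono) auto
        also have "\<dots> \<le> n" using n by (simp only: mult_ac)
        finally have "q * card ?B \<le> n div r" using r2 by (simp add: less_eq_div_iff_mult_less_eq)
        then show "q * card ?B \<le> digits_known r n" using digits_known_ge_div[OF r2, of n] by linarith
        fix c assume c: "c < m r"
        have "(m r)\<^sup>2 \<le> q\<^sup>2" using mq by (rule power_mono) simp
        then have "2 * (m r)\<^sup>2 * card (?B - ?J) \<le> 2 * q\<^sup>2 * (C + G)"
          using core(3)[OF r2] by (intro mult_mono) auto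
        also have "\<dots> \<le> card ?B" using card_lower[OF r] by (simp add: b_def)
        finally have "2 * (m r)\<^sup>2 * card (?B - ?J) \<le> card ?B" .
        then show "(m r)\<^sup>2 * card {j \<in> ?B. cell r (m r) a' n' j = c} \<le> (m r + 1) * card ?B"
          using core(2)[OF r2] m1 c weyl'
          by (intro cell_count_le_of_weyl[where J = ?J]) (auto simp: block_def)
      qed
    next
      show "biased_block s k a' n n'"
      proof -
        let ?B = "block s n n'" and ?W = "bias_scale k"
        have "card ?B \<le> ilog s (8 * s ^ (L + 1))" using card_upper[OF sR] by (simp add: U_def)
        also have "\<dots> \<le> L + 4"
        proof -
          have "(2::nat) ^ 3 \<le> s ^ 3" using s2 by (rule power_mono) simp
          then have "8 * s ^ (L + 1) \<le> s ^ 3 * s ^ (L + 1)" by simp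
          also have "\<dots> = s ^ (L + 4)" by (simp add: power_add eval_nat_numeral)
          finally show ?thesis using ilog_le_iff[OF s2] by blast
        qed
        finally have "card ?B \<le> L + 4" .
        then have "real (card ?B) \<le> real L + 4" by linarith
        then have "(real ?W + real s) * real (card ?B) \<le> (real ?W + real s) * (real L + 4)"
          by (intro mult_left_mono) auto
        \<comment> \<open>The margin is spent here: with W the bias scale, L \<ge> 5 (W + s) and s
          \<ge> 2 give 4 (W + s) \<le> L s / 2.\<close>
        also have "\<dots> \<le> real L * (real ?W + 3 / 2 * real s)"
        proof -
          have "5 * (?W + s) \<le> L" by (simp add: L_def)
          then have "real (5 * (?W + s)) \<le> real L" by (simp only: of_nat_le_iff)
          then have "5 * (real ?W + real s) \<le> real L" by simp
          moreover have "real L * 2 \<le> real L * real s" using s2 by (intro mult_left_mono) auto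
          ultimately show ?thesis by (simp add: algebra_simps)
        qed
        also have "\<dots> = real ?W * real s * (real L * (1 / real s + 3 / (2 * real ?W)))"
        proof -
          have scale: "z * (x + 3 / 2 * y) = x * y * (z * (1 / y + 3 / (2 * x)))" if "x > 0" "y > 0" for x y z :: real
            using that by (simp add: field_simps)
          have "real ?W > 0" using bias_scale_ge[OF k(1)] by simp
          then show ?thesis using s0 by (rule scale)
        qed
        also have "\<dots> \<le> real ?W * real s * real (card {j \<in> ?B. cell s s a' n' j = 0})"
        proof (rule mult_left_mono)
          have "digit_law.zero_digits s L w \<le> card {j \<in> ?B. cell s s a' n' j = 0}"
            using zero_cells_ge_zero_digits[OF s2 s_block _ V1 V2] by (simp add: block_def)
          then show "real L * (1 / real s + 3 / (2 * real ?W)) \<le> real (card {j \<in> ?B. cell s s a' n' j = 0})"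
            using zero by linarith
        qed simp
        finally have "real ((?W + s) * card ?B) \<le> real (?W * s * card {j \<in> ?B. cell s s a' n' j = 0})"
          by simp
        then show ?thesis unfolding biased_block_def by (simp only: of_nat_le_iff)
      qed
    qed
    then show "\<exists>a' n'. good_block s k q a n a' n'" by blast
  qed
qed

section \<open>Discrepancy\<close>

definition visits :: "nat \<Rightarrow> real \<Rightarrow> nat set \<Rightarrow> real \<Rightarrow> real \<Rightarrow> nat" where
  "visits r \<xi> B u v = card {j \<in> B. u \<le> frac (real r ^ j * \<xi>) \<and> frac (real r ^ j * \<xi>) < v}"

lemma visits_le_card: "finite B \<Longrightarrow> visits r \<xi> B u v \<le> card B"
  unfolding visits_def by (intro card_mono) auto

text \<open>At these positions an error of 2^-n' in the number can move the point by more than 1 /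
  q. Their powers r^j span a factor q, so there are at most \<open>ilog r q\<close> of them.\<close>

lemma card_late_positions:
  assumes r: "r \<ge> 2" and q: "q \<ge> 1"
  shows "card {j \<in> block r n n'. 2 ^ n' < q * r ^ j} \<le> q"
proof -
  let ?i = "ilog r (2 ^ n' div q + 1)"
  have "{j \<in> block r n n'. 2 ^ n' < q * r ^ j} \<subseteq> {?i..<ilog r (2 ^ n')}"
  proof
    fix j assume j: "j \<in> {j \<in> block r n n'. 2 ^ n' < q * r ^ j}"
    have "\<not> r ^ j \<le> 2 ^ n' div q"
    proof
      assume "r ^ j \<le> 2 ^ n' div q"
      then have "q * r ^ j \<le> q * (2 ^ n' div q)" by (rule mult_le_mono2)
      also have "\<dots> \<le> 2 ^ n'" by simp
      finally show False using j by simp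
    qed
    then have "?i \<le> j" by (simp add: ilog_le_iff[OF r])
    then show "j \<in> {?i..<ilog r (2 ^ n')}" using j by (simp add: block_def digits_known_eq[OF r])
  qed
  then have "card {j \<in> block r n n'. 2 ^ n' < q * r ^ j} \<le> card {?i..<ilog r (2 ^ n')}"
    by (rule card_mono[rotated]) simp
  also have "\<dots> \<le> q"
  proof -
    have "2 ^ n' = q * (2 ^ n' div q) + 2 ^ n' mod q" by simp
    also have "2 ^ n' mod q \<le> q" using q by (simp add: less_imp_le)
    finally have "2 ^ n' \<le> q * (2 ^ n' div q + 1)" by simp
    then have "ilog r (2 ^ n') \<le> ilog r (q * (2 ^ n' div q + 1))" using r by (intro ilog_mono)
    also have "\<dots> \<le> ilog r q + ?i" by (rule ilog_mult_le[OF r])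
    finally show ?thesis using ilog_le_self[OF r, of q] by simp
  qed
  finally show ?thesis .
qed

text \<open>Undoing a shift by at most 1 / m moves the point at most one cell to the left, unless it
  crosses an integer; then it comes from the last cell.\<close>

lemma floor_cell_after_shift:
  fixes x \<theta> u v :: real and m :: nat
  assumes "0 \<le> \<theta>" "real m * \<theta> \<le> 1" "m \<ge> 1" "u \<le> frac (x + \<theta>)" "frac (x + \<theta>) < v"
  shows "\<lfloor>real m * frac x\<rfloor> \<in> {\<lfloor>real m * u\<rfloor> - 1..\<lfloor>real m * v\<rfloor>} \<union> {int m - 1}"
proof -
  let ?y = "frac (x + \<theta>)"
  have xy: "?y = frac x + \<theta> + of_int (\<lfloor>x\<rfloor> - \<lfloor>x + \<theta>\<rfloor>)" by (simp add: frac_def)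
  have fl: "\<lfloor>x\<rfloor> \<le> \<lfloor>x + \<theta>\<rfloor>" using assms by (intro floor_mono) simp
  have x01: "0 \<le> frac x" "frac x < 1" by (auto simp: frac_lt_1)
  have mx: "real m * frac x < real m" using x01 assms by simp
  show ?thesis
  proof (cases "\<lfloor>x + \<theta>\<rfloor> = \<lfloor>x\<rfloor>")
    case True
    then have x: "frac x = ?y - \<theta>" using xy by simp
    have hi: "real m * frac x \<le> real m * v" using assms x by (intro mult_left_mono) auto
    have lo: "real m * u - 1 \<le> real m * frac x"
    proof -
      have "real m * u \<le> real m * ?y" using assms by (intro mult_left_mono) auto
      then show ?thesis using assms unfolding x right_diff_distrib by linarith
    qed
    show ?thesis using floor_mono[OF hi] floor_mono[OF lo] by simp
  next
    case False
    then have "real_of_int (\<lfloor>x\<rfloor> - \<lfloor>x + \<theta>\<rfloor>) \<le> -1" using fl by linarith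
    then have "?y \<le> frac x + \<theta> - 1" using xy by linarith
    then have "1 - \<theta> \<le> frac x" using frac_ge_0[of "x + \<theta>"] by linarith
    then have "real m * (1 - \<theta>) \<le> real m * frac x" by (intro mult_left_mono) auto
    then have "real m - 1 \<le> real m * frac x" using assms by (simp add: right_diff_distrib)
    then have "\<lfloor>real m * frac x\<rfloor> = int m - 1" using mx by (simp add: floor_eq_iff)
    then show ?thesis by simp
  qed
qed

text \<open>Apart from late positions, a visit puts the approximate point into one of at most m (v -
  u) + 4 cells. The constant 10 consists of 1 for the late positions, 4 for the surplus cells and 5
  for the factor 1 + 1 / m.\<close>

lemma even_block_visits:
  assumes r: "r \<ge> 2" and even: "even_block r m q a' n n'" and m: "1 \<le> m" "m \<le> q"
    and \<xi>: "real a' / 2 ^ n' \<le> \<xi>" "\<xi> \<le> (real a' + 1) / 2 ^ n'"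
    and uv: "0 \<le> u" "u \<le> v" "v \<le> 1"
  shows "real (visits r \<xi> (block r n n') u v) \<le> real (card (block r n n')) * (v - u + 10 / real m)"
proof -
  let ?B = "block r n n'"
  define x where "x = real a' / 2 ^ n'"
  define late where "late = {j \<in> ?B. 2 ^ n' < q * r ^ j}"
  define T where "T = {\<lfloor>real m * u\<rfloor> - 1..\<lfloor>real m * v\<rfloor>} \<union> {int m - 1}"
  define Q where "Q c = {j \<in> ?B. cell r m a' n' j = c}" for c
  have finB: "finite ?B" by (simp add: block_def)
  have m0: "real m > 0" using m by simp
  have qB: "q\<^sup>2 \<le> card ?B" and cells: "\<And>c. c < m \<Longrightarrow> m\<^sup>2 * card (Q c) \<le> (m + 1) * card ?B"
    using even by (auto simp: even_block_def Q_def)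
  have cell_lt: "cell r m a' n' j < m" for j
  proof -
    have "real m * frac (real r ^ j * (real a' / 2 ^ n')) < real m * 1"
      using m0 frac_lt_1 by (intro mult_strict_left_mono) auto
    then have "int (cell r m a' n' j) < int m" unfolding cell_eq_floor by (simp add: floor_less_iff)
    then show ?thesis by simp
  qed
  have "{j \<in> ?B. u \<le> frac (real r ^ j * \<xi>) \<and> frac (real r ^ j * \<xi>) < v}
     \<subseteq> late \<union> (\<Union>c\<in>nat ` (T \<inter> {0..<int m}). Q c)"
  proof
    fix j assume j: "j \<in> {j \<in> ?B. u \<le> frac (real r ^ j * \<xi>) \<and> frac (real r ^ j * \<xi>) < v}"
    show "j \<in> late \<union> (\<Union>c\<in>nat ` (T \<inter> {0..<int m}). Q c)"
    proof (cases "j \<in> late")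
      case False
      define \<theta> where "\<theta> = real r ^ j * (\<xi> - x)"
      have "q * r ^ j \<le> 2 ^ n'" using False j by (simp add: late_def)
      then have "m * r ^ j \<le> 2 ^ n'" using mult_le_mono1[OF m(2), of "r ^ j"] by linarith
      then have "real (m * r ^ j) \<le> real (2 ^ n')" by (simp only: of_nat_le_iff)
      then have mr: "real m * real r ^ j \<le> 2 ^ n'" by simp
      have "\<xi> - x \<le> 1 / 2 ^ n'" using \<xi> by (simp add: x_def add_divide_distrib)
      then have "(real m * real r ^ j) * (\<xi> - x) \<le> (real m * real r ^ j) * (1 / 2 ^ n')"
        by (intro mult_left_mono) auto
      also have "\<dots> \<le> 1" using mr by simp
      finally have "real m * \<theta> \<le> 1" by (simp add: \<theta>_def mult.assoc)
      moreover have "0 \<le> \<theta>" using \<xi> by (simp add: \<theta>_def x_def)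
      moreover have "real r ^ j * \<xi> = real r ^ j * x + \<theta>" by (simp add: \<theta>_def algebra_simps)
      ultimately have "\<lfloor>real m * frac (real r ^ j * x)\<rfloor> \<in> T"
        unfolding T_def using j m by (intro floor_cell_after_shift[where \<theta> = \<theta>]) auto
      then have "int (cell r m a' n' j) \<in> T" by (simp add: cell_eq_floor x_def)
      then have "cell r m a' n' j \<in> nat ` (T \<inter> {0..<int m})"
        using cell_lt[of j] by (intro image_eqI[of _ _ "int (cell r m a' n' j)"]) auto
      then show ?thesis using j by (auto simp: Q_def)
    qed simp
  qed
  then have "visits r \<xi> ?B u v \<le> card (late \<union> (\<Union>c\<in>nat ` (T \<inter> {0..<int m}). Q c))"
    unfolding visits_def by (rule card_mono[rotated]) (auto simp: late_def Q_def finB)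
  also have "\<dots> \<le> card late + card (\<Union>c\<in>nat ` (T \<inter> {0..<int m}). Q c)" by (rule card_Un_le)
  also have "card (\<Union>c\<in>nat ` (T \<inter> {0..<int m}). Q c) \<le> (\<Sum>c\<in>nat ` (T \<inter> {0..<int m}). card (Q c))"
    by (rule card_UN_le) simp
  finally have "real (visits r \<xi> ?B u v) \<le> real (card late) + (\<Sum>c\<in>nat ` (T \<inter> {0..<int m}). real (card (Q c)))"
    unfolding of_nat_sum[symmetric] of_nat_add[symmetric] of_nat_le_iff by simp
  also have "(\<Sum>c\<in>nat ` (T \<inter> {0..<int m}). real (card (Q c)))
     \<le> (\<Sum>c\<in>nat ` (T \<inter> {0..<int m}). real (card ?B) * (1 / real m * (1 + 1 / real m)))"
  proof (rule sum_mono)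
    fix c assume "c \<in> nat ` (T \<inter> {0..<int m})"
    then have "c < m" by auto
    then have "real (m\<^sup>2 * card (Q c)) \<le> real ((m + 1) * card ?B)" using cells by (simp only: of_nat_le_iff)
    then show "real (card (Q c)) \<le> real (card ?B) * (1 / real m * (1 + 1 / real m))"
      using m0 by (simp add: field_simps power2_eq_square)
  qed
  also have "\<dots> = real (card (nat ` (T \<inter> {0..<int m}))) * (real (card ?B) * (1 / real m * (1 + 1 / real m)))"
    by simp
  also have "\<dots> \<le> (real m * (v - u) + 4) * (real (card ?B) * (1 / real m * (1 + 1 / real m)))"
  proof (rule mult_right_mono)
    have "card (nat ` (T \<inter> {0..<int m})) \<le> card (T \<inter> {0..<int m})" by (rule card_image_le) simp
    also have "\<dots> \<le> card T" by (rule card_mono) (auto simp: T_def)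
    also have "\<dots> \<le> card {\<lfloor>real m * u\<rfloor> - 1..\<lfloor>real m * v\<rfloor>} + card {int m - 1}"
      unfolding T_def by (rule card_Un_le)
    finally have "real (card (nat ` (T \<inter> {0..<int m}))) \<le> real (nat (\<lfloor>real m * v\<rfloor> - \<lfloor>real m * u\<rfloor> + 2)) + 1"
      by simp
    also have "\<lfloor>real m * u\<rfloor> \<le> \<lfloor>real m * v\<rfloor>" using uv by (intro floor_mono mult_left_mono) auto
    then have "real (nat (\<lfloor>real m * v\<rfloor> - \<lfloor>real m * u\<rfloor> + 2)) = of_int \<lfloor>real m * v\<rfloor> - of_int \<lfloor>real m * u\<rfloor> + 2"
      by simp
    finally show "real (card (nat ` (T \<inter> {0..<int m}))) \<le> real m * (v - u) + 4"
      unfolding right_diff_distrib by linarith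
  qed simp
  also have "real (card late) \<le> real (card ?B) * (1 / real m)"
  proof -
    have "card late * m \<le> q * q" unfolding late_def using card_late_positions[OF r, of q n n'] m by (intro mult_mono) auto
    then have "card late * m \<le> card ?B" using qB by (simp add: power2_eq_square)
    then have "real (card late * m) \<le> real (card ?B)" by (simp only: of_nat_le_iff)
    then show ?thesis using m0 by (simp add: field_simps)
  qed
  also have "real (card ?B) * (1 / real m) + (real m * (v - u) + 4) * (real (card ?B) * (1 / real m * (1 + 1 / real m)))
     \<le> real (card ?B) * (v - u + 10 / real m)"
  proof -
    define t where "t = 1 / real m"
    have t: "0 < t" "t \<le> 1" using m by (simp_all add: t_def)
    have tm: "t * real m = 1" using m0 by (simp add: t_def)
    have "t + (real m * (v - u) + 4) * (t * (1 + t)) = t + (t * real m) * ((v - u) * (1 + t)) + 4 * t + 4 * (t * t)"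
      by (simp add: algebra_simps)
    also have "\<dots> = 5 * t + (v - u) + (v - u) * t + 4 * (t * t)" unfolding tm by (simp add: algebra_simps)
    also have "\<dots> \<le> 5 * t + (v - u) + 1 * t + 4 * (1 * t)"
      using t uv by (intro add_mono mult_left_mono mult_right_mono) auto
    also have "\<dots> = v - u + 10 * t" by simp
    finally have "t + (real m * (v - u) + 4) * (t * (1 + t)) \<le> v - u + 10 * t" .
    then have "real (card ?B) * (t + (real m * (v - u) + 4) * (t * (1 + t))) \<le> real (card ?B) * (v - u + 10 * t)"
      by (intro mult_left_mono) auto
    moreover have "real (card ?B) * t + (real m * (v - u) + 4) * (real (card ?B) * (t * (1 + t)))
        = real (card ?B) * (t + (real m * (v - u) + 4) * (t * (1 + t)))"
      by (simp add: algebra_simps)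
    moreover have "10 / real m = 10 * t" by (simp add: t_def)
    ultimately show ?thesis unfolding t_def[symmetric] by simp
  qed
  finally show ?thesis by simp
qed

section \<open>Discrepancy and upper bounds for visits\<close>

lemma discrepancy_bounds:
  fixes x :: "nat \<Rightarrow> real"
  assumes "N > 0"
  shows "0 \<le> u \<Longrightarrow> u < v \<Longrightarrow> v \<le> 1 \<Longrightarrow>
      \<bar>real (card {n. n < N \<and> u \<le> x n \<and> x n < v}) / real N - (v - u)\<bar> \<le> discrepancy x N"
    and "(\<And>u v. 0 \<le> u \<Longrightarrow> u < v \<Longrightarrow> v \<le> 1 \<Longrightarrow>
      \<bar>real (card {n. n < N \<and> u \<le> x n \<and> x n < v}) / real N - (v - u)\<bar> \<le> d) \<Longrightarrow> discrepancy x N \<le> d"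
    and "0 \<le> discrepancy x N"
proof -
  let ?f = "\<lambda>(u, v). \<bar>real (card {n. n < N \<and> u \<le> x n \<and> x n < v}) / real N - (v - u)\<bar>"
  let ?S = "{(u, v). 0 \<le> u \<and> u < v \<and> v \<le> (1::real)}"
  have bdd: "bdd_above (?f ` ?S)"
  proof (rule bdd_aboveI2[where M = 1])
    fix z assume z: "z \<in> ?S"
    then obtain u v where uv: "z = (u, v)" "0 \<le> u" "u < v" "v \<le> 1" by auto
    have "card {n. n < N \<and> u \<le> x n \<and> x n < v} \<le> card {..<N}" by (intro card_mono) auto
    then have "real (card {n. n < N \<and> u \<le> x n \<and> x n < v}) / real N \<le> 1" using assms by simp
    moreover have "0 \<le> real (card {n. n < N \<and> u \<le> x n \<and> x n < v}) / real N" by simp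
    ultimately have "\<bar>real (card {n. n < N \<and> u \<le> x n \<and> x n < v}) / real N - (v - u)\<bar> \<le> 1"
      using uv by linarith
    then show "?f z \<le> 1" by (simp add: uv(1))
  qed
  have ge: "?f z \<le> discrepancy x N" if "z \<in> ?S" for z
    unfolding discrepancy_def by (rule cSUP_upper[OF that bdd])
  show "\<bar>real (card {n. n < N \<and> u \<le> x n \<and> x n < v}) / real N - (v - u)\<bar> \<le> discrepancy x N"
    if "0 \<le> u" "u < v" "v \<le> 1" for u v using ge[of "(u, v)"] that by simp
  show "discrepancy x N \<le> d" if "\<And>u v. 0 \<le> u \<Longrightarrow> u < v \<Longrightarrow> v \<le> 1 \<Longrightarrow>
      \<bar>real (card {n. n < N \<and> u \<le> x n \<and> x n < v}) / real N - (v - u)\<bar> \<le> d" for d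
  proof -
    have "(0, 1) \<in> ?S" by simp
    then have "?S \<noteq> {}" by blast
    then show ?thesis unfolding discrepancy_def by (rule cSUP_least) (use that in auto)
  qed
  have "(0, 1) \<in> ?S" by simp
  from ge[OF this] show "0 \<le> discrepancy x N" by simp
qed

lemma visits_lessThan: "visits r \<xi> {..<N} u v = card {j. j < N \<and> u \<le> frac (real r ^ j * \<xi>) \<and> frac (real r ^ j * \<xi>) < v}"
  by (simp add: visits_def)

text \<open>The intervals [0, u), [u, v) and [v, 1) partition the unit interval, so upper bounds for
  the outer two bound the middle one from below, at twice the error. In 11 / m the share 10 / m is
  due to complete blocks and 1 / m to the block in progress.\<close>

lemma normal_to_base_if_upper_bounds:
  assumes "\<And>m. m \<ge> 1 \<Longrightarrow> \<exists>K N0. \<forall>N\<ge>N0. \<forall>u v. 0 \<le> u \<longrightarrow> u \<le> v \<longrightarrow> v \<le> 1 \<longrightarrow>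
     real (visits r \<xi> {..<N} u v) \<le> K + real N * (v - u + 11 / real m)"
  shows "normal_to_base r \<xi>"
  unfolding normal_to_base_def
proof (rule LIMSEQ_I)
  fix \<epsilon> :: real assume \<epsilon>: "\<epsilon> > 0"
  obtain m :: nat where m: "44 / \<epsilon> < real m" using reals_Archimedean2 by blast
  then have m0: "real m > 0" using \<epsilon> by (smt (verit) divide_pos_pos)
  then have m1: "m \<ge> 1" by linarith
  obtain K N0 where ub: "\<And>N u v. N \<ge> N0 \<Longrightarrow> 0 \<le> u \<Longrightarrow> u \<le> v \<Longrightarrow> v \<le> 1 \<Longrightarrow>
     real (visits r \<xi> {..<N} u v) \<le> K + real N * (v - u + 11 / real m)"
    using assms[OF m1] by blast
  obtain N1 :: nat where N1: "8 * \<bar>K\<bar> / \<epsilon> < real N1" using reals_Archimedean2 by blast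
  show "\<exists>no. \<forall>N\<ge>no. norm (discrepancy (\<lambda>j. frac (real r ^ j * \<xi>)) N - 0) < \<epsilon>"
  proof (intro exI[of _ "N0 + N1 + 1"] allI impI)
    fix N assume N: "N0 + N1 + 1 \<le> N"
    have Npos: "real N > 0" and N0: "N \<ge> N0" using N by auto
    have "discrepancy (\<lambda>j. frac (real r ^ j * \<xi>)) N \<le> 22 / real m + 2 * \<bar>K\<bar> / real N"
    proof (rule discrepancy_bounds(2))
      show "N > 0" using N by simp
      fix u v :: real assume uv: "0 \<le> u" "u < v" "v \<le> 1"
      let ?V = "\<lambda>u v. real (visits r \<xi> {..<N} u v)"
      have f01: "0 \<le> frac y" "frac y < 1" for y :: real by (auto simp: frac_lt_1)
      have parts: "real N = ?V 0 u + ?V u v + ?V v 1"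
      proof -
        let ?P = "\<lambda>u v. {j \<in> {..<N}. u \<le> frac (real r ^ j * \<xi>) \<and> frac (real r ^ j * \<xi>) < v}"
        have eq: "{..<N} = (?P 0 u \<union> ?P u v) \<union> ?P v 1" using f01 by (auto simp: not_less)
        have "card {..<N} = card (?P 0 u \<union> ?P u v) + card (?P v 1)"
          by (subst eq, rule card_Un_disjoint) (use uv in auto)
        also have "card (?P 0 u \<union> ?P u v) = card (?P 0 u) + card (?P u v)"
          by (rule card_Un_disjoint) auto
        finally show ?thesis by (simp add: visits_def)
      qed
      have V1: "?V u v \<le> \<bar>K\<bar> + real N * (v - u + 11 / real m)" using ub[OF N0, of u v] uv by simp
      have "?V 0 u \<le> \<bar>K\<bar> + real N * (u - 0 + 11 / real m)" using ub[OF N0, of 0 u] uv by simp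
      moreover have "?V v 1 \<le> \<bar>K\<bar> + real N * (1 - v + 11 / real m)" using ub[OF N0, of v 1] uv by simp
      ultimately have "real N - ?V u v \<le> 2 * \<bar>K\<bar> + real N * (u - 0 + 11 / real m) + real N * (1 - v + 11 / real m)"
        using parts by linarith
      then have V2: "real N * (v - u - 22 / real m) - 2 * \<bar>K\<bar> \<le> ?V u v" by (simp add: algebra_simps)
      have "?V u v / real N \<le> (\<bar>K\<bar> + real N * (v - u + 11 / real m)) / real N"
        using V1 Npos by (intro divide_right_mono) auto
      also have "\<dots> = \<bar>K\<bar> / real N + (v - u + 11 / real m)" using Npos by (simp add: add_divide_distrib)
      finally have D0: "?V u v / real N \<le> \<bar>K\<bar> / real N + (v - u + 11 / real m)" .
      have D1: "?V u v / real N - (v - u) \<le> 2 * \<bar>K\<bar> / real N + 22 / real m"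
      proof -
        have "2 * \<bar>K\<bar> / real N = \<bar>K\<bar> / real N + \<bar>K\<bar> / real N" "22 / real m = 11 / real m + 11 / real m" by simp_all
        moreover have "0 \<le> \<bar>K\<bar> / real N" "0 \<le> 11 / real m" by simp_all
        ultimately show ?thesis using D0 by linarith
      qed
      have "v - u - 22 / real m - 2 * \<bar>K\<bar> / real N = (real N * (v - u - 22 / real m) - 2 * \<bar>K\<bar>) / real N"
        using Npos by (simp add: diff_divide_distrib)
      also have "\<dots> \<le> ?V u v / real N" using V2 Npos by (intro divide_right_mono) auto
      finally have "\<bar>?V u v / real N - (v - u)\<bar> \<le> 22 / real m + 2 * \<bar>K\<bar> / real N" using D1 by linarith
      then show "\<bar>real (card {n. n < N \<and> u \<le> frac (real r ^ n * \<xi>) \<and> frac (real r ^ n * \<xi>) < v}) / real N - (v - u)\<bar>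
          \<le> 22 / real m + 2 * \<bar>K\<bar> / real N" by (simp add: visits_lessThan)
    qed
    moreover have "22 / real m < \<epsilon> / 2" using m \<epsilon> m0 by (simp add: field_simps)
    moreover have "2 * \<bar>K\<bar> / real N < \<epsilon> / 2"
    proof -
      have "8 * \<bar>K\<bar> / \<epsilon> < real N" using N1 N by linarith
      then show ?thesis using \<epsilon> Npos by (simp add: field_simps)
    qed
    moreover have "0 \<le> discrepancy (\<lambda>j. frac (real r ^ j * \<xi>)) N" using N by (intro discrepancy_bounds(3)) simp
    ultimately show "norm (discrepancy (\<lambda>j. frac (real r ^ j * \<xi>)) N - 0) < \<epsilon>" by simp
  qed
qed

section \<open>The construction\<close>

text \<open>The representation of a / 2^n in [0, 1) in the sense of \<open>real_name\<close>; the
  value at 0 encodes the integer part 0.\<close>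

definition dyadic_name :: "nat \<Rightarrow> nat \<Rightarrow> nat \<Rightarrow> nat" where
  "dyadic_name a n i = (if i = 0 then 0 else 2 ^ i * a div 2 ^ n mod 2)"

lemma two_minimal: "2 \<in> minimal_bases"
  by (simp add: minimal_bases_def)

text \<open>Bounded minimization as a cardinality, so that its computability follows from that of
  counting; the value is b if nothing below b qualifies.\<close>

definition least_below :: "nat \<Rightarrow> (nat \<Rightarrow> bool) \<Rightarrow> nat" where
  "least_below b P = card {i. i < b \<and> (\<forall>j<Suc i. \<not> P j)}"

lemma least_below:
  assumes "P v" "v < b"
  shows "P (least_below b P)" "least_below b P \<le> v"
proof -
  define m where "m = (LEAST v. P v)"
  have m: "P m" "m \<le> v" using assms(1) unfolding m_def by (rule LeastI, rule Least_le)
  have "(\<forall>j<Suc i. \<not> P j) \<longleftrightarrow> i < m" for i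
    using m(1) not_less_Least[of _ P] unfolding m_def[symmetric] by (metis less_Suc_eq_le not_less order_le_less_trans)
  then have "{i. i < b \<and> (\<forall>j<Suc i. \<not> P j)} = {..<m}" using m assms(2) by auto
  then have "least_below b P = m" by (simp add: least_below_def)
  then show "P (least_below b P)" "least_below b P \<le> v" using m by simp_all
qed

text \<open>A choice is coded as i \<open>code_range n\<close> + n' 4^n + a'. The index i weighs
  most, so the least candidate prefers the task (i = 0) to the fallback, and a higher fallback
  quality to a lower one.\<close>

definition code_range :: "nat \<Rightarrow> nat" where
  "code_range n = (2 * n + 1) * 4 ^ n"

definition new_len :: "nat \<Rightarrow> nat \<Rightarrow> nat" where
  "new_len n v = v mod code_range n div 4 ^ n"

definition new_num :: "nat \<Rightarrow> nat \<Rightarrow> nat" where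
  "new_num n v = v mod code_range n mod 4 ^ n"

lemma option_code:
  fixes n n' a' i :: nat
  assumes "n' \<le> 2 * n" "a' < 2 ^ n'"
  defines "v \<equiv> i * code_range n + (n' * 4 ^ n + a')"
  shows "v div code_range n = i" "new_len n v = n'" "new_num n v = a'"
proof -
  have "(2::nat) ^ n' \<le> 2 ^ (2 * n)" using assms(1) by (intro power_increasing) auto
  then have a': "a' < 4 ^ n" using assms(2) by (simp add: power_mult)
  have "n' * 4 ^ n + a' < (n' + 1) * 4 ^ n" using a' by simp
  also have "\<dots> \<le> code_range n" unfolding code_range_def using assms(1) by (intro mult_right_mono) auto
  finally have u: "n' * 4 ^ n + a' < code_range n" .
  then have "v mod code_range n = n' * 4 ^ n + a'" by (simp add: v_def)
  then show "new_len n v = n'" "new_num n v = a'" using a' by (simp_all add: new_len_def new_num_def)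
  show "v div code_range n = i" using u by (simp add: v_def)
qed

text \<open>
  A state \<open>(a, n, t, b)\<close> records that the number lies between \<open>a / 2 ^ n\<close> and
  \<open>(a + 1) / 2 ^ n\<close>, and that the task \<open>t\<close> has been pursued without interruption since the
  precision was \<open>b\<close>. The task \<open>t\<close> asks for blocks of quality \<open>t + 1\<close> that are biased in base
  \<open>base a n t\<close>; the candidates with \<open>i > 0\<close> are the fallback of highest possible quality
  when the task cannot be continued.
\<close>

locale block_search =
  fixes base level :: "nat \<Rightarrow> nat \<Rightarrow> nat \<Rightarrow> nat" and use_bound :: "nat \<Rightarrow> nat"
  assumes base_minimal: "base a n t \<in> minimal_bases"
    and level_bounds: "1 \<le> level a n t" "level a n t \<le> t + 1"
begin

definition candidate :: "nat \<Rightarrow> nat \<Rightarrow> nat \<Rightarrow> nat \<Rightarrow> bool" where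
  "candidate a n t v \<longleftrightarrow> v < (n + 2) * code_range n \<and>
     (let i = v div code_range n in
      if i = 0 then good_block (base a n t) (level a n t) (t + 1) a n (new_num n v) (new_len n v)
      else good_block 2 (n + 1 - i) (n + 1 - i) a n (new_num n v) (new_len n v))"

definition chosen :: "nat \<Rightarrow> nat \<Rightarrow> nat \<Rightarrow> nat" where
  "chosen a n t = least_below ((n + 2) * code_range n) (candidate a n t)"

text \<open>A task ends when the precision is at least t + 1 times that at the start of its run,
  plus the number of digits on which the next task depends. A fallback block restarts the run, since
  the bias has to prevail over everything before it.\<close>

definition next_state :: "nat \<times> nat \<times> nat \<times> nat \<Rightarrow> nat \<times> nat \<times> nat \<times> nat" where
  "next_state = (\<lambda>(a, n, t, b).
     let v = chosen a n t; n' = new_len n v in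
     (new_num n v, n',
      (if v < code_range n \<and> (t + 1) * b + use_bound (t + 1) \<le> n' then t + 1 else t),
      (if v < code_range n \<and> n' < (t + 1) * b + use_bound (t + 1) then b else n')))"

text \<open>The initial precision exceeds \<open>use_bound 0\<close>, so that task 0 can already be
  decided.\<close>

definition state :: "nat \<Rightarrow> nat \<times> nat \<times> nat \<times> nat" where
  "state i = (next_state ^^ i) (0, use_bound 0 + 1, 0, use_bound 0 + 1)"

definition "num i = fst (state i)"
definition "len i = fst (snd (state i))"
definition "task i = fst (snd (snd (state i)))"
definition "mark i = snd (snd (snd (state i)))"

definition "pick i = chosen (num i) (len i) (task i)"
definition "on_task i \<longleftrightarrow> pick i < code_range (len i)"
definition "cur_base i = (if on_task i then base (num i) (len i) (task i) else 2)"
definition "cur_quality i = (if on_task i then task i + 1 else len i + 1 - pick i div code_range (len i))"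
definition "cur_level i = (if on_task i then level (num i) (len i) (task i) else cur_quality i)"
definition "finishes i \<longleftrightarrow> on_task i \<and> (task i + 1) * mark i + use_bound (task i + 1) \<le> len (Suc i)"

lemma state_0: "num 0 = 0" "len 0 = use_bound 0 + 1" "task 0 = 0" "mark 0 = use_bound 0 + 1"
  by (simp_all add: num_def len_def task_def mark_def state_def)

lemma state_Suc: "state (Suc i) = next_state (num i, len i, task i, mark i)"
  by (simp add: state_def num_def len_def task_def mark_def)

lemma step:
  "num (Suc i) = new_num (len i) (pick i)"
  "len (Suc i) = new_len (len i) (pick i)"
  "task (Suc i) = (if finishes i then task i + 1 else task i)"
  "mark (Suc i) = (if on_task i \<and> \<not> finishes i then mark i else len (Suc i))"
proof -
  show 1: "num (Suc i) = new_num (len i) (pick i)" "len (Suc i) = new_len (len i) (pick i)"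
    by (simp_all add: num_def[of "Suc i"] len_def[of "Suc i"] state_Suc next_state_def pick_def Let_def)
  have "task (Suc i) = (if pick i < code_range (len i) \<and> (task i + 1) * mark i + use_bound (task i + 1) \<le> len (Suc i)
      then task i + 1 else task i)"
    unfolding 1 by (simp add: task_def[of "Suc i"] state_Suc next_state_def pick_def Let_def)
  then show "task (Suc i) = (if finishes i then task i + 1 else task i)"
    by (simp add: finishes_def on_task_def)
  have "mark (Suc i) = (if pick i < code_range (len i) \<and> len (Suc i) < (task i + 1) * mark i + use_bound (task i + 1)
      then mark i else len (Suc i))"
    unfolding 1 by (simp add: mark_def[of "Suc i"] state_Suc next_state_def pick_def Let_def)
  then show "mark (Suc i) = (if on_task i \<and> \<not> finishes i then mark i else len (Suc i))"
    by (auto simp: finishes_def on_task_def)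
qed

lemma good_block_bounds:
  assumes "good_block s k q a n a' n'" "a < 2 ^ n"
  shows "n < n'" "n' \<le> 2 * n" "a' < 2 ^ n'" "a * 2 ^ (n' - n) \<le> a'" "a' + 1 < (a + 1) * 2 ^ (n' - n)"
proof -
  show n': "n < n'" "n' \<le> 2 * n" and "a * 2 ^ (n' - n) \<le> a'" and up: "a' + 1 < (a + 1) * 2 ^ (n' - n)"
    using assms(1) by (auto simp: good_block_def)
  have "(a + 1) * 2 ^ (n' - n) \<le> 2 ^ n * 2 ^ (n' - n)" using assms(2) by (intro mult_right_mono) auto
  also have "\<dots> = 2 ^ n'" using n' by (simp flip: power_add)
  finally show "a' < 2 ^ n'" using up by linarith
qed

lemma candidate_task:
  assumes "good_block (base a n t) (level a n t) (t + 1) a n a' n'" "a < 2 ^ n"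
  shows "\<exists>v < code_range n. candidate a n t v"
proof -
  note g = good_block_bounds[OF assms]
  define v where "v = 0 * code_range n + (n' * 4 ^ n + a')"
  note c = option_code[OF g(2,3), of 0, folded v_def]
  have "code_range n > 0" by (simp add: code_range_def)
  then have v: "v < code_range n" using c(1) by (simp add: div_eq_0_iff)
  then have "candidate a n t v" using c assms(1) by (auto simp: candidate_def)
  then show ?thesis using v by blast
qed

lemma candidate_fallback:
  assumes "good_block 2 q q a n a' n'" "a < 2 ^ n" "q \<le> n"
  shows "\<exists>v. candidate a n t v \<and> v div code_range n = n + 1 - q"
proof -
  note g = good_block_bounds[OF assms(1,2)]
  define v where "v = (n + 1 - q) * code_range n + (n' * 4 ^ n + a')"
  note c = option_code[OF g(2,3), of "n + 1 - q", folded v_def]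
  have "code_range n > 0" by (simp add: code_range_def)
  moreover have "v div code_range n < n + 2" using c(1) assms(3) by simp
  ultimately have "v < (n + 2) * code_range n" by (simp add: div_less_iff_less_mult)
  then have "candidate a n t v" using c assms by (auto simp: candidate_def Let_def)
  then show ?thesis using c by blast
qed

text \<open>At quality and level 0 the conditions on counts are void, so the search always has a
  candidate.\<close>

lemma trivial_good_block: "n \<ge> 1 \<Longrightarrow> good_block 2 0 0 a n (2 * a) (n + 1)"
  by (auto simp: good_block_def even_block_def)

lemma chosen_candidate:
  assumes "a < 2 ^ n" "n \<ge> 1"
  shows "candidate a n t (chosen a n t)"
proof -
  obtain v where "candidate a n t v"
    using candidate_fallback[OF trivial_good_block[OF assms(2)] assms(1)] by blast
  then show ?thesis unfolding chosen_def by (rule least_below) (use \<open>candidate a n t v\<close> in \<open>simp add: candidate_def\<close>)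
qed

lemma chosen_le: "candidate a n t v \<Longrightarrow> chosen a n t \<le> v"
  unfolding chosen_def by (rule least_below) (simp_all add: candidate_def)

lemma chosen_good:
  fixes a n t :: nat
  assumes "a < 2 ^ n" "n \<ge> 1"
  defines "v \<equiv> chosen a n t"
  shows "v < code_range n \<Longrightarrow> good_block (base a n t) (level a n t) (t + 1) a n (new_num n v) (new_len n v)"
    and "\<not> v < code_range n \<Longrightarrow> good_block 2 (n + 1 - v div code_range n) (n + 1 - v div code_range n) a n (new_num n v) (new_len n v)"
  using chosen_candidate[OF assms(1,2), of t] unfolding v_def[symmetric]
  by (auto simp: candidate_def Let_def div_eq_0_iff split: if_splits)

lemma num_len: "num i < 2 ^ len i \<and> 1 \<le> len i"
proof (induction i)
  case 0
  then show ?case by (simp add: state_0)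
next
  case (Suc i)
  then have "\<exists>s k q. good_block s k q (num i) (len i) (num (Suc i)) (len (Suc i))"
    using chosen_good[of "num i" "len i" "task i"] unfolding step pick_def by blast
  then obtain s k q where g: "good_block s k q (num i) (len i) (num (Suc i)) (len (Suc i))" by blast
  show ?case using good_block_bounds(1,3)[OF g] Suc by simp
qed

lemma step_good: "good_block (cur_base i) (cur_level i) (cur_quality i) (num i) (len i) (num (Suc i)) (len (Suc i))"
  using chosen_good[of "num i" "len i" "task i"] num_len[of i]
  unfolding step cur_base_def cur_level_def cur_quality_def on_task_def pick_def by auto

lemmas step_bounds = good_block_bounds[OF step_good num_len[THEN conjunct1]]

lemma len_strict_mono: "strict_mono len"
  using step_bounds(1) by (intro strict_monoI_Suc)

lemma len_ge: "i \<le> len i"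
  using len_strict_mono strict_mono_imp_increasing by blast

lemma task_mono: "i \<le> j \<Longrightarrow> task i \<le> task j"
  by (rule lift_Suc_mono_le) (simp add: step)

text \<open>The threshold in \<open>finishes\<close> contains the bound for the next task, and the
  precision only grows.\<close>

lemma use_bound_le_len: "use_bound (task i) \<le> len i"
proof (induction i)
  case (Suc i)
  then show ?case using step_bounds(1)[of i] by (auto simp: step(3) finishes_def)
qed (simp add: state_0)

lemma mark_run: "\<exists>i0\<le>i. mark i = len i0 \<and> (\<forall>j. i0 \<le> j \<longrightarrow> j < i \<longrightarrow> on_task j \<and> task j = task i)"
proof (induction i)
  case 0
  then show ?case by (simp add: state_0)
next
  case (Suc i)
  show ?case
  proof (cases "on_task i \<and> \<not> finishes i")
    case True
    then have "mark (Suc i) = mark i" "task (Suc i) = task i" by (simp_all add: step(3,4))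
    then show ?thesis using Suc True by (metis le_SucI less_Suc_eq)
  next
    case False
    then have "mark (Suc i) = len (Suc i)" by (simp only: step(4) if_False)
    then show ?thesis by (intro exI[of _ "Suc i"]) simp
  qed
qed

definition "lower i = real (num i) / 2 ^ len i"
definition "upper i = (real (num i) + 1) / 2 ^ len i"

lemma lower_Suc: "lower i \<le> lower (Suc i)"
  and upper_Suc: "upper (Suc i) < upper i"
proof -
  let ?d = "len (Suc i) - len i"
  have split: "(2::real) ^ len (Suc i) = 2 ^ len i * 2 ^ ?d"
    using step_bounds(1)[of i] by (simp flip: power_add)
  have "real (num i * 2 ^ ?d) \<le> real (num (Suc i))" using step_bounds(4)[of i] by (simp only: of_nat_le_iff)
  then show "lower i \<le> lower (Suc i)" by (simp add: lower_def split field_simps)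
  have "real (num (Suc i) + 1) < real ((num i + 1) * 2 ^ ?d)" using step_bounds(5)[of i] by (simp only: of_nat_less_iff)
  then have "(real (num (Suc i)) + 1) / (2 ^ len i * 2 ^ ?d) < (real (num i) + 1) * 2 ^ ?d / (2 ^ len i * 2 ^ ?d)"
    by (intro divide_strict_right_mono) (simp_all add: distrib_right)
  then show "upper (Suc i) < upper i" by (simp add: upper_def split)
qed

lemma lower_mono: "i \<le> j \<Longrightarrow> lower i \<le> lower j"
  by (rule lift_Suc_mono_le[of lower]) (rule lower_Suc)

lemma upper_antimono: "i \<le> j \<Longrightarrow> upper j \<le> upper i"
  by (rule lift_Suc_antimono_le[of upper]) (simp_all add: upper_Suc less_imp_le)

lemma lower_le_upper: "lower i \<le> upper j"
proof -
  have "lower i \<le> lower (max i j)" by (rule lower_mono) simp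
  also have "\<dots> \<le> upper (max i j)" by (simp add: lower_def upper_def divide_right_mono)
  also have "\<dots> \<le> upper j" by (rule upper_antimono) simp
  finally show ?thesis .
qed

definition "limit = (SUP i. lower i)"

lemma limit_bounds: "lower i \<le> limit" "limit < upper i"
proof -
  have bdd: "bdd_above (range lower)" using lower_le_upper[of _ 0] by (intro bdd_aboveI2)
  show "lower i \<le> limit" unfolding limit_def by (rule cSUP_upper[OF _ bdd]) simp
  have "limit \<le> upper (Suc i)" unfolding limit_def by (rule cSUP_least) (auto intro: lower_le_upper)
  then show "limit < upper i" using upper_Suc[of i] by linarith
qed

lemma limit_01: "0 \<le> limit" "limit < 1"
proof -
  show "0 \<le> limit" using limit_bounds(1)[of 0] by (simp add: lower_def state_0)
  have "(1::real) \<le> 2 ^ len 0" by (rule one_le_power) simp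
  then have "upper 0 \<le> 1" by (simp add: upper_def state_0(1) divide_le_eq)
  then show "limit < 1" using limit_bounds(2)[of 0] by linarith
qed

text \<open>The limit lies in the half-open interval from a / 2^n to (a + 1) / 2^n, so the digits of
  a are those of the expansion selected by \<open>real_name\<close>, even for a dyadic
  limit.\<close>

lemma real_name_limit:
  assumes "j \<le> len i"
  shows "real_name limit j = dyadic_name (num i) (len i) j"
proof (cases "j = 0")
  case True
  have "\<lfloor>limit\<rfloor> = 0" using limit_01 by (simp add: floor_eq_iff)
  then show ?thesis using True by (simp add: real_name_def dyadic_name_def int_encode_def sum_encode_def)
next
  case False
  define t where "t = limit * 2 ^ len i"
  have "real (num i) \<le> t" "t < real (num i) + 1"
    using limit_bounds[of i] by (simp_all add: t_def lower_def upper_def divide_le_eq less_divide_eq)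
  then have "\<lfloor>t / real (2 ^ (len i - j))\<rfloor> = int (num i div 2 ^ (len i - j))"
    by (rule floor_div_of_interval) simp
  moreover have "t / real (2 ^ (len i - j)) = 2 ^ j * limit"
  proof -
    have "(2::real) ^ len i = 2 ^ j * 2 ^ (len i - j)" using assms by (simp flip: power_add)
    then show ?thesis by (simp add: t_def)
  qed
  moreover have "2 ^ j * num i div 2 ^ len i = num i div 2 ^ (len i - j)"
  proof -
    have "(2::nat) ^ len i = 2 ^ j * 2 ^ (len i - j)" using assms by (simp flip: power_add)
    then show ?thesis by simp
  qed
  ultimately have "nat (\<lfloor>2 ^ j * limit\<rfloor> mod 2) = 2 ^ j * num i div 2 ^ len i mod 2"
    by (simp add: nat_mod_distrib)
  then show ?thesis using False by (simp add: real_name_def dyadic_name_def)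
qed

text \<open>On a task the quality is \<open>task i + 1\<close>. In a fallback step, blocks of
  quality Q exist from some precision on, and the least code then has at least this quality.\<close>

lemma quality_ge_if_len_ge:
  assumes "Q \<ge> 1"
  shows "\<exists>i0. \<forall>i\<ge>i0. Q \<le> task i + 1 \<longrightarrow> Q \<le> cur_quality i"
proof -
  obtain n0 where n0: "\<And>n a. n \<ge> n0 \<Longrightarrow> \<exists>a' n'. good_block 2 Q Q a n a' n'"
    using good_block_exists[OF two_minimal assms order_refl] by blast
  show ?thesis
  proof (intro exI[of _ "n0 + Q"] allI impI)
    fix i assume i: "n0 + Q \<le> i" and Q: "Q \<le> task i + 1"
    show "Q \<le> cur_quality i"
    proof (cases "on_task i")
      case False
      have len: "n0 + Q \<le> len i" using i len_ge[of i] by linarith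
      then obtain a' n' where g: "good_block 2 Q Q (num i) (len i) a' n'"
        using n0[of "len i" "num i"] len by (meson add_leD1)
      have "Q \<le> len i" using len by simp
      from candidate_fallback[OF g num_len[THEN conjunct1] this]
      obtain v where v: "candidate (num i) (len i) (task i) v" "v div code_range (len i) = len i + 1 - Q"
        by blast
      have "pick i \<le> v" unfolding pick_def using v(1) by (rule chosen_le)
      then have "pick i div code_range (len i) \<le> len i + 1 - Q" using v(2) div_le_mono by metis
      then show ?thesis using False len by (simp add: cur_quality_def)
    qed (use Q in \<open>simp add: cur_quality_def\<close>)
  qed
qed

end

section \<open>Normality of the limit and its failure\<close>

lemma good_block_even:
  assumes "good_block s k q a n a' n'" "r \<in> minimal_bases" "r \<le> q \<or> r = s"
  shows "even_block r (if r = s then k else q) q a' n n'"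
proof -
  have "r \<le> max q s" using assms(3) by auto
  then show ?thesis using assms unfolding good_block_def by blast
qed

lemma digits_known_mono: "r \<ge> 2 \<Longrightarrow> n \<le> n' \<Longrightarrow> digits_known r n \<le> digits_known r n'"
  by (simp add: digits_known_eq ilog_mono power_increasing)

lemma digits_known_le: "digits_known r n \<le> n"
proof -
  have "digits_known r n \<le> card {..<n}" unfolding digits_known_def by (intro card_mono) auto
  then show ?thesis by simp
qed

lemma visits_split:
  assumes "N \<le> M"
  shows "visits r \<xi> {..<M} u v = visits r \<xi> {..<N} u v + visits r \<xi> {N..<M} u v"
proof -
  let ?P = "\<lambda>j. u \<le> frac (real r ^ j * \<xi>) \<and> frac (real r ^ j * \<xi>) < v"
  have "{j \<in> {..<M}. ?P j} = {j \<in> {..<N}. ?P j} \<union> {j \<in> {N..<M}. ?P j}" using assms by auto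
  moreover have "card ({j \<in> {..<N}. ?P j} \<union> {j \<in> {N..<M}. ?P j}) = card {j \<in> {..<N}. ?P j} + card {j \<in> {N..<M}. ?P j}"
    by (rule card_Un_disjoint) auto
  ultimately show ?thesis by (simp add: visits_def)
qed

text \<open>Passing from the approximation to the number moves a point by at most \<eta>, except at
  late positions, which cost 1 / q. Widening the interval by \<eta> keeps the points that lie just
  below 1 / s.\<close>

lemma biased_block_visits:
  assumes s: "s \<ge> 2" and bb: "biased_block s k a' n n'" and W: "bias_scale k > 0"
    and q: "q\<^sup>2 \<le> card (block s n n')" "q \<ge> 1" "1 / real q \<le> \<eta>" "1 / real s + \<eta> < 1"
    and \<xi>: "real a' / 2 ^ n' \<le> \<xi>" "\<xi> \<le> (real a' + 1) / 2 ^ n'"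
  shows "real (card (block s n n')) * (1 / real s + 1 / real (bias_scale k) - 1 / real q)
     \<le> real (visits s \<xi> (block s n n') 0 (1 / real s + \<eta>))"
proof -
  let ?B = "block s n n'" and ?W = "bias_scale k"
  define x where "x = real a' / 2 ^ n'"
  define Z where "Z = {j \<in> ?B. cell s s a' n' j = 0}"
  define late where "late = {j \<in> ?B. 2 ^ n' < q * s ^ j}"
  have s0: "real s > 0" using s by simp
  have W0: "real ?W > 0" using W by simp
  have q0: "real q > 0" using q by simp
  have "Z \<subseteq> {j \<in> ?B. 0 \<le> frac (real s ^ j * \<xi>) \<and> frac (real s ^ j * \<xi>) < 1 / real s + \<eta>} \<union> late"
  proof
    fix j assume j: "j \<in> Z"
    show "j \<in> {j \<in> ?B. 0 \<le> frac (real s ^ j * \<xi>) \<and> frac (real s ^ j * \<xi>) < 1 / real s + \<eta>} \<union> late"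
    proof (cases "j \<in> late")
      case False
      define \<theta> where "\<theta> = real s ^ j * (\<xi> - x)"
      have "q * s ^ j \<le> 2 ^ n'" using False j by (simp add: late_def Z_def)
      then have "real (q * s ^ j) \<le> real (2 ^ n')" by (simp only: of_nat_le_iff)
      then have "real s ^ j * (1 / 2 ^ n') \<le> 1 / real q" using q0 by (simp add: field_simps)
      moreover have "\<xi> - x \<le> 1 / 2 ^ n'" using \<xi> by (simp add: x_def add_divide_distrib)
      then have "\<theta> \<le> real s ^ j * (1 / 2 ^ n')" unfolding \<theta>_def by (intro mult_left_mono) auto
      ultimately have \<theta>: "\<theta> \<le> \<eta>" using q(3) by linarith
      have \<theta>0: "0 \<le> \<theta>" using \<xi> by (simp add: \<theta>_def x_def)
      have "int (cell s s a' n' j) = 0" using j by (simp add: Z_def)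
      then have "real s * frac (real s ^ j * x) < 1" unfolding cell_eq_floor x_def by (simp add: floor_eq_iff)
      then have fx: "frac (real s ^ j * x) < 1 / real s" using s0 by (simp add: field_simps)
      have sum: "real s ^ j * \<xi> = real s ^ j * x + \<theta>" by (simp add: \<theta>_def algebra_simps)
      have "frac (real s ^ j * \<xi>) = frac (real s ^ j * x) + \<theta>"
      proof -
        have "0 \<le> frac (real s ^ j * x) + \<theta>" using \<theta>0 by simp
        moreover have "frac (real s ^ j * x) + \<theta> < 1" using fx \<theta> q(4) by linarith
        moreover have "real s ^ j * \<xi> - (frac (real s ^ j * x) + \<theta>) = of_int \<lfloor>real s ^ j * x\<rfloor>"
          unfolding sum frac_def by simp
        ultimately show ?thesis by (simp add: frac_unique_iff)
      qed
      then have "frac (real s ^ j * \<xi>) < 1 / real s + \<eta>" using fx \<theta> by linarith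
      then show ?thesis using j by (simp add: Z_def)
    qed simp
  qed
  then have "card Z \<le> card ({j \<in> ?B. 0 \<le> frac (real s ^ j * \<xi>) \<and> frac (real s ^ j * \<xi>) < 1 / real s + \<eta>} \<union> late)"
    by (rule card_mono[rotated]) (simp add: late_def block_def)
  also have "\<dots> \<le> visits s \<xi> ?B 0 (1 / real s + \<eta>) + card late"
    unfolding visits_def by (rule card_Un_le)
  finally have "real (card Z) \<le> real (visits s \<xi> ?B 0 (1 / real s + \<eta>)) + real (card late)" by linarith
  moreover have "real (card late) \<le> real (card ?B) * (1 / real q)"
  proof -
    have "card late * q \<le> q * q" unfolding late_def using card_late_positions[OF s q(2), of n n'] by (intro mult_mono) auto
    then have "card late * q \<le> card ?B" using q(1) unfolding power2_eq_square by linarith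
    then have "real (card late * q) \<le> real (card ?B)" by (simp only: of_nat_le_iff)
    then show ?thesis using q0 by (simp add: field_simps)
  qed
  moreover have "real (card ?B) * (1 / real s + 1 / real ?W) \<le> real (card Z)"
  proof -
    have "real ((?W + s) * card ?B) \<le> real (?W * s * card Z)"
      using bb unfolding biased_block_def Z_def by (simp only: of_nat_le_iff)
    then have "(real ?W + real s) * real (card ?B) \<le> real ?W * real s * real (card Z)" by simp
    then show ?thesis using s0 W0 by (simp add: field_simps)
  qed
  ultimately show ?thesis by (simp add: right_diff_distrib)
qed

text \<open>Expresses that the self-reference is resolved: base and level are functions of the task
  alone, whatever approximation they are computed from.\<close>

locale stable_search = block_search +
  fixes task_base task_level :: "nat \<Rightarrow> nat"
  assumes stable: "base (num i) (len i) (task i) = task_base (task i)"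
    "level (num i) (len i) (task i) = task_level (task i)"
begin

text \<open>If the task remained t forever, good blocks for its fixed base and level would exist
  from some precision on. The search would then stay on the task, \<open>mark\<close> would freeze,
  and the growing precision would pass the threshold.\<close>

lemma task_unbounded: "\<exists>i. T \<le> task i"
proof (rule ccontr)
  assume "\<not> ?thesis"
  then have less: "task i < T" for i by (simp add: not_le)
  define t where "t = Max (range task)"
  have fin: "finite (range task)" by (rule finite_subset[of _ "{..<T}"]) (use less in auto)
  then have "t \<in> range task" unfolding t_def by (intro Max_in) auto
  then obtain i0 where i0: "task i0 = t" by blast
  have const: "task i = t" if "i \<ge> i0" for i
  proof (rule antisym)
    show "task i \<le> t" unfolding t_def using fin by (intro Max_ge) auto
    show "t \<le> task i" using task_mono[OF that] i0 by simp
  qed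
  have tb: "base (num i0) (len i0) t = task_base t" "level (num i0) (len i0) t = task_level t"
    using stable[of i0] i0 by simp_all
  have "task_base t \<in> minimal_bases" "1 \<le> task_level t" "task_level t \<le> t + 1"
    using base_minimal[of "num i0" "len i0" t] level_bounds[where a = "num i0" and n = "len i0" and t = t]
    unfolding tb by auto
  from good_block_exists[OF this]
  obtain n0 where n0: "\<And>n a. n \<ge> n0 \<Longrightarrow> \<exists>a' n'. good_block (task_base t) (task_level t) (t + 1) a n a' n'" by blast
  define i1 where "i1 = i0 + n0"
  have on: "on_task i" if "i \<ge> i1" for i
  proof -
    have t: "task i = t" using const that by (simp add: i1_def)
    have "n0 \<le> len i" using len_ge[of i] that by (simp add: i1_def)
    then obtain a' n' where "good_block (task_base t) (task_level t) (t + 1) (num i) (len i) a' n'"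
      using n0 by blast
    then have "good_block (base (num i) (len i) t) (level (num i) (len i) t) (t + 1) (num i) (len i) a' n'"
      using stable[of i] t by simp
    from candidate_task[OF this] num_len[of i]
    obtain v where v: "v < code_range (len i)" "candidate (num i) (len i) t v" by blast
    have "pick i \<le> v" unfolding pick_def t using v(2) by (rule chosen_le)
    then show ?thesis using v(1) by (simp add: on_task_def)
  qed
  have nf: "\<not> finishes i" if "i \<ge> i1" for i
  proof
    assume "finishes i"
    then have "task (Suc i) = t + 1" using const[of i] that by (simp add: step(3) i1_def)
    then show False using const[of "Suc i"] that by (simp add: i1_def)
  qed
  have mark: "mark i = mark i1" if "i \<ge> i1" for i
    using that by (induction i rule: dec_induct) (simp_all add: step(4) on nf)
  define i where "i = i1 + (t + 1) * mark i1 + use_bound (t + 1)"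
  have i: "i \<ge> i1" by (simp add: i_def)
  have "(t + 1) * mark i + use_bound (t + 1) \<le> len (Suc i)"
    unfolding mark[OF i] using len_ge[of "Suc i"] by (simp add: i_def)
  moreover have "task i = t" using const i by (simp add: i1_def)
  ultimately have "finishes i" unfolding finishes_def using on[OF i] by simp
  then show False using nf[OF i] by contradiction
qed

lemma eventually_task_ge: "\<exists>i0. \<forall>i\<ge>i0. T \<le> task i"
proof -
  obtain i0 where i0: "T \<le> task i0" using task_unbounded by blast
  have "T \<le> task i" if "i \<ge> i0" for i using i0 task_mono[OF that] by simp
  then show ?thesis by blast
qed

lemma eventually_quality_ge: "\<exists>i0. \<forall>i\<ge>i0. Q \<le> cur_quality i"
proof -
  have "1 \<le> Suc Q" by simp
  from quality_ge_if_len_ge[OF this]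
  obtain i1 where i1: "\<forall>i\<ge>i1. Suc Q \<le> task i + 1 \<longrightarrow> Suc Q \<le> cur_quality i" by (rule exE)
  obtain i2 where i2: "\<And>i. i \<ge> i2 \<Longrightarrow> Q \<le> task i" using eventually_task_ge by blast
  show ?thesis
  proof (intro exI[of _ "max i1 i2"] allI impI)
    fix i assume "max i1 i2 \<le> i"
    then show "Q \<le> cur_quality i" using i1[THEN spec, of i] i2[of i] by simp
  qed
qed

lemma limit_in_block: "real (num i) / 2 ^ len i \<le> limit" "limit \<le> (real (num i) + 1) / 2 ^ len i"
  using limit_bounds[of i] by (simp_all add: lower_def upper_def)

text \<open>From some step on every block is even in base r at a level of at least m: the blocks of
  tasks for r by the hypothesis on levels, the others by their quality. Complete blocks are added
  up; the block in progress is counted in full, being at most N / m long.\<close>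

lemma limit_normal:
  assumes r: "r \<in> minimal_bases" and level: "\<And>m. \<exists>T. \<forall>t\<ge>T. task_base t = r \<longrightarrow> m \<le> task_level t"
  shows "normal_to_base r limit"
proof (rule normal_to_base_if_upper_bounds)
  fix m :: nat assume m: "m \<ge> 1"
  have r2: "r \<ge> 2" using r by (simp add: minimal_bases_def)
  obtain T where T: "\<And>t. t \<ge> T \<Longrightarrow> task_base t = r \<Longrightarrow> m \<le> task_level t" using level by blast
  obtain i1 where i1: "\<And>i. i \<ge> i1 \<Longrightarrow> T \<le> task i" using eventually_task_ge by blast
  obtain i2 where i2: "\<And>i. i \<ge> i2 \<Longrightarrow> max m r \<le> cur_quality i" using eventually_quality_ge by blast
  define i0 where "i0 = max i1 i2"
  define \<nu> where "\<nu> i = digits_known r (len i)" for i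
  have \<nu>_mono: "\<nu> i \<le> \<nu> j" if "i \<le> j" for i j
    using len_strict_mono that by (simp add: \<nu>_def digits_known_mono[OF r2] strict_mono_less_eq)
  have block_eq: "block r (len i) (len (Suc i)) = {\<nu> i..<\<nu> (Suc i)}" for i by (simp add: block_def \<nu>_def)
  have even: "\<exists>m'. m \<le> m' \<and> m' \<le> cur_quality i \<and>
     even_block r m' (cur_quality i) (num (Suc i)) (len i) (len (Suc i))" if i: "i \<ge> i0" for i
  proof -
    have q: "m \<le> cur_quality i" "r \<le> cur_quality i" using i2[of i] i by (simp_all add: i0_def)
    define m' where "m' = (if r = cur_base i then cur_level i else cur_quality i)"
    have "even_block r m' (cur_quality i) (num (Suc i)) (len i) (len (Suc i))"
      using good_block_even[OF step_good r] q unfolding m'_def by blast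
    moreover have "m \<le> m'"
    proof (cases "r = cur_base i \<and> on_task i")
      case True
      then have "task_base (task i) = r" using stable(1)[of i] by (simp add: cur_base_def)
      moreover have "T \<le> task i" using i1 i by (simp add: i0_def)
      ultimately have "m \<le> task_level (task i)" using T by blast
      then show ?thesis using True stable(2)[of i] by (simp add: m'_def cur_level_def)
    qed (use q in \<open>auto simp: m'_def cur_level_def\<close>)
    moreover have "m' \<le> cur_quality i"
      using level_bounds(2)[of "num i" "len i" "task i"] by (auto simp: m'_def cur_level_def cur_quality_def)
    ultimately show ?thesis by blast
  qed
  show "\<exists>K N0. \<forall>N\<ge>N0. \<forall>u v. 0 \<le> u \<longrightarrow> u \<le> v \<longrightarrow> v \<le> 1 \<longrightarrow>
     real (visits r limit {..<N} u v) \<le> K + real N * (v - u + 11 / real m)"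
  proof (rule exI[of _ "real (\<nu> i0)"], rule exI[of _ "\<nu> i0"], intro allI impI)
    fix N u v assume N: "\<nu> i0 \<le> N" and uv: "0 \<le> u" "u \<le> v" "v \<le> (1::real)"
    have blk: "real (visits r limit {\<nu> i..<\<nu> (Suc i)} u v) \<le> (real (\<nu> (Suc i)) - real (\<nu> i)) * (v - u + 10 / real m)"
      if i: "i \<ge> i0" for i
    proof -
      obtain m' where m': "m \<le> m'" "m' \<le> cur_quality i"
        "even_block r m' (cur_quality i) (num (Suc i)) (len i) (len (Suc i))" using even[OF i] by blast
      have "real (visits r limit {\<nu> i..<\<nu> (Suc i)} u v) \<le> real (card {\<nu> i..<\<nu> (Suc i)}) * (v - u + 10 / real m')"
        using even_block_visits[OF r2 m'(3) _ m'(2) limit_in_block uv] m m' by (simp add: block_eq)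
      also have "\<dots> \<le> real (card {\<nu> i..<\<nu> (Suc i)}) * (v - u + 10 / real m)"
        using m m' by (intro mult_left_mono add_left_mono divide_left_mono) auto
      finally show ?thesis using \<nu>_mono[of i "Suc i"] by (simp add: of_nat_diff)
    qed
    have cum: "real (visits r limit {..<\<nu> i} u v) \<le> real (\<nu> i0) + (real (\<nu> i) - real (\<nu> i0)) * (v - u + 10 / real m)"
      if "i \<ge> i0" for i using that
    proof (induction i rule: dec_induct)
      case base
      show ?case using visits_le_card[of "{..<\<nu> i0}" r limit u v] by simp
    next
      case (step i)
      have "visits r limit {..<\<nu> (Suc i)} u v = visits r limit {..<\<nu> i} u v + visits r limit {\<nu> i..<\<nu> (Suc i)} u v"
        by (rule visits_split) (simp add: \<nu>_mono)
      then have "real (visits r limit {..<\<nu> (Suc i)} u v)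
          = real (visits r limit {..<\<nu> i} u v) + real (visits r limit {\<nu> i..<\<nu> (Suc i)} u v)" by simp
      also have "\<dots> \<le> (real (\<nu> i0) + (real (\<nu> i) - real (\<nu> i0)) * (v - u + 10 / real m))
          + (real (\<nu> (Suc i)) - real (\<nu> i)) * (v - u + 10 / real m)"
        by (rule add_mono[OF step.IH blk[OF step.hyps(1)]])
      also have "\<dots> = real (\<nu> i0) + (real (\<nu> (Suc i)) - real (\<nu> i0)) * (v - u + 10 / real m)"
        unfolding left_diff_distrib by simp
      finally show ?case .
    qed
    have "\<exists>i\<ge>i0. \<nu> i \<le> N \<and> N < \<nu> (Suc i)"
    proof -
      have unb: "N < \<nu> (r * (N + 1))"
      proof -
        have "N + 1 \<le> len (r * (N + 1)) div r" using len_ge[of "r * (N + 1)"] r2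
          by (simp add: less_eq_div_iff_mult_less_eq mult.commute)
        then show ?thesis unfolding \<nu>_def using digits_known_ge_div[OF r2, of "len (r * (N + 1))"] by linarith
      qed
      define j where "j = (LEAST j. N < \<nu> j)"
      have j: "N < \<nu> j" unfolding j_def using unb by (rule LeastI)
      have "\<not> j \<le> i0" using \<nu>_mono[of j i0] N j by linarith
      then obtain i where ji: "j = Suc i" "i \<ge> i0" by (cases j) auto
      have "i < j" by (simp add: ji(1))
      then have "\<not> N < \<nu> i" unfolding j_def by (rule not_less_Least)
      then show ?thesis using ji j by (intro exI[of _ i]) (simp add: not_less)
    qed
    then obtain i where i: "i \<ge> i0" "\<nu> i \<le> N" "N < \<nu> (Suc i)" by blast
    have tail: "real (visits r limit {\<nu> i..<N} u v) \<le> real N * (1 / real m)"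
    proof -
      obtain m' where m': "m \<le> m'" "m' \<le> cur_quality i"
        "even_block r m' (cur_quality i) (num (Suc i)) (len i) (len (Suc i))" using even[OF i(1)] by blast
      have "visits r limit {\<nu> i..<N} u v \<le> N - \<nu> i" using visits_le_card[of "{\<nu> i..<N}" r limit u v] by simp
      also have "\<dots> \<le> \<nu> (Suc i) - \<nu> i" using i by simp
      finally have "m * visits r limit {\<nu> i..<N} u v \<le> cur_quality i * (\<nu> (Suc i) - \<nu> i)"
        using m' by (intro mult_mono) auto
      also have "\<dots> \<le> \<nu> i" using m'(3) unfolding even_block_def by (simp add: block_eq) (simp add: \<nu>_def)
      finally have "m * visits r limit {\<nu> i..<N} u v \<le> N" using i by simp
      then have "real (m * visits r limit {\<nu> i..<N} u v) \<le> real N" by (simp only: of_nat_le_iff)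
      then show ?thesis using m by (simp add: field_simps)
    qed
    have "real (visits r limit {..<N} u v) = real (visits r limit {..<\<nu> i} u v) + real (visits r limit {\<nu> i..<N} u v)"
      using visits_split[OF i(2)] by simp
    also have "\<dots> \<le> real (\<nu> i0) + (real (\<nu> i) - real (\<nu> i0)) * (v - u + 10 / real m) + real N * (1 / real m)"
      using cum[OF i(1)] tail by linarith
    also have "(real (\<nu> i) - real (\<nu> i0)) * (v - u + 10 / real m) \<le> real N * (v - u + 10 / real m)"
      using i uv by (intro mult_right_mono) auto
    also have "real (\<nu> i0) + real N * (v - u + 10 / real m) + real N * (1 / real m)
       = real (\<nu> i0) + real N * (v - u + 11 / real m)" using m by (simp add: field_simps)
    finally show "real (visits r limit {..<N} u v) \<le> real (\<nu> i0) + real N * (v - u + 11 / real m)" by simp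
  qed
qed

text \<open>The run in which t is finished, traced back to the step at which \<open>mark\<close> was
  last set.\<close>

lemma task_run:
  shows "\<exists>i0 i1. i0 \<le> i1 \<and> (\<forall>j\<in>{i0..i1}. on_task j \<and> task j = t) \<and> (t + 1) * len i0 \<le> len (Suc i1)"
proof -
  define i where "i = (LEAST i. t < task i)"
  have "\<exists>i. t < task i" using task_unbounded[of "Suc t"] by (simp add: Suc_le_eq)
  then have i: "t < task i" unfolding i_def by (rule LeastI_ex)
  then obtain i1 where i1: "i = Suc i1" by (cases i) (auto simp: state_0)
  have "\<not> t < task i1" using not_less_Least[of i1 "\<lambda>i. t < task i"] i1 by (simp add: i_def)
  then have t: "task i1 = t" "finishes i1" using i unfolding i1 step(3) by (auto split: if_splits)
  obtain i0 where i0: "i0 \<le> i1" "mark i1 = len i0" "\<And>j. i0 \<le> j \<Longrightarrow> j < i1 \<Longrightarrow> on_task j \<and> task j = task i1"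
    using mark_run[of i1] by blast
  have "on_task j \<and> task j = t" if "j \<in> {i0..i1}" for j
    using i0(3)[of j] that t by (cases "j = i1") (auto simp: finishes_def)
  moreover have "(t + 1) * len i0 \<le> len (Suc i1)" using t i0(2) by (auto simp: finishes_def)
  ultimately show ?thesis using i0(1) by blast
qed

text \<open>One run of a late task already produces the deviation. The interval [0, 1 / r + \<eta>)
  is visited too often by \<eta> in the limit; late positions cost \<eta> / 4 and the past before
  the run another \<eta> / 4. What remains is \<eta> / 2, and \<eta> depends only on k, which is the
  same for infinitely many tasks.\<close>

lemma limit_not_normal:
  assumes r: "r \<in> minimal_bases" and inf: "\<And>T. \<exists>t\<ge>T. task_base t = r \<and> task_level t = k" and k: "k \<ge> 1"
  shows "\<not> normal_to_base r limit"
proof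
  assume normal: "normal_to_base r limit"
  have r2: "r \<ge> 2" using r by (simp add: minimal_bases_def)
  have W8: "bias_scale k \<ge> 8" by (rule bias_scale_ge[OF k])
  define \<eta> where "\<eta> = 1 / (2 * real (bias_scale k))"
  have \<eta>: "0 < \<eta>" "\<eta> \<le> 1 / 16" using W8 by (simp_all add: \<eta>_def field_simps)
  have r\<eta>: "1 / real r + 2 * \<eta> \<le> 1"
  proof -
    have "1 / real r \<le> 1 / 2" using r2 by (simp add: field_simps)
    then show ?thesis using \<eta> by linarith
  qed
  have "\<forall>\<^sub>F N in sequentially. discrepancy (\<lambda>j. frac (real r ^ j * limit)) N < \<eta> / 2"
    using normal \<eta> unfolding normal_to_base_def by (intro order_tendstoD) auto
  then obtain N0 where N0: "\<And>N. N \<ge> N0 \<Longrightarrow> discrepancy (\<lambda>j. frac (real r ^ j * limit)) N < \<eta> / 2"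
    unfolding eventually_sequentially by blast
  obtain Q :: nat where Q: "8 * real r / \<eta> \<le> real Q" using real_arch_simple by blast
  \<comment> \<open>Q makes t + 1 large compared with r / \<eta>, for the sake of late positions and
    of the past; the other summand carries the end of the run beyond N0.\<close>
  obtain t where t: "t \<ge> Q + r * (N0 + 2)" "task_base t = r" "task_level t = k" using inf by blast
  obtain i0 i1 where run: "i0 \<le> i1" "\<And>j. j \<in> {i0..i1} \<Longrightarrow> on_task j \<and> task j = t" "(t + 1) * len i0 \<le> len (Suc i1)"
    using task_run[of t] by blast
  define \<nu> where "\<nu> i = digits_known r (len i)" for i
  have \<nu>_mono: "\<nu> i \<le> \<nu> j" if "i \<le> j" for i j
    using len_strict_mono that by (simp add: \<nu>_def digits_known_mono[OF r2] strict_mono_less_eq)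
  have block_eq: "block r (len i) (len (Suc i)) = {\<nu> i..<\<nu> (Suc i)}" for i by (simp add: block_def \<nu>_def)
  define q where "q = t + 1"
  have "8 * real r / \<eta> \<le> real q" using Q t by (simp add: q_def)
  then have q\<eta>: "8 * real r \<le> \<eta> * real q" using \<eta> by (simp add: field_simps)
  have q1: "1 / real q \<le> \<eta> / 4"
  proof -
    have "4 \<le> 8 * real r" using r2 by simp
    then have "4 \<le> \<eta> * real q" using q\<eta> by linarith
    then show ?thesis by (simp add: field_simps q_def)
  qed
  define w where "w = 1 / real r + \<eta>"
  have blk: "(real (\<nu> (Suc i)) - real (\<nu> i)) * (w + 3 / 4 * \<eta>) \<le> real (visits r limit {\<nu> i..<\<nu> (Suc i)} 0 w)"
    if i: "i \<in> {i0..i1}" for i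
  proof -
    have cur: "cur_base i = r" "cur_level i = k" "cur_quality i = q"
      using run(2)[OF i] stable[of i] t by (simp_all add: cur_base_def cur_level_def cur_quality_def q_def)
    note g = step_good[of i, unfolded cur]
    have bb: "biased_block r k (num (Suc i)) (len i) (len (Suc i))" using g k by (simp add: good_block_def)
    have "even_block r k q (num (Suc i)) (len i) (len (Suc i))"
      using good_block_even[OF g r] by simp
    then have q2: "q\<^sup>2 \<le> card (block r (len i) (len (Suc i)))" by (simp add: even_block_def)
    have "real (card (block r (len i) (len (Suc i)))) * (1 / real r + 1 / real (bias_scale k) - 1 / real q)
      \<le> real (visits r limit (block r (len i) (len (Suc i))) 0 w)"
      unfolding w_def
    proof (rule biased_block_visits[OF r2 bb _ q2 _ _ _ limit_in_block])
      show "0 < bias_scale k" using W8 by simp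
      show "1 \<le> q" by (simp add: q_def)
      show "1 / real q \<le> \<eta>" using q1 \<eta> by linarith
      show "1 / real r + \<eta> < 1" using r\<eta> \<eta> by linarith
    qed
    moreover have "1 / real (bias_scale k) = 2 * \<eta>" by (simp add: \<eta>_def)
    then have "w + 3 / 4 * \<eta> \<le> 1 / real r + 1 / real (bias_scale k) - 1 / real q"
      using q1 unfolding w_def by linarith
    then have "real (card (block r (len i) (len (Suc i)))) * (w + 3 / 4 * \<eta>)
      \<le> real (card (block r (len i) (len (Suc i)))) * (1 / real r + 1 / real (bias_scale k) - 1 / real q)"
      by (intro mult_left_mono) auto
    ultimately show ?thesis using \<nu>_mono[of i "Suc i"] by (simp add: block_eq of_nat_diff)
  qed
  have cum: "(real (\<nu> i) - real (\<nu> i0)) * (w + 3 / 4 * \<eta>) \<le> real (visits r limit {..<\<nu> i} 0 w)"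
    if "i0 \<le> i" "i \<le> Suc i1" for i using that
  proof (induction i rule: dec_induct)
    case (step i)
    have "visits r limit {..<\<nu> (Suc i)} 0 w = visits r limit {..<\<nu> i} 0 w + visits r limit {\<nu> i..<\<nu> (Suc i)} 0 w"
      by (rule visits_split) (simp add: \<nu>_mono)
    then have "real (visits r limit {..<\<nu> (Suc i)} 0 w)
        = real (visits r limit {..<\<nu> i} 0 w) + real (visits r limit {\<nu> i..<\<nu> (Suc i)} 0 w)" by simp
    moreover have "(real (\<nu> (Suc i)) - real (\<nu> i0)) * (w + 3 / 4 * \<eta>)
        = (real (\<nu> i) - real (\<nu> i0)) * (w + 3 / 4 * \<eta>) + (real (\<nu> (Suc i)) - real (\<nu> i)) * (w + 3 / 4 * \<eta>)"
      unfolding left_diff_distrib by simp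
    moreover have "(real (\<nu> i) - real (\<nu> i0)) * (w + 3 / 4 * \<eta>) \<le> real (visits r limit {..<\<nu> i} 0 w)"
      using step by simp
    moreover have "i \<in> {i0..i1}" using step by simp
    ultimately show ?case using blk[of i] by linarith
  qed simp
  define J where "J = \<nu> (Suc i1)"
  have J1: "(t + 1) * len i0 \<le> r * J + r"
  proof -
    have "len (Suc i1) div r \<le> J" unfolding J_def \<nu>_def by (rule digits_known_ge_div[OF r2])
    moreover have "len (Suc i1) = r * (len (Suc i1) div r) + len (Suc i1) mod r" by simp
    moreover have "len (Suc i1) mod r \<le> r" using r2 by (simp add: less_imp_le)
    ultimately have "len (Suc i1) \<le> r * J + r" by (metis add_mono mult_le_mono2)
    then show ?thesis using run(3) by linarith
  qed
  have l1: "1 \<le> len i0" using num_len by blast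
  have "(t + 1) * 1 \<le> (t + 1) * len i0" using l1 by (rule mult_le_mono2)
  then have "t \<le> r * (J + 1)" using J1 by simp
  then have "r * (N0 + 2) \<le> r * (J + 1)" using t(1) by linarith
  then have "N0 + 2 \<le> J + 1" using r2 by (simp only: mult_le_cancel1)
  then have J2: "N0 + 1 \<le> J" by simp
  then have Jpos: "real J > 0" by simp
  have small: "real (\<nu> i0) \<le> \<eta> / 4 * real J"
  proof -
    have "real ((t + 1) * len i0) \<le> real (r * J + r)" using J1 by (simp only: of_nat_le_iff)
    then have "real q * real (len i0) \<le> real r * (real J + 1)" by (simp add: q_def algebra_simps)
    also have "\<dots> \<le> real r * (2 * real J)" using J2 by (intro mult_left_mono) auto
    finally have "\<eta> * (real q * real (len i0)) \<le> \<eta> * (real r * (2 * real J))" using \<eta> by (intro mult_left_mono) auto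
    moreover have "8 * real r * real (len i0) \<le> \<eta> * real q * real (len i0)" using q\<eta> by (intro mult_right_mono) auto
    ultimately have "real r * (8 * real (len i0)) \<le> real r * (\<eta> * (2 * real J))" by (simp add: mult_ac)
    then have "8 * real (len i0) \<le> \<eta> * (2 * real J)" using r2 by simp
    moreover have "real (\<nu> i0) \<le> real (len i0)" unfolding \<nu>_def using digits_known_le by simp
    ultimately show ?thesis by linarith
  qed
  have "real J * (w + \<eta> / 2) \<le> (real J - \<eta> / 4 * real J) * (w + 3 / 4 * \<eta>)"
  proof -
    have "w + 3 / 4 * \<eta> \<le> 1" using r\<eta> \<eta> unfolding w_def by linarith
    define P where "P = \<eta> / 4 * (w + 3 / 4 * \<eta>)"
    have "P \<le> \<eta> / 4 * 1" unfolding P_def using \<open>w + 3 / 4 * \<eta> \<le> 1\<close> \<eta> by (intro mult_left_mono) auto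
    then have "w + \<eta> / 2 \<le> 1 * (w + 3 / 4 * \<eta>) - P" by simp
    then have "w + \<eta> / 2 \<le> (1 - \<eta> / 4) * (w + 3 / 4 * \<eta>)" unfolding left_diff_distrib P_def .
    then have "real J * (w + \<eta> / 2) \<le> real J * ((1 - \<eta> / 4) * (w + 3 / 4 * \<eta>))" by (intro mult_left_mono) auto
    then show ?thesis by (simp add: algebra_simps)
  qed
  also have "\<dots> \<le> (real J - real (\<nu> i0)) * (w + 3 / 4 * \<eta>)"
  proof (rule mult_right_mono)
    show "real J - \<eta> / 4 * real J \<le> real J - real (\<nu> i0)" using small by linarith
    show "0 \<le> w + 3 / 4 * \<eta>" using \<eta> by (simp add: w_def)
  qed
  also have "\<dots> \<le> real (visits r limit {..<J} 0 w)" using cum[of "Suc i1"] run(1) by (simp add: J_def)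
  finally have "w + \<eta> / 2 \<le> real (visits r limit {..<J} 0 w) / real J"
    using Jpos by (simp add: le_divide_eq mult.commute)
  moreover have "\<bar>real (visits r limit {..<J} 0 w) / real J - (w - 0)\<bar> \<le> discrepancy (\<lambda>j. frac (real r ^ j * limit)) J"
    unfolding visits_lessThan
    by (rule discrepancy_bounds(1)) (use J2 r\<eta> \<eta> r2 in \<open>auto simp: w_def add_pos_pos\<close>)
  moreover have "discrepancy (\<lambda>j. frac (real r ^ j * limit)) J < \<eta> / 2" using N0 J2 by simp
  ultimately show False by linarith
qed

end

section \<open>Computability\<close>

definition computable_list :: "nat \<Rightarrow> (nat list \<Rightarrow> nat) \<Rightarrow> bool" where
  "computable_list n f \<longleftrightarrow> (\<exists>p. \<forall>xs. length xs = n \<longrightarrow> evals_to p xs (f xs))"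

definition decidable_list :: "nat \<Rightarrow> (nat list \<Rightarrow> bool) \<Rightarrow> bool" where
  "decidable_list n P \<longleftrightarrow> computable_list n (\<lambda>xs. of_bool (P xs))"

lemma computable_list_cong:
  assumes "computable_list n f" "\<And>xs. length xs = n \<Longrightarrow> f xs = g xs"
  shows "computable_list n g"
  using assms unfolding computable_list_def by metis

lemma computable_nth: "i < n \<Longrightarrow> computable_list n (\<lambda>xs. xs ! i)"
  unfolding computable_list_def by (intro exI[of _ "Proj i"]) (auto intro: evals_to.intros)

lemma computable_comp:
  assumes "computable_list (length fs) h" and "\<And>f. f \<in> set fs \<Longrightarrow> computable_list n f"
  shows "computable_list n (\<lambda>xs. h (map (\<lambda>f. f xs) fs))"
proof -
  obtain p where p: "\<And>xs. length xs = length fs \<Longrightarrow> evals_to p xs (h xs)"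
    using assms(1) unfolding computable_list_def by blast
  have "\<exists>gs. length gs = length fs \<and> (\<forall>xs. length xs = n \<longrightarrow> list_all2 (\<lambda>g y. evals_to g xs y) gs (map (\<lambda>f. f xs) fs))"
    using assms(2)
  proof (induction fs)
    case (Cons f fs)
    then obtain gs where gs: "length gs = length fs"
      "\<forall>xs. length xs = n \<longrightarrow> list_all2 (\<lambda>g y. evals_to g xs y) gs (map (\<lambda>f. f xs) fs)" by auto
    obtain g where "\<forall>xs. length xs = n \<longrightarrow> evals_to g xs (f xs)"
      using Cons.prems[of f] unfolding computable_list_def by auto
    then show ?case using gs by (intro exI[of _ "g # gs"]) simp
  qed simp
  then obtain gs where gs: "\<And>xs. length xs = n \<Longrightarrow> list_all2 (\<lambda>g y. evals_to g xs y) gs (map (\<lambda>f. f xs) fs)" by blast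
  show ?thesis unfolding computable_list_def
    by (intro exI[of _ "Comp p gs"]) (auto intro!: evals_to.intros(4)[OF gs p])
qed

lemma computable_comp1:
  assumes "computable_list 1 (\<lambda>xs. h (xs ! 0))" "computable_list n f"
  shows "computable_list n (\<lambda>xs. h (f xs))"
  using computable_comp[of "[f]" "\<lambda>xs. h (xs ! 0)" n] assms by simp

lemma computable_Suc: "computable_list n f \<Longrightarrow> computable_list n (\<lambda>xs. Suc (f xs))"
proof (rule computable_comp1[where h = Suc])
  show "computable_list 1 (\<lambda>xs. Suc (xs ! 0))"
    unfolding computable_list_def
    by (intro exI[of _ Succ]) (auto simp: length_Suc_conv intro: evals_to.intros)
qed

lemma computable_const: "computable_list n (\<lambda>xs. c)"
proof (induction c)
  case 0
  show ?case unfolding computable_list_def by (intro exI[of _ Zero]) (auto intro: evals_to.intros)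
qed (rule computable_Suc)

text \<open>Bound variables are prepended to the argument list, as with de Bruijn indices:
  \<open>hd\<close> is the innermost variable and \<open>tl\<close> the context, from which
  functions are lifted here.\<close>

lemma computable_weaken:
  assumes "computable_list n f"
  shows "computable_list (Suc n) (\<lambda>xs. f (tl xs))"
proof (rule computable_list_cong)
  show "computable_list (Suc n) (\<lambda>xs. f (map (\<lambda>g. g xs) (map (\<lambda>i xs. xs ! Suc i) [0..<n])))"
  proof (rule computable_comp)
    show "computable_list (length (map (\<lambda>i xs. xs ! Suc i) [0..<n])) f" using assms by simp
    fix g :: "nat list \<Rightarrow> nat" assume "g \<in> set (map (\<lambda>i xs. xs ! Suc i) [0..<n])"
    then obtain i where "i < n" "g = (\<lambda>xs. xs ! Suc i)" by auto
    then show "computable_list (Suc n) g" by (simp add: computable_nth)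
  qed
  show "f (map (\<lambda>g. g xs) (map (\<lambda>i xs. xs ! Suc i) [0..<n])) = f (tl xs)" if "length xs = Suc n" for xs
  proof -
    have "map (\<lambda>g. g xs) (map (\<lambda>i xs. xs ! Suc i) [0..<n]) = tl xs"
      using that by (intro nth_equalityI) (auto simp: nth_tl)
    then show ?thesis by simp
  qed
qed

lemma computable_hd: "computable_list (Suc n) (\<lambda>xs. hd xs)"
  by (rule computable_list_cong[OF computable_nth[of 0]]) (auto simp: length_Suc_conv)

lemma computable_subst:
  assumes "computable_list (Suc n) (\<lambda>ys. h (tl ys) (hd ys))" "computable_list n c"
  shows "computable_list n (\<lambda>xs. h xs (c xs))"
proof (rule computable_list_cong)
  let ?fs = "c # map (\<lambda>i xs. xs ! i) [0..<n]"
  show "computable_list n (\<lambda>xs. (\<lambda>ys. h (tl ys) (hd ys)) (map (\<lambda>f. f xs) ?fs))"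
  proof (rule computable_comp)
    show "computable_list (length ?fs) (\<lambda>ys. h (tl ys) (hd ys))" using assms(1) by simp
    fix g :: "nat list \<Rightarrow> nat" assume "g \<in> set ?fs"
    then consider "g = c" | i where "i < n" "g = (\<lambda>xs. xs ! i)" by auto
    then show "computable_list n g" by cases (simp_all add: assms(2) computable_nth)
  qed
  fix xs :: "nat list" assume "length xs = n"
  then have "map (\<lambda>f. f xs) (map (\<lambda>i xs. xs ! i) [0..<n]) = xs" by (intro nth_equalityI) auto
  then show "(\<lambda>ys. h (tl ys) (hd ys)) (map (\<lambda>f. f xs) ?fs) = h xs (c xs)" by simp
qed

lemma computable_rec:
  assumes "computable_list n z" "computable_list (Suc (Suc n)) (\<lambda>ys. st (tl (tl ys)) (hd ys) (hd (tl ys)))"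
    and "computable_list n c"
  shows "computable_list n (\<lambda>xs. rec_nat (z xs) (\<lambda>i y. st xs i y) (c xs))"
proof -
  obtain p where p: "\<And>xs. length xs = n \<Longrightarrow> evals_to p xs (z xs)"
    using assms(1) unfolding computable_list_def by blast
  obtain q where q: "\<And>ys. length ys = Suc (Suc n) \<Longrightarrow> evals_to q ys (st (tl (tl ys)) (hd ys) (hd (tl ys)))"
    using assms(2) unfolding computable_list_def by blast
  have ev: "evals_to (PrimRec p q) (k # xs) (rec_nat (z xs) (\<lambda>i y. st xs i y) k)" if "length xs = n" for k xs
  proof (induction k)
    case 0
    show ?case using p[OF that] by (auto intro: evals_to.intros)
  next
    case (Suc k)
    have "evals_to q (k # rec_nat (z xs) (\<lambda>i y. st xs i y) k # xs) (st xs k (rec_nat (z xs) (\<lambda>i y. st xs i y) k))"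
      using q[of "k # rec_nat (z xs) (\<lambda>i y. st xs i y) k # xs"] that by simp
    then show ?case using Suc by (auto intro: evals_to.intros)
  qed
  have "computable_list (Suc n) (\<lambda>ys. rec_nat (z (tl ys)) (\<lambda>i y. st (tl ys) i y) (hd ys))"
    unfolding computable_list_def
    by (intro exI[of _ "PrimRec p q"]) (auto simp: length_Suc_conv intro: ev)
  then show ?thesis using assms(3) by (rule computable_subst)
qed

lemmas computable_vars = computable_hd computable_hd[THEN computable_weaken]
  computable_hd[THEN computable_weaken, THEN computable_weaken]
  computable_hd[THEN computable_weaken, THEN computable_weaken, THEN computable_weaken]

lemma computable_add:
  assumes "computable_list n f" "computable_list n g"
  shows "computable_list n (\<lambda>xs. f xs + g xs)"
proof -
  have eq: "f xs + g xs = rec_nat (f xs) (\<lambda>i y. Suc y) (g xs)" for xs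
  proof -
    have "a + b = rec_nat a (\<lambda>i y. Suc y) b" for a b :: nat by (induction b) simp_all
    then show ?thesis .
  qed
  show ?thesis unfolding eq by (intro computable_rec computable_Suc computable_vars assms)
qed

lemma computable_mult:
  assumes "computable_list n f" "computable_list n g"
  shows "computable_list n (\<lambda>xs. f xs * g xs)"
proof -
  have eq: "f xs * g xs = rec_nat 0 (\<lambda>i y. y + f xs) (g xs)" for xs
  proof -
    have "a * b = rec_nat 0 (\<lambda>i y. y + a) b" for a b :: nat by (induction b) simp_all
    then show ?thesis .
  qed
  show ?thesis unfolding eq
    by (intro computable_rec computable_const computable_add computable_vars assms assms[THEN computable_weaken, THEN computable_weaken])
qed

lemma computable_power:
  assumes "computable_list n f" "computable_list n g"
  shows "computable_list n (\<lambda>xs. f xs ^ g xs)"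
proof -
  have eq: "f xs ^ g xs = rec_nat 1 (\<lambda>i y. f xs * y) (g xs)" for xs
  proof -
    have "a ^ b = rec_nat 1 (\<lambda>i y. a * y) b" for a b :: nat by (induction b) simp_all
    then show ?thesis .
  qed
  show ?thesis unfolding eq
    by (intro computable_rec computable_const computable_mult computable_vars assms assms[THEN computable_weaken, THEN computable_weaken])
qed

lemma computable_diff:
  assumes "computable_list n f" "computable_list n g"
  shows "computable_list n (\<lambda>xs. f xs - g xs)"
proof -
  have eq: "f xs - g xs = rec_nat (f xs) (\<lambda>i y. rec_nat 0 (\<lambda>j z. j) y) (g xs)" for xs
  proof -
    have pred: "rec_nat 0 (\<lambda>j z. j) y = y - 1" for y :: nat by (cases y) simp_all
    have "a - b = rec_nat a (\<lambda>i y. y - 1) b" for a b :: nat by (induction b) simp_all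
    then show ?thesis unfolding pred .
  qed
  show ?thesis unfolding eq by (intro computable_rec computable_const computable_vars assms)
qed

text \<open>Primitive recursion puts the accumulated value behind the counter; this lifts a body
  that reads the counter but not the accumulated value.\<close>

lemma computable_weaken_second:
  assumes "computable_list (Suc n) (\<lambda>ys. f (tl ys) (hd ys))"
  shows "computable_list (Suc (Suc n)) (\<lambda>ys. f (tl (tl ys)) (hd ys))"
proof (rule computable_list_cong)
  show "computable_list (Suc (Suc n)) (\<lambda>xs. (\<lambda>ys. f (tl ys) (hd ys)) (map (\<lambda>g. g xs) (hd # map (\<lambda>i xs. tl (tl xs) ! i) [0..<n])))"
  proof (rule computable_comp)
    show "computable_list (length (hd # map (\<lambda>i xs. tl (tl xs) ! i) [0..<n])) (\<lambda>ys. f (tl ys) (hd ys))"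
      using assms by simp
    show "computable_list (Suc (Suc n)) g" if "g \<in> set (hd # map (\<lambda>i xs. tl (tl xs) ! i) [0..<n])" for g
      using that by (auto intro: computable_hd computable_nth[THEN computable_weaken, THEN computable_weaken])
  qed
  fix xs :: "nat list" assume xs: "length xs = Suc (Suc n)"
  have "map (\<lambda>i. tl (tl xs) ! i) [0..<n] = tl (tl xs)" using xs by (intro nth_equalityI) auto
  then show "f (tl (map (\<lambda>g. g xs) (hd # map (\<lambda>i xs. tl (tl xs) ! i) [0..<n])))
      (hd (map (\<lambda>g. g xs) (hd # map (\<lambda>i xs. tl (tl xs) ! i) [0..<n]))) = f (tl (tl xs)) (hd xs)"
    by (simp add: comp_def)
qed

lemma computable_sum:
  assumes "computable_list n b" "computable_list (Suc n) (\<lambda>ys. f (tl ys) (hd ys))"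
  shows "computable_list n (\<lambda>xs. \<Sum>i<b xs. f xs i)"
proof -
  have eq: "(\<Sum>i<b xs. f xs i) = rec_nat 0 (\<lambda>i y. y + f xs i) (b xs)" for xs
  proof -
    have "(\<Sum>i<c. f xs i) = rec_nat 0 (\<lambda>i y. y + f xs i) c" for c by (induction c) simp_all
    then show ?thesis .
  qed
  have "computable_list (Suc (Suc n)) (\<lambda>ys. f (tl (tl ys)) (hd ys))" by (rule computable_weaken_second[OF assms(2)])
  then show ?thesis unfolding eq
    by (intro computable_rec computable_const computable_add computable_vars assms(1))
qed

lemma decidable_not: "decidable_list n P \<Longrightarrow> decidable_list n (\<lambda>xs. \<not> P xs)"
proof -
  assume "decidable_list n P"
  moreover have "of_bool (\<not> P xs) = 1 - (of_bool (P xs) :: nat)" for xs by simp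
  ultimately show ?thesis unfolding decidable_list_def by (simp only:) (intro computable_diff computable_const)
qed

lemma decidable_conj: "decidable_list n P \<Longrightarrow> decidable_list n Q \<Longrightarrow> decidable_list n (\<lambda>xs. P xs \<and> Q xs)"
  unfolding decidable_list_def of_bool_conj by (rule computable_mult)

lemma decidable_disj: "decidable_list n P \<Longrightarrow> decidable_list n Q \<Longrightarrow> decidable_list n (\<lambda>xs. P xs \<or> Q xs)"
  using decidable_not[OF decidable_conj[OF decidable_not decidable_not], of n P Q] by simp

lemma decidable_imp: "decidable_list n P \<Longrightarrow> decidable_list n Q \<Longrightarrow> decidable_list n (\<lambda>xs. P xs \<longrightarrow> Q xs)"
  unfolding imp_conv_disj by (intro decidable_disj decidable_not)

lemma decidable_le: "computable_list n f \<Longrightarrow> computable_list n g \<Longrightarrow> decidable_list n (\<lambda>xs. f xs \<le> g xs)"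
proof -
  assume fg: "computable_list n f" "computable_list n g"
  have "of_bool (f xs \<le> g xs) = 1 - (f xs - g xs)" for xs by auto
  then show ?thesis unfolding decidable_list_def by (simp only:) (intro computable_diff computable_const fg)
qed

lemma decidable_less: "computable_list n f \<Longrightarrow> computable_list n g \<Longrightarrow> decidable_list n (\<lambda>xs. f xs < g xs)"
  unfolding less_eq_Suc_le by (intro decidable_le computable_Suc)

lemma decidable_eq: "computable_list n f \<Longrightarrow> computable_list n g \<Longrightarrow> decidable_list n (\<lambda>xs. f xs = g xs)"
  unfolding eq_iff[where 'a = nat] by (intro decidable_conj decidable_le)

lemma decidable_ball:
  assumes "computable_list n b" "decidable_list (Suc n) (\<lambda>ys. P (tl ys) (hd ys))"
  shows "decidable_list n (\<lambda>xs. \<forall>i<b xs. P xs i)"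
proof -
  have eq: "(\<forall>i<b xs. P xs i) \<longleftrightarrow> (\<Sum>i<b xs. of_bool (\<not> P xs i)) = (0::nat)" for xs
    by (simp add: sum_eq_0_iff Ball_def del: sum_of_bool_eq)
  show ?thesis unfolding eq
    by (intro decidable_eq computable_sum computable_const assms(1)) (fold decidable_list_def, intro decidable_not assms(2))
qed

lemma decidable_bex:
  assumes "computable_list n b" "decidable_list (Suc n) (\<lambda>ys. P (tl ys) (hd ys))"
  shows "decidable_list n (\<lambda>xs. \<exists>i<b xs. P xs i)"
  using decidable_not[OF decidable_ball[OF assms(1) decidable_not[OF assms(2)]]] by simp

lemma decidable_ball_le:
  assumes "computable_list n b" "decidable_list (Suc n) (\<lambda>ys. P (tl ys) (hd ys))"
  shows "decidable_list n (\<lambda>xs. \<forall>i\<le>b xs. P xs i)"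
  using decidable_ball[OF computable_Suc[OF assms(1)] assms(2)] by (simp add: less_Suc_eq_le)

lemma decidable_bex_le:
  assumes "computable_list n b" "decidable_list (Suc n) (\<lambda>ys. P (tl ys) (hd ys))"
  shows "decidable_list n (\<lambda>xs. \<exists>i\<le>b xs. P xs i)"
  using decidable_bex[OF computable_Suc[OF assms(1)] assms(2)] by (simp add: less_Suc_eq_le)

lemma computable_if:
  assumes "decidable_list n P" "computable_list n f" "computable_list n g"
  shows "computable_list n (\<lambda>xs. if P xs then f xs else g xs)"
proof -
  have eq: "(if P xs then f xs else g xs) = of_bool (P xs) * f xs + of_bool (\<not> P xs) * g xs" for xs by simp
  show ?thesis unfolding eq using assms(1) decidable_not[OF assms(1)] unfolding decidable_list_def
    by (intro computable_add computable_mult assms(2,3))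
qed

lemma decidable_if:
  assumes "decidable_list n P" "decidable_list n Q" "decidable_list n R"
  shows "decidable_list n (\<lambda>xs. if P xs then Q xs else R xs)"
  unfolding if_bool_eq_conj by (intro decidable_conj decidable_imp decidable_not assms)

lemma computable_card:
  assumes "computable_list n b" "decidable_list (Suc n) (\<lambda>ys. P (tl ys) (hd ys))"
  shows "computable_list n (\<lambda>xs. card {i. i < b xs \<and> P xs i})"
proof -
  have eq: "card {i. i < b xs \<and> P xs i} = (\<Sum>i<b xs. of_bool (P xs i))" for xs
  proof -
    have "(\<Sum>i<b xs. of_bool (P xs i)) = card ({..<b xs} \<inter> {i. P xs i})" by simp
    also have "{..<b xs} \<inter> {i. P xs i} = {i. i < b xs \<and> P xs i}" by auto
    finally show ?thesis by simp
  qed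
  show ?thesis unfolding eq using assms unfolding decidable_list_def by (rule computable_sum)
qed

lemma computable_div:
  assumes f: "computable_list n f" and g: "computable_list n g"
  shows "computable_list n (\<lambda>xs. f xs div g xs)"
proof -
  have eq: "f xs div g xs = card {i. i < f xs \<and> (0 < g xs \<and> Suc i * g xs \<le> f xs)}" for xs
  proof (cases "g xs = 0")
    case False
    have "i < f xs \<and> (0 < g xs \<and> Suc i * g xs \<le> f xs) \<longleftrightarrow> i < f xs div g xs" for i
    proof -
      have "i < f xs div g xs \<longleftrightarrow> Suc i * g xs \<le> f xs"
        using False by (simp add: less_eq_div_iff_mult_less_eq flip: Suc_le_eq)
      moreover have "f xs div g xs \<le> f xs" by (rule div_le_dividend)
      then have "i < f xs" if "i < f xs div g xs" using that by linarith
      ultimately show ?thesis using False by blast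
    qed
    then show ?thesis by (simp add: lessThan_def[symmetric])
  qed simp
  show ?thesis unfolding eq
    by (intro computable_card decidable_conj decidable_less decidable_le computable_mult computable_Suc
        computable_const computable_vars f g f[THEN computable_weaken] g[THEN computable_weaken])
qed

lemma computable_mod:
  assumes "computable_list n f" "computable_list n g"
  shows "computable_list n (\<lambda>xs. f xs mod g xs)"
  unfolding modulo_nat_def by (intro computable_diff computable_mult computable_div assms)

lemma computable_prod_encode:
  assumes "computable_list n f" "computable_list n g"
  shows "computable_list n (\<lambda>xs. prod_encode (f xs, g xs))"
  unfolding prod_encode_def triangle_def prod.case
  by (intro computable_add computable_div computable_mult computable_Suc computable_const assms)

lemma computable_fst_decode:
  assumes f: "computable_list n f"
  shows "computable_list n (\<lambda>xs. fst (prod_decode (f xs)))"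
proof -
  have eq: "fst (prod_decode z) = card {i. i < Suc z \<and> (\<exists>k<Suc z. i < k \<and> (\<exists>j<Suc z. prod_encode (k, j) = z))}" for z
  proof -
    obtain a b where ab: "prod_decode z = (a, b)" by fastforce
    then have z: "z = prod_encode (a, b)" by (metis prod_decode_inverse)
    have "(\<exists>k<Suc z. i < k \<and> (\<exists>j<Suc z. prod_encode (k, j) = z)) \<longleftrightarrow> i < a" for i
      using le_prod_encode_1[of a b] le_prod_encode_2[of b a] by (auto simp: z prod_encode_eq less_Suc_eq_le)
    moreover have "a \<le> z" using le_prod_encode_1[of a b] z by simp
    ultimately have "{i. i < Suc z \<and> (\<exists>k<Suc z. i < k \<and> (\<exists>j<Suc z. prod_encode (k, j) = z))} = {..<a}" by auto
    then show ?thesis using ab by simp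
  qed
  note f' = f f[THEN computable_weaken] f[THEN computable_weaken, THEN computable_weaken]
    f[THEN computable_weaken, THEN computable_weaken, THEN computable_weaken]
  show ?thesis unfolding eq
    by (intro computable_card decidable_bex decidable_conj decidable_less decidable_eq computable_prod_encode
        computable_Suc computable_vars f')
qed

lemma computable_snd_decode:
  assumes f: "computable_list n f"
  shows "computable_list n (\<lambda>xs. snd (prod_decode (f xs)))"
proof -
  have eq: "snd (prod_decode z) = card {i. i < Suc z \<and> (\<exists>k<Suc z. i < k \<and> (\<exists>j<Suc z. prod_encode (j, k) = z))}" for z
  proof -
    obtain a b where ab: "prod_decode z = (a, b)" by fastforce
    then have z: "z = prod_encode (a, b)" by (metis prod_decode_inverse)
    have "(\<exists>k<Suc z. i < k \<and> (\<exists>j<Suc z. prod_encode (j, k) = z)) \<longleftrightarrow> i < b" for i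
      using le_prod_encode_1[of a b] le_prod_encode_2[of b a] by (auto simp: z prod_encode_eq less_Suc_eq_le)
    moreover have "b \<le> z" using le_prod_encode_2[of b a] z by simp
    ultimately have "{i. i < Suc z \<and> (\<exists>k<Suc z. i < k \<and> (\<exists>j<Suc z. prod_encode (j, k) = z))} = {..<b}" by auto
    then show ?thesis using ab by simp
  qed
  note f' = f f[THEN computable_weaken] f[THEN computable_weaken, THEN computable_weaken]
    f[THEN computable_weaken, THEN computable_weaken, THEN computable_weaken]
  show ?thesis unfolding eq
    by (intro computable_card decidable_bex decidable_conj decidable_less decidable_eq computable_prod_encode
        computable_Suc computable_vars f')
qed

lemmas computable_intros = computable_const computable_Suc computable_add computable_mult computable_power
  computable_diff computable_div computable_mod computable_if computable_sum computable_card computable_vars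
  computable_prod_encode computable_fst_decode computable_snd_decode
  decidable_not decidable_conj decidable_disj decidable_imp decidable_le decidable_less decidable_eq
  decidable_ball decidable_bex decidable_ball_le decidable_bex_le decidable_if

section \<open>Decidability of minimality of a base\<close>

lemma mult_dependent_powers:
  assumes "r \<ge> 2" "s \<ge> 2" "mult_dependent s r"
  shows "\<exists>a b. a \<ge> 1 \<and> b \<ge> 1 \<and> r ^ a = s ^ b"
proof -
  have powers: "\<exists>a b. a \<ge> 1 \<and> b \<ge> 1 \<and> y ^ a = x ^ b"
    if xy: "x \<ge> 2" "y \<ge> 2" and q: "q \<in> \<rat>" "real y = real x powr q" for x y :: nat and q
  proof -
    have "q > 0"
    proof (rule ccontr)
      assume "\<not> q > 0"
      then have "real x powr q \<le> real x powr 0" using xy by (intro powr_mono) auto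
      then show False using xy q by simp
    qed
    then obtain A B :: nat where AB: "B \<noteq> 0" "q = real A / real B"
      using Rats_abs_nat_div_natE[OF q(1)] by (metis abs_of_pos)
    then have A: "A \<ge> 1" using \<open>q > 0\<close> by (cases A) auto
    have "real y ^ B = real y powr real B" using xy by (simp add: powr_realpow)
    also have "\<dots> = real x powr (q * real B)" unfolding q(2) by (simp add: powr_powr)
    also have "\<dots> = real x ^ A" using AB xy by (simp add: powr_realpow)
    finally have "y ^ B = x ^ A" by (simp flip: of_nat_power)
    then show ?thesis using A AB by (intro exI[of _ B] exI[of _ A]) simp
  qed
  from assms(3) obtain q where "q \<in> \<rat>" "real s = real r powr q \<or> real r = real s powr q"
    by (auto simp: mult_dependent_def)
  then show ?thesis using powers[of r s q] powers[of s r q] assms(1,2) by metis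
qed

lemma powers_coprime_exponents:
  fixes r s a b :: nat
  assumes "a \<ge> 1" "b \<ge> 1" "r ^ a = s ^ b"
  shows "\<exists>a' b'. a' \<ge> 1 \<and> b' \<ge> 1 \<and> coprime a' b' \<and> r ^ a' = s ^ b'"
proof -
  let ?g = "gcd a b"
  obtain a' b' where ab: "a = a' * ?g" "b = b' * ?g" "coprime a' b'"
    using assms gcd_coprime_exists[of a b] by auto
  have g: "?g > 0" using assms by simp
  have "(r ^ a') ^ ?g = (s ^ b') ^ ?g" using assms(3) ab by (metis power_mult)
  then have "r ^ a' = s ^ b'" using g by (simp add: power_eq_iff_eq_base)
  moreover have "a' \<ge> 1" "b' \<ge> 1" using ab assms by (metis One_nat_def Suc_leI mult_0 not_gr_zero not_one_le_zero)+
  ultimately show ?thesis using ab by blast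
qed

text \<open>For a prime p dividing s, comparing multiplicities gives a v_p(r) = b v_p(s). By
  coprimality a divides v_p(s) and b divides v_p(r), and v_p(x) \<le> x.\<close>

lemma coprime_exponents_bounded:
  fixes r s a b :: nat
  assumes "r \<ge> 2" "s \<ge> 2" "a \<ge> 1" "b \<ge> 1" "coprime a b" "r ^ a = s ^ b"
  shows "a \<le> s \<and> b \<le> r"
proof -
  obtain p where p: "prime p" "p dvd s" using prime_factor_nat[of s] assms by auto
  have mult: "a * multiplicity p r = b * multiplicity p s"
    using assms p by (metis prime_elem_multiplicity_power_distrib prime_imp_prime_elem not_numeral_le_zero)
  have ms: "multiplicity p s > 0" using p assms by (simp add: prime_multiplicity_gt_zero_iff)
  then have "b * multiplicity p s > 0" using assms by simp
  then have mr: "multiplicity p r > 0" unfolding mult[symmetric] by simp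
  have le: "multiplicity p x \<le> x" if "x > 0" for x
  proof -
    have "multiplicity p x < 2 ^ multiplicity p x" by (rule less_exp)
    also have "\<dots> \<le> p ^ multiplicity p x" using prime_ge_2_nat[OF p(1)] by (intro power_mono) auto
    also have "\<dots> \<le> x" using multiplicity_dvd[of p x] that by (rule dvd_imp_le)
    finally show ?thesis by simp
  qed
  have "a dvd b * multiplicity p s" using mult by (metis dvd_triv_left)
  then have "a dvd multiplicity p s" using assms(5) by (simp add: coprime_dvd_mult_right_iff)
  then have "a \<le> multiplicity p s" using ms by (rule dvd_imp_le)
  moreover have "b dvd a * multiplicity p r" using mult by (metis dvd_triv_left)
  then have "b dvd multiplicity p r" using assms(5) by (simp add: coprime_dvd_mult_right_iff coprime_commute)
  then have "b \<le> multiplicity p r" using mr by (rule dvd_imp_le)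
  ultimately show ?thesis using le[of s] le[of r] assms by simp
qed

text \<open>Dependence is an equation between powers with exponents that can be taken coprime, hence
  bounded; a finite search replaces the quantifier over rationals.\<close>

lemma minimal_bases_iff:
  "r \<in> minimal_bases \<longleftrightarrow> 2 \<le> r \<and> (\<forall>s<r. 2 \<le> s \<longrightarrow> \<not> (\<exists>a\<le>s. \<exists>b\<le>r. 1 \<le> a \<and> r ^ a = s ^ b))"
proof (intro iffI conjI allI impI notI)
  assume r: "r \<in> minimal_bases"
  then show r2: "2 \<le> r" by (simp add: minimal_bases_def)
  fix s assume s: "s < r" "2 \<le> s" and "\<exists>a\<le>s. \<exists>b\<le>r. 1 \<le> a \<and> r ^ a = s ^ b"
  then obtain a b where ab: "1 \<le> a" "r ^ a = s ^ b" by blast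
  have "real r = real s powr (real b / real a)"
  proof -
    have "real s powr (real b / real a) = (real s powr real b) powr (1 / real a)" by (simp add: powr_powr)
    also have "real s powr real b = real r powr real a"
      using ab(2) s r2 by (simp add: powr_realpow flip: of_nat_power)
    also have "(real r powr real a) powr (1 / real a) = real r" using ab r2 by (simp add: powr_powr)
    finally show ?thesis by simp
  qed
  moreover have "real b / real a \<in> \<rat>" by (intro Rats_divide) auto
  ultimately have "mult_dependent s r" by (auto simp: mult_dependent_def)
  then show False using r s by (auto simp: minimal_bases_def)
next
  assume r: "2 \<le> r \<and> (\<forall>s<r. 2 \<le> s \<longrightarrow> \<not> (\<exists>a\<le>s. \<exists>b\<le>r. 1 \<le> a \<and> r ^ a = s ^ b))"
  show "r \<in> minimal_bases" unfolding minimal_bases_def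
  proof (intro CollectI conjI allI impI)
    show "2 \<le> r" using r by blast
    fix s assume s: "2 \<le> s" "mult_dependent s r"
    show "r \<le> s"
    proof (rule ccontr)
      assume "\<not> r \<le> s"
      then have "s < r" by simp
      obtain a b where "a \<ge> 1" "b \<ge> 1" "r ^ a = s ^ b"
        using mult_dependent_powers[OF \<open>2 \<le> r\<close> s] by blast
      from powers_coprime_exponents[OF this]
      obtain a b where ab: "a \<ge> 1" "b \<ge> 1" "coprime a b" "r ^ a = s ^ b" by blast
      then show False using coprime_exponents_bounded[OF \<open>2 \<le> r\<close> s(1) ab] r s \<open>s < r\<close> by blast
    qed
  qed
qed

lemma decidable_minimal_bases:
  assumes "computable_list n f"
  shows "decidable_list n (\<lambda>xs. f xs \<in> minimal_bases)"
proof -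
  note w = assms assms[THEN computable_weaken] assms[THEN computable_weaken, THEN computable_weaken]
    assms[THEN computable_weaken, THEN computable_weaken, THEN computable_weaken]
  show ?thesis unfolding minimal_bases_iff by (intro computable_intros w)
qed

section \<open>Computability of the construction\<close>

lemma computable_digits_known:
  assumes "computable_list n f" "computable_list n g"
  shows "computable_list n (\<lambda>xs. digits_known (f xs) (g xs))"
  unfolding digits_known_def by (intro computable_intros assms assms[THEN computable_weaken])

lemma computable_cell:
  assumes "computable_list n r" "computable_list n m" "computable_list n a" "computable_list n l" "computable_list n j"
  shows "computable_list n (\<lambda>xs. cell (r xs) (m xs) (a xs) (l xs) (j xs))"
  unfolding cell_def by (intro computable_intros assms)

lemma computable_card_block:
  assumes "computable_list n r" "computable_list n l" "computable_list n l'"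
  shows "computable_list n (\<lambda>xs. card (block (r xs) (l xs) (l' xs)))"
  unfolding block_def card_atLeastLessThan by (intro computable_diff computable_digits_known assms)

lemma computable_card_in_block:
  assumes rl: "computable_list n r" "computable_list n l" "computable_list n l'"
    and P: "decidable_list (Suc n) (\<lambda>ys. P (tl ys) (hd ys))"
  shows "computable_list n (\<lambda>xs. card {j \<in> block (r xs) (l xs) (l' xs). P xs j})"
proof -
  have eq: "{j \<in> block (r xs) (l xs) (l' xs). P xs j}
      = {j. j < digits_known (r xs) (l' xs) \<and> (digits_known (r xs) (l xs) \<le> j \<and> P xs j)}" for xs
    by (auto simp: block_def)
  show ?thesis unfolding eq
    by (intro computable_card decidable_conj decidable_le computable_digits_known computable_vars
        rl rl[THEN computable_weaken] P)
qed

lemma computable_bias_scale: "computable_list n k \<Longrightarrow> computable_list n (\<lambda>xs. bias_scale (k xs))"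
  unfolding bias_scale_def weyl_order_def by (intro computable_intros)

lemmas computable_block_intros = computable_intros computable_digits_known computable_cell
  computable_card_block computable_card_in_block computable_bias_scale decidable_minimal_bases

lemma decidable_even_block:
  assumes "computable_list n r" "computable_list n m" "computable_list n q" "computable_list n a"
    "computable_list n l" "computable_list n l'"
  shows "decidable_list n (\<lambda>xs. even_block (r xs) (m xs) (q xs) (a xs) (l xs) (l' xs))"
  unfolding even_block_def
  by (intro computable_block_intros assms assms[THEN computable_weaken]
      assms[THEN computable_weaken, THEN computable_weaken])

lemma decidable_biased_block:
  assumes "computable_list n s" "computable_list n k" "computable_list n a" "computable_list n l" "computable_list n l'"
  shows "decidable_list n (\<lambda>xs. biased_block (s xs) (k xs) (a xs) (l xs) (l' xs))"
  unfolding biased_block_def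
  by (intro computable_block_intros assms assms[THEN computable_weaken])

lemma decidable_good_block:
  assumes "computable_list n s" "computable_list n k" "computable_list n q" "computable_list n a"
    "computable_list n l" "computable_list n a'" "computable_list n l'"
  shows "decidable_list n (\<lambda>xs. good_block (s xs) (k xs) (q xs) (a xs) (l xs) (a' xs) (l' xs))"
  unfolding good_block_def max_def
  by (intro computable_block_intros decidable_even_block decidable_biased_block assms assms[THEN computable_weaken])

lemma computable_codes:
  assumes "computable_list n l"
  shows "computable_list n (\<lambda>xs. code_range (l xs))"
    and "computable_list n v \<Longrightarrow> computable_list n (\<lambda>xs. new_len (l xs) (v xs))"
    and "computable_list n v \<Longrightarrow> computable_list n (\<lambda>xs. new_num (l xs) (v xs))"
  unfolding new_len_def new_num_def code_range_def by (intro computable_intros assms; assumption)+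

lemma computable_dyadic_name:
  assumes "computable_list n a" "computable_list n l" "computable_list n i"
  shows "computable_list n (\<lambda>xs. dyadic_name (a xs) (l xs) (i xs))"
  unfolding dyadic_name_def by (intro computable_intros assms)

lemma computable_least_below:
  assumes b: "computable_list n b" and P: "decidable_list (Suc n) (\<lambda>ys. P (tl ys) (hd ys))"
  shows "computable_list n (\<lambda>xs. least_below (b xs) (P xs))"
proof -
  have P': "decidable_list (Suc (Suc n)) (\<lambda>ys. P (tl (tl ys)) (hd ys))"
    using computable_weaken_second[of n "\<lambda>xs i. of_bool (P xs i)"] P unfolding decidable_list_def by blast
  show ?thesis unfolding least_below_def
    by (intro computable_card decidable_ball decidable_not computable_Suc computable_vars b P')
qed

locale computable_search = block_search +
  assumes computable_base: "\<And>m a n t. \<lbrakk>computable_list m a; computable_list m n; computable_list m t\<rbrakk>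
      \<Longrightarrow> computable_list m (\<lambda>xs. base (a xs) (n xs) (t xs))"
    and computable_level: "\<And>m a n t. \<lbrakk>computable_list m a; computable_list m n; computable_list m t\<rbrakk>
      \<Longrightarrow> computable_list m (\<lambda>xs. level (a xs) (n xs) (t xs))"
    and computable_use_bound: "\<And>m t. computable_list m t \<Longrightarrow> computable_list m (\<lambda>xs. use_bound (t xs))"
begin

lemma decidable_candidate:
  assumes "computable_list m a" "computable_list m n" "computable_list m t" "computable_list m v"
  shows "decidable_list m (\<lambda>xs. candidate (a xs) (n xs) (t xs) (v xs))"
  unfolding candidate_def Let_def
  by (intro computable_intros decidable_good_block computable_codes computable_base computable_level assms)

lemma computable_chosen:
  assumes "computable_list m a" "computable_list m n" "computable_list m t"
  shows "computable_list m (\<lambda>xs. chosen (a xs) (n xs) (t xs))"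
  unfolding chosen_def
  by (intro computable_least_below decidable_candidate computable_intros computable_codes assms assms[THEN computable_weaken])

definition "encode_state = (\<lambda>(a, n, t, b). prod_encode (a, prod_encode (n, prod_encode (t, b))))"

definition "decode_state c = (let c1 = snd (prod_decode c); c2 = snd (prod_decode c1)
  in (fst (prod_decode c), fst (prod_decode c1), fst (prod_decode c2), snd (prod_decode c2)))"

lemma decode_encode_state: "decode_state (encode_state \<sigma>) = \<sigma>"
  by (cases \<sigma>) (simp add: encode_state_def decode_state_def)

text \<open>The state is packed into one number because primitive recursion carries a single
  value.\<close>

lemma state_rec: "encode_state (state i)
   = rec_nat (encode_state (0, use_bound 0 + 1, 0, use_bound 0 + 1)) (\<lambda>_ c. encode_state (next_state (decode_state c))) i"
proof (induction i)
  case (Suc i)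
  have "state (Suc i) = next_state (state i)" by (simp add: state_def)
  then show ?case using arg_cong[where f = decode_state, OF Suc] by (simp add: decode_encode_state)
qed (simp add: state_def)

lemma computable_state:
  assumes "computable_list m i"
  shows "computable_list m (\<lambda>xs. encode_state (state (i xs)))"
  unfolding state_rec
  unfolding decode_state_def next_state_def encode_state_def Let_def prod.case fst_conv snd_conv
  by (intro computable_rec computable_intros computable_codes computable_chosen computable_use_bound assms)

text \<open>Digit i can be read off at step i, since each step increases the precision by at least
  one.\<close>

lemma computable_real_limit: "computable_real limit"
proof -
  have num: "num i = fst (decode_state (encode_state (state i)))" for i
    by (simp add: num_def decode_encode_state)
  have len: "len i = fst (snd (decode_state (encode_state (state i))))" for i
    by (simp add: len_def decode_encode_state)
  have i: "computable_list 1 (\<lambda>xs. xs ! 0)" by (rule computable_nth) simp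
  have "computable_list 1 (\<lambda>xs. dyadic_name (num (xs ! 0)) (len (xs ! 0)) (xs ! 0))"
    unfolding num len decode_state_def Let_def fst_conv snd_conv
    by (intro computable_dyadic_name computable_fst_decode computable_snd_decode computable_state i)
  then obtain p where p: "\<And>xs. length xs = 1 \<Longrightarrow> evals_to p xs (dyadic_name (num (xs ! 0)) (len (xs ! 0)) (xs ! 0))"
    unfolding computable_list_def by blast
  have "evals_to p [i] (real_name limit i)" for i
    using p[of "[i]"] real_name_limit[OF len_ge, of i] by simp
  then show ?thesis unfolding computable_real_def computable_fun_def by blast
qed

end

section \<open>Arithmetical formulas\<close>

lemma power_sum_le:
  fixes b c d :: nat
  assumes "b \<ge> 2"
  shows "b ^ c + b ^ d \<le> b ^ (c + d + 1)"
proof -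
  have "b ^ c \<le> b ^ (c + d)" "b ^ d \<le> b ^ (c + d)" using assms by (auto intro: power_increasing)
  then have "b ^ c + b ^ d \<le> 2 * b ^ (c + d)" by simp
  also have "\<dots> \<le> b * b ^ (c + d)" using assms by (rule mult_le_mono1)
  finally show ?thesis by simp
qed

text \<open>Bounds by powers of t + 2 survive sums and products because t + 2 \<ge> 2, and an
  application of the 0-1-valued function variable resets the bound to 1.\<close>

lemma trm_bound:
  "\<exists>c. \<forall>X e t. (\<forall>i. X i \<le> 1) \<longrightarrow> (\<forall>w. e w \<le> t) \<longrightarrow> trm_val X e s \<le> (t + 2) ^ c"
proof (induction s)
  case (Var w)
  have "e w \<le> (t + 2) ^ 1" if "\<forall>w. e w \<le> t" for e :: "nat \<Rightarrow> nat" and t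
    using that[THEN spec, of w] by simp
  then show ?case by (intro exI[of _ 1]) simp
next
  case (SucT s)
  then obtain c where c: "\<And>X e t. \<forall>i. X i \<le> 1 \<Longrightarrow> \<forall>w. e w \<le> t \<Longrightarrow> trm_val X e s \<le> (t + 2) ^ c" by blast
  show ?case
  proof (intro exI[of _ "c + 0 + 1"] allI impI)
    fix X e :: "nat \<Rightarrow> nat" and t assume "\<forall>i. X i \<le> 1" "\<forall>w. e w \<le> t"
    from c[OF this] power_sum_le[of "t + 2" c 0]
    show "trm_val X e (SucT s) \<le> (t + 2) ^ (c + 0 + 1)" by simp
  qed
next
  case (Add s1 s2)
  then obtain c d where c: "\<And>X e t. \<forall>i. X i \<le> 1 \<Longrightarrow> \<forall>w. e w \<le> t \<Longrightarrow> trm_val X e s1 \<le> (t + 2) ^ c"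
    and d: "\<And>X e t. \<forall>i. X i \<le> 1 \<Longrightarrow> \<forall>w. e w \<le> t \<Longrightarrow> trm_val X e s2 \<le> (t + 2) ^ d" by blast
  show ?case
  proof (intro exI[of _ "c + d + 1"] allI impI)
    fix X e :: "nat \<Rightarrow> nat" and t assume "\<forall>i. X i \<le> 1" "\<forall>w. e w \<le> t"
    from c[OF this] d[OF this] power_sum_le[of "t + 2" c d]
    show "trm_val X e (Add s1 s2) \<le> (t + 2) ^ (c + d + 1)" by simp
  qed
next
  case (Mult s1 s2)
  then obtain c d where c: "\<And>X e t. \<forall>i. X i \<le> 1 \<Longrightarrow> \<forall>w. e w \<le> t \<Longrightarrow> trm_val X e s1 \<le> (t + 2) ^ c"
    and d: "\<And>X e t. \<forall>i. X i \<le> 1 \<Longrightarrow> \<forall>w. e w \<le> t \<Longrightarrow> trm_val X e s2 \<le> (t + 2) ^ d" by blast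
  show ?case
    by (intro exI[of _ "c + d"] allI impI) (simp add: power_add mult_le_mono c d del: add_2_eq_Suc')
next
  case (FunApp s)
  show ?case by (intro exI[of _ 0]) simp
qed simp

definition agree :: "(nat \<Rightarrow> nat) \<Rightarrow> (nat \<Rightarrow> nat) \<Rightarrow> nat \<Rightarrow> bool" where
  "agree X Y N \<longleftrightarrow> (\<forall>i. X i \<le> 1) \<and> (\<forall>i. Y i \<le> 1) \<and> (\<forall>i<N. X i = Y i)"

lemma agree_mono: "agree X Y N \<Longrightarrow> M \<le> N \<Longrightarrow> agree X Y M"
  by (simp add: agree_def)

text \<open>The use of an oracle computation, measured by a power of t + 2. The exponent belongs to
  the formula alone, so the bound is a computable function of t.\<close>

definition uses :: "nat \<Rightarrow> ((nat \<Rightarrow> nat) \<Rightarrow> (nat \<Rightarrow> nat) \<Rightarrow> 'a) \<Rightarrow> bool" where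
  "uses c F \<longleftrightarrow> (\<forall>X Y e t. agree X Y ((t + 2) ^ c) \<longrightarrow> (\<forall>w. e w \<le> t) \<longrightarrow> F X e = F Y e)"

lemma usesD: "uses c F \<Longrightarrow> agree X Y ((t + 2) ^ c) \<Longrightarrow> \<forall>w. e w \<le> t \<Longrightarrow> F X e = F Y e"
  unfolding uses_def by blast

lemma uses_mono: "uses c F \<Longrightarrow> c \<le> d \<Longrightarrow> uses d F"
proof -
  assume c: "uses c F" and "c \<le> d"
  then have "(t + 2) ^ c \<le> (t + 2) ^ d" for t :: nat by (intro power_increasing) simp_all
  then show ?thesis unfolding uses_def using usesD[OF c] agree_mono by blast
qed

lemma uses_combine:
  assumes "uses c F" "uses d G"
  shows "uses (c + d) (\<lambda>X e. h (F X e) (G X e))"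
  using usesD[OF uses_mono[OF assms(1), of "c + d"]] usesD[OF uses_mono[OF assms(2), of "c + d"]]
  unfolding uses_def by fastforce

text \<open>Pairing the bound with the truth set below it treats both bounded quantifiers at once.
  The enlarged environment is bounded by t' = (t + 2)^(b + 1), and t' + 2 \<le> (t + 2)^(b + 2),
  whence the exponent (b + 2) d.\<close>

lemma uses_quantifier:
  assumes s: "uses c (\<lambda>X e. trm_val X e s)"
    and bound: "\<And>X e t. \<forall>i. X i \<le> 1 \<Longrightarrow> \<forall>w. e w \<le> t \<Longrightarrow> trm_val X e s \<le> (t + 2) ^ b"
    and \<phi>: "uses d (\<lambda>X e. sat X e \<phi>)"
  shows "uses (c + (b + 2) * d) (\<lambda>X e. (trm_val X e s, \<lambda>k. k < trm_val X e s \<and> sat X (e(u := k)) \<phi>))"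
  unfolding uses_def prod.inject
proof (intro allI impI conjI ext)
  fix X Y e :: "nat \<Rightarrow> nat" and t assume a: "agree X Y ((t + 2) ^ (c + (b + 2) * d))" and e: "\<forall>w. e w \<le> t"
  show eq: "trm_val X e s = trm_val Y e s"
    using usesD[OF uses_mono[OF s, of "c + (b + 2) * d"] a e] by simp
  fix k
  have "sat X (e(u := k)) \<phi> = sat Y (e(u := k)) \<phi>" if k: "k < trm_val X e s"
  proof -
    define t' where "t' = (t + 2) ^ (b + 1)"
    have t': "t + 2 \<le> t'" unfolding t'_def using power_increasing[of 1 "b + 1" "t + 2"] by simp
    have "trm_val X e s \<le> (t + 2) ^ b" using bound e a by (simp add: agree_def)
    also have "(t + 2) ^ b \<le> t'" unfolding t'_def by (rule power_increasing) simp_all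
    finally have "k \<le> t'" using k by simp
    moreover have "e w \<le> t'" for w using e[THEN spec, of w] t' by linarith
    ultimately have e': "\<forall>w. (e(u := k)) w \<le> t'" by simp
    have "t' + 2 \<le> t' + t'" using t' by simp
    also have "\<dots> \<le> (t + 2) * t'" by simp
    also have "\<dots> = (t + 2) ^ (b + 2)" by (simp add: t'_def)
    finally have "(t' + 2) ^ d \<le> ((t + 2) ^ (b + 2)) ^ d" by (rule power_mono) simp
    also have "\<dots> = (t + 2) ^ ((b + 2) * d)" by (rule power_mult[symmetric])
    also have "\<dots> \<le> (t + 2) ^ (c + (b + 2) * d)" by (rule power_increasing) simp_all
    finally show ?thesis using usesD[OF \<phi> agree_mono[OF a] e'] by blast
  qed
  then show "(k < trm_val X e s \<and> sat X (e(u := k)) \<phi>) = (k < trm_val Y e s \<and> sat Y (e(u := k)) \<phi>)"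
    unfolding eq[symmetric] by blast
qed

lemma trm_uses: "\<exists>c. uses c (\<lambda>X e. trm_val X e s)"
proof (induction s)
  case (FunApp s)
  then obtain c where c: "uses c (\<lambda>X e. trm_val X e s)" by blast
  obtain b where b: "\<And>X e t. \<forall>i. X i \<le> 1 \<Longrightarrow> \<forall>w. e w \<le> t \<Longrightarrow> trm_val X e s \<le> (t + 2) ^ b"
    using trm_bound[of s] by blast
  have "uses (c + (b + 1)) (\<lambda>X e. trm_val X e (FunApp s))"
    unfolding uses_def
  proof (intro allI impI)
    fix X Y e :: "nat \<Rightarrow> nat" and t assume a: "agree X Y ((t + 2) ^ (c + (b + 1)))" and e: "\<forall>w. e w \<le> t"
    have "trm_val X e s \<le> (t + 2) ^ b" using b e a by (simp add: agree_def)
    also have "\<dots> < (t + 2) ^ (c + (b + 1))" by (rule power_strict_increasing) simp_all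
    finally have "X (trm_val X e s) = Y (trm_val X e s)" using a by (simp add: agree_def)
    then show "trm_val X e (FunApp s) = trm_val Y e (FunApp s)"
      using usesD[OF uses_mono[OF c, of "c + (b + 1)"] a e] by simp
  qed
  then show ?case by blast
next
  case (SucT s)
  then obtain c where "uses c (\<lambda>X e. trm_val X e s)" by blast
  from uses_combine[OF this this, of "\<lambda>x y. Suc x"] show ?case by auto
next
  case (Add s1 s2)
  then obtain c d where "uses c (\<lambda>X e. trm_val X e s1)" "uses d (\<lambda>X e. trm_val X e s2)" by blast
  from uses_combine[OF this, of "(+)"] show ?case by auto
next
  case (Mult s1 s2)
  then obtain c d where "uses c (\<lambda>X e. trm_val X e s1)" "uses d (\<lambda>X e. trm_val X e s2)" by blast
  from uses_combine[OF this, of "(*)"] show ?case by auto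
qed (auto simp: uses_def)

text \<open>
  The function variable only takes the values 0 and 1, so the positions at which a bounded
  formula inspects it are bounded by a polynomial in the values of the number variables.
\<close>

lemma sat_uses: "bounded_fm \<theta> \<Longrightarrow> \<exists>c. uses c (\<lambda>X e. sat X e \<theta>)"
proof (induction \<theta>)
  case (Eq s1 s2)
  obtain c d where "uses c (\<lambda>X e. trm_val X e s1)" "uses d (\<lambda>X e. trm_val X e s2)" using trm_uses by blast
  from uses_combine[OF this, of "(=)"] show ?case by auto
next
  case (Less s1 s2)
  obtain c d where "uses c (\<lambda>X e. trm_val X e s1)" "uses d (\<lambda>X e. trm_val X e s2)" using trm_uses by blast
  from uses_combine[OF this, of "(<)"] show ?case by auto
next
  case (Neg \<phi>)
  then show ?case by (simp add: uses_def)
next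
  case (Conj \<phi> \<psi>)
  then obtain c d where "uses c (\<lambda>X e. sat X e \<phi>)" "uses d (\<lambda>X e. sat X e \<psi>)" by auto
  from uses_combine[OF this, of "(\<and>)"] show ?case by auto
next
  case (Disj \<phi> \<psi>)
  then obtain c d where "uses c (\<lambda>X e. sat X e \<phi>)" "uses d (\<lambda>X e. sat X e \<psi>)" by auto
  from uses_combine[OF this, of "(\<or>)"] show ?case by auto
next
  case (BAll u s \<phi>)
  obtain b where b: "\<And>X e t. \<forall>i. X i \<le> 1 \<Longrightarrow> \<forall>w. e w \<le> t \<Longrightarrow> trm_val X e s \<le> (t + 2) ^ b"
    using trm_bound[of s] by blast
  obtain c d where "uses c (\<lambda>X e. trm_val X e s)" "uses d (\<lambda>X e. sat X e \<phi>)"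
    using trm_uses[of s] BAll by auto
  from uses_quantifier[OF this(1) b this(2), of u]
  have q: "uses (c + (b + 2) * d) (\<lambda>X e. (trm_val X e s, \<lambda>k. k < trm_val X e s \<and> sat X (e(u := k)) \<phi>))" .
  have "uses (c + (b + 2) * d) (\<lambda>X e. sat X e (BAll u s \<phi>))"
    unfolding uses_def
  proof (intro allI impI)
    fix X Y e :: "nat \<Rightarrow> nat" and t assume "agree X Y ((t + 2) ^ (c + (b + 2) * d))" "\<forall>w. e w \<le> t"
    from usesD[OF q this] show "sat X e (BAll u s \<phi>) = sat Y e (BAll u s \<phi>)"
      unfolding prod.inject fun_eq_iff sat.simps by metis
  qed
  then show ?case by blast
next
  case (BEx u s \<phi>)
  obtain b where b: "\<And>X e t. \<forall>i. X i \<le> 1 \<Longrightarrow> \<forall>w. e w \<le> t \<Longrightarrow> trm_val X e s \<le> (t + 2) ^ b"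
    using trm_bound[of s] by blast
  obtain c d where "uses c (\<lambda>X e. trm_val X e s)" "uses d (\<lambda>X e. sat X e \<phi>)"
    using trm_uses[of s] BEx by auto
  from uses_quantifier[OF this(1) b this(2), of u]
  have q: "uses (c + (b + 2) * d) (\<lambda>X e. (trm_val X e s, \<lambda>k. k < trm_val X e s \<and> sat X (e(u := k)) \<phi>))" .
  have "uses (c + (b + 2) * d) (\<lambda>X e. sat X e (BEx u s \<phi>))"
    unfolding uses_def
  proof (intro allI impI)
    fix X Y e :: "nat \<Rightarrow> nat" and t assume "agree X Y ((t + 2) ^ (c + (b + 2) * d))" "\<forall>w. e w \<le> t"
    from usesD[OF q this] show "sat X e (BEx u s \<phi>) = sat Y e (BEx u s \<phi>)"
      unfolding prod.inject fun_eq_iff sat.simps by metis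
  qed
  then show ?case by blast
qed simp_all

lemma computable_upd:
  assumes "\<And>w. computable_list n (\<lambda>xs. e xs w)" "computable_list n k"
  shows "computable_list n (\<lambda>xs. ((e xs)(u := k xs)) w)"
  using assms by (cases "w = u") simp_all

lemma computable_trm_val:
  assumes "\<And>w. computable_list n (\<lambda>xs. e xs w)" "computable_list n a" "computable_list n l"
  shows "computable_list n (\<lambda>xs. trm_val (dyadic_name (a xs) (l xs)) (e xs) s)"
  by (induction s) (simp_all add: assms computable_const computable_Suc computable_add computable_mult computable_dyadic_name)

text \<open>One program is built for each formula, by induction on it. The environment is a family
  of computable functions, so that quantified variables can be added to it.\<close>

lemma decidable_sat:
  assumes "bounded_fm \<theta>" "\<And>w. computable_list n (\<lambda>xs. e xs w)" "computable_list n a" "computable_list n l"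
  shows "decidable_list n (\<lambda>xs. sat (dyadic_name (a xs) (l xs)) (e xs) \<theta>)"
  using assms
proof (induction \<theta> arbitrary: n e a l)
  case (BAll u s \<phi>)
  have "decidable_list (Suc n) (\<lambda>ys. sat (dyadic_name (a (tl ys)) (l (tl ys))) ((e (tl ys))(u := hd ys)) \<phi>)"
    using BAll.prems by (intro BAll.IH computable_upd computable_hd computable_weaken) simp_all
  then show ?case unfolding sat.simps
    by (intro decidable_ball computable_trm_val BAll.prems)
next
  case (BEx u s \<phi>)
  have "decidable_list (Suc n) (\<lambda>ys. sat (dyadic_name (a (tl ys)) (l (tl ys))) ((e (tl ys))(u := hd ys)) \<phi>)"
    using BEx.prems by (intro BEx.IH computable_upd computable_hd computable_weaken) simp_all
  then show ?case unfolding sat.simps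
    by (intro decidable_bex computable_trm_val BEx.prems)
qed (auto intro!: decidable_eq decidable_less decidable_not decidable_conj decidable_disj computable_trm_val)

text \<open>
  Task \<open>t\<close> codes a quadruple \<open>(r, i, j, l)\<close>. It is genuine if \<open>l\<close> is the first stage at which
  the failure of \<open>\<exists>y. \<forall>z. \<theta>\<close>, with \<open>i\<close> for the outermost variable, has been confirmed for all
  \<open>y \<le> j\<close>. Hence, for given \<open>r\<close> and \<open>i\<close>, infinitely many tasks are genuine iff it fails.
\<close>

definition "task_r t = fst (prod_decode t)"
definition "task_i t = fst (prod_decode (snd (prod_decode t)))"
definition "task_j t = fst (prod_decode (snd (prod_decode (snd (prod_decode t)))))"
definition "task_l t = snd (prod_decode (snd (prod_decode (snd (prod_decode t)))))"

definition task_code :: "nat \<Rightarrow> nat \<Rightarrow> nat \<Rightarrow> nat \<Rightarrow> nat" where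
  "task_code r i j l = prod_encode (r, prod_encode (i, prod_encode (j, l)))"

lemma task_code [simp]:
  "task_r (task_code r i j l) = r" "task_i (task_code r i j l) = i"
  "task_j (task_code r i j l) = j" "task_l (task_code r i j l) = l"
  by (simp_all add: task_r_def task_i_def task_j_def task_l_def task_code_def)

lemma task_code_of: "task_code (task_r t) (task_i t) (task_j t) (task_l t) = t"
  by (simp add: task_r_def task_i_def task_j_def task_l_def task_code_def)

lemma task_code_ge: "r \<le> task_code r i j l" "i \<le> task_code r i j l" "j \<le> task_code r i j l" "l \<le> task_code r i j l"
proof -
  have "prod_encode (j, l) \<le> prod_encode (i, prod_encode (j, l))"
    "prod_encode (i, prod_encode (j, l)) \<le> task_code r i j l"
    unfolding task_code_def by (rule le_prod_encode_2)+
  moreover have "j \<le> prod_encode (j, l)" "l \<le> prod_encode (j, l)" "i \<le> prod_encode (i, prod_encode (j, l))"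
    "r \<le> task_code r i j l"
    unfolding task_code_def by (rule le_prod_encode_1 le_prod_encode_2)+
  ultimately show "r \<le> task_code r i j l" "i \<le> task_code r i j l" "j \<le> task_code r i j l" "l \<le> task_code r i j l"
    by linarith+
qed

lemma task_components_le: "task_r t \<le> t" "task_i t \<le> t" "task_j t \<le> t" "task_l t \<le> t"
  by (metis task_code_of task_code_ge)+

lemma computable_task:
  assumes "computable_list n t"
  shows "computable_list n (\<lambda>xs. task_r (t xs))" "computable_list n (\<lambda>xs. task_i (t xs))"
    "computable_list n (\<lambda>xs. task_j (t xs))" "computable_list n (\<lambda>xs. task_l (t xs))"
  unfolding task_r_def task_i_def task_j_def task_l_def by (intro computable_intros assms)+

locale formula_search =
  fixes \<theta> :: fm and v x y z c :: nat
  assumes bounded: "bounded_fm \<theta>" and \<theta>_uses: "uses c (\<lambda>X e. sat X e \<theta>)"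
begin

text \<open>The updates follow the order in which \<open>sat\<close> passes the quantifiers, so
  coinciding variable names are treated alike.\<close>

definition env :: "nat \<Rightarrow> nat \<Rightarrow> nat \<Rightarrow> nat \<Rightarrow> nat \<Rightarrow> nat" where
  "env r i j l = (((\<lambda>_. 0)(v := r))(x := i, y := j, z := l))"

definition refuted :: "(nat \<Rightarrow> nat) \<Rightarrow> nat \<Rightarrow> nat \<Rightarrow> nat \<Rightarrow> nat \<Rightarrow> bool" where
  "refuted X r i j l \<longleftrightarrow> (\<forall>j'\<le>j. \<exists>l'\<le>l. \<not> sat X (env r i j' l') \<theta>)"

definition genuine :: "(nat \<Rightarrow> nat) \<Rightarrow> nat \<Rightarrow> bool" where
  "genuine X t \<longleftrightarrow> task_r t \<in> minimal_bases \<and> refuted X (task_r t) (task_i t) (task_j t) (task_l t) \<and>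
     (task_l t = 0 \<or> \<not> refuted X (task_r t) (task_i t) (task_j t) (task_l t - 1))"

definition wanted_base :: "(nat \<Rightarrow> nat) \<Rightarrow> nat \<Rightarrow> nat" where
  "wanted_base X t = (if genuine X t then task_r t else 2)"

text \<open>The level of a genuine task depends on i only, so that one and the same bias can recur.
  The other tasks use base 2 with levels tending to infinity, which does not endanger normality to
  base 2.\<close>

definition wanted_level :: "(nat \<Rightarrow> nat) \<Rightarrow> nat \<Rightarrow> nat" where
  "wanted_level X t = (if genuine X t then task_i t + 1 else t + 1)"

text \<open>All components of the task are at most t, so the use bound at t covers every instance of
  \<theta> that enters.\<close>

lemma genuine_agree:
  assumes "agree X Y ((t + 2) ^ c)"
  shows "genuine X t \<longleftrightarrow> genuine Y t"
proof -
  have "sat X (env (task_r t) (task_i t) j' l') \<theta> = sat Y (env (task_r t) (task_i t) j' l') \<theta>"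
    if "j' \<le> t" "l' \<le> t" for j' l'
    using usesD[OF \<theta>_uses assms] that task_components_le by (simp add: env_def)
  then have "refuted X (task_r t) (task_i t) (task_j t) l = refuted Y (task_r t) (task_i t) (task_j t) l"
    if "l \<le> t" for l
    unfolding refuted_def using that task_components_le(3)[of t] by (meson order_trans)
  moreover have "task_l t \<le> t" "task_l t - 1 \<le> t" using task_components_le(4)[of t] by simp_all
  ultimately show ?thesis unfolding genuine_def by simp
qed

lemma computable_env:
  assumes "computable_list n r" "computable_list n i" "computable_list n j" "computable_list n l"
  shows "computable_list n (\<lambda>xs. env (r xs) (i xs) (j xs) (l xs) w)"
  unfolding env_def by (intro computable_upd computable_const assms)

lemma decidable_refuted:
  assumes "computable_list n a" "computable_list n b" "computable_list n r" "computable_list n i"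
    "computable_list n j" "computable_list n l"
  shows "decidable_list n (\<lambda>xs. refuted (dyadic_name (a xs) (b xs)) (r xs) (i xs) (j xs) (l xs))"
  unfolding refuted_def
  by (intro decidable_ball_le decidable_bex_le decidable_not decidable_sat bounded computable_env computable_vars
      assms assms[THEN computable_weaken] assms[THEN computable_weaken, THEN computable_weaken])

lemma decidable_genuine:
  assumes "computable_list n a" "computable_list n b" "computable_list n t"
  shows "decidable_list n (\<lambda>xs. genuine (dyadic_name (a xs) (b xs)) (t xs))"
  unfolding genuine_def
  by (intro computable_intros decidable_minimal_bases decidable_refuted computable_task assms)

sublocale computable_search "\<lambda>a n. wanted_base (dyadic_name a n)" "\<lambda>a n. wanted_level (dyadic_name a n)"
  "\<lambda>t. (t + 2) ^ c"
proof
  fix a n t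
  show "wanted_base (dyadic_name a n) t \<in> minimal_bases"
    by (simp add: wanted_base_def genuine_def two_minimal)
  show "1 \<le> wanted_level (dyadic_name a n) t" "wanted_level (dyadic_name a n) t \<le> t + 1"
    using task_components_le(2)[of t] by (simp_all add: wanted_level_def)
next
  fix m a n t assume c: "computable_list m a" "computable_list m n" "computable_list m t"
  show "computable_list m (\<lambda>xs. wanted_base (dyadic_name (a xs) (n xs)) (t xs))"
    unfolding wanted_base_def by (intro computable_intros decidable_genuine computable_task c)
  show "computable_list m (\<lambda>xs. wanted_level (dyadic_name (a xs) (n xs)) (t xs))"
    unfolding wanted_level_def by (intro computable_intros decidable_genuine computable_task c)
next
  fix m and t :: "nat list \<Rightarrow> nat" assume "computable_list m t"
  then show "computable_list m (\<lambda>xs. (t xs + 2) ^ c)" by (intro computable_intros)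
qed

lemma dyadic_name_le_1: "dyadic_name a n i \<le> 1"
proof -
  have "q mod 2 \<le> 1" for q :: nat using mod_less_divisor[of 2 q] by linarith
  then show ?thesis unfolding dyadic_name_def by (cases "i = 0") (simp_all only: if_True if_False zero_le_one refl)
qed

lemma agree_limit: "agree (dyadic_name (num i) (len i)) (real_name limit) ((task i + 2) ^ c)"
proof -
  have "real_name limit j \<le> 1" for j
    unfolding real_name_limit[OF len_ge] by (rule dyadic_name_le_1)
  moreover have "dyadic_name (num i) (len i) j = real_name limit j" if "j < (task i + 2) ^ c" for j
    using real_name_limit[of j i] use_bound_le_len[of i] that by simp
  ultimately show ?thesis using dyadic_name_le_1 by (simp add: agree_def)
qed

text \<open>By the agreement at every step, decisions taken on approximations are those for the
  limit itself.\<close>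

sublocale stable_search "\<lambda>a n. wanted_base (dyadic_name a n)" "\<lambda>a n. wanted_level (dyadic_name a n)"
  "\<lambda>t. (t + 2) ^ c" "wanted_base (real_name limit)" "wanted_level (real_name limit)"
  by unfold_locales (simp_all only: wanted_base_def wanted_level_def genuine_agree[OF agree_limit])

lemma refuted_mono: "refuted X r i j l \<Longrightarrow> l \<le> l' \<Longrightarrow> refuted X r i j l'"
  unfolding refuted_def using order_trans by blast

lemma genuine_Least:
  assumes "r \<in> minimal_bases" "refuted X r i j l"
  shows "genuine X (task_code r i j (LEAST l. refuted X r i j l))"
proof -
  let ?l = "LEAST l. refuted X r i j l"
  have "refuted X r i j ?l" using assms(2) by (rule LeastI)
  moreover have "\<not> refuted X r i j (?l - 1)" if "?l \<noteq> 0"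
    using not_less_Least[of "?l - 1" "refuted X r i j"] that by simp
  ultimately show ?thesis using assms(1) unfolding genuine_def task_code by blast
qed

text \<open>Minimality makes l a function of r, i and j, so finitely many pairs (i, j) give finitely
  many genuine tasks for r.\<close>

lemma genuine_Least_eq:
  assumes "genuine X (task_code r i j l)"
  shows "l = (LEAST l. refuted X r i j l)"
proof (rule Least_equality[symmetric])
  show "refuted X r i j l" using assms by (simp add: genuine_def)
  fix l' assume l': "refuted X r i j l'"
  show "l \<le> l'"
  proof (rule ccontr)
    assume "\<not> l \<le> l'"
    then have "l \<noteq> 0" "l' \<le> l - 1" by auto
    then show False using refuted_mono[OF l'] assms unfolding genuine_def task_code by blast
  qed
qed

text \<open>If i is a counterexample, then every j yields a genuine task of level i + 1 with a code
  of at least j, so this level recurs. If j = J i works, refutations for i exist only for j < J i,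
  so each level is wanted only finitely often in base r.\<close>

lemma limit_correct:
  assumes r: "r \<in> minimal_bases"
  shows "(\<forall>i. \<exists>j. \<forall>l. sat (real_name limit) (env r i j l) \<theta>) \<longleftrightarrow> normal_to_base r limit"
proof
  let ?X = "real_name limit"
  assume "normal_to_base r limit"
  show "\<forall>i. \<exists>j. \<forall>l. sat ?X (env r i j l) \<theta>"
  proof (rule ccontr)
    assume "\<not> ?thesis"
    then obtain i where "\<forall>j. \<exists>l. \<not> sat ?X (env r i j l) \<theta>" by blast
    from choice[OF this] obtain L where L: "\<forall>j. \<not> sat ?X (env r i j (L j)) \<theta>" by blast
    have "\<exists>t\<ge>T. wanted_base ?X t = r \<and> wanted_level ?X t = i + 1" for T
    proof -
      have "refuted ?X r i T (Max (L ` {..T}))"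
        unfolding refuted_def
      proof (intro allI impI)
        fix j assume "j \<le> T"
        then show "\<exists>l'\<le>Max (L ` {..T}). \<not> sat ?X (env r i j l') \<theta>"
          using L by (intro exI[of _ "L j"]) simp
      qed
      from genuine_Least[OF r this] show ?thesis
        using task_code_ge(3) by (intro exI[of _ "task_code r i T (LEAST l. refuted ?X r i T l)"])
          (simp add: wanted_base_def wanted_level_def)
    qed
    then have "\<not> normal_to_base r limit" by (rule limit_not_normal[OF r _ le_add2])
    then show False using \<open>normal_to_base r limit\<close> by contradiction
  qed
next
  let ?X = "real_name limit"
  assume "\<forall>i. \<exists>j. \<forall>l. sat ?X (env r i j l) \<theta>"
  from choice[OF this] obtain J where J: "\<forall>i l. sat ?X (env r i (J i) l) \<theta>" by blast
  show "normal_to_base r limit"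
  proof (rule limit_normal[OF r])
    fix m
    define S where "S = (\<lambda>(i, j). task_code r i j (LEAST l. refuted ?X r i j l)) ` (SIGMA i:{..<m}. {..<J i})"
    have fin: "finite S" unfolding S_def by (intro finite_imageI finite_SigmaI) auto
    show "\<exists>T. \<forall>t\<ge>T. wanted_base ?X t = r \<longrightarrow> m \<le> wanted_level ?X t"
    proof (intro exI[of _ "m + Suc (Max (insert 0 S))"] allI impI)
      fix t assume t: "m + Suc (Max (insert 0 S)) \<le> t" and b: "wanted_base ?X t = r"
      show "m \<le> wanted_level ?X t"
      proof (cases "genuine ?X t")
        case False
        then show ?thesis using t by (simp add: wanted_level_def)
      next
        case True
        then have tr: "task_r t = r" using b by (simp add: wanted_base_def)
        define i j l where "i = task_i t" and "j = task_j t" and "l = task_l t"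
        have code: "t = task_code r i j l" using task_code_of[of t] by (simp add: tr i_def j_def l_def)
        have g: "genuine ?X (task_code r i j l)" using True code by simp
        then have "refuted ?X r i j l" by (simp add: genuine_def)
        then have "j < J i" using J unfolding refuted_def by (meson not_less)
        have "\<not> i < m"
        proof
          assume "i < m"
          then have "t \<in> S"
            unfolding S_def code genuine_Least_eq[OF g] using \<open>j < J i\<close>
            by (intro image_eqI[of _ _ "(i, j)"]) auto
          then have "t \<le> Max (insert 0 S)" using fin by (intro Max_ge) auto
          then show False using t by simp
        qed
        then show ?thesis using True by (simp add: wanted_level_def i_def)
      qed
    qed
  qed
qed

end

theorem theorem3:
  fixes \<phi> :: fm and v :: nat
  assumes "Pi03 \<phi>" and "free_vars \<phi> \<subseteq> {v}"
  shows "\<exists>\<xi>::real. computable_real \<xi> \<and>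
    (\<forall>r \<in> minimal_bases.
       sat (real_name \<xi>) ((\<lambda>_. 0)(v := r)) \<phi> \<longleftrightarrow> normal_to_base r \<xi>)"
proof -
  obtain x y z \<theta> where \<phi>: "\<phi> = UAll x (UEx y (UAll z \<theta>))" and \<theta>: "bounded_fm \<theta>"
    using assms(1) by (auto simp: Pi03_def)
  obtain c where c: "uses c (\<lambda>X e. sat X e \<theta>)" using sat_uses[OF \<theta>] by blast
  interpret formula_search \<theta> v x y z c by unfold_locales fact+
  have "sat (real_name limit) ((\<lambda>_. 0)(v := r)) \<phi> \<longleftrightarrow> normal_to_base r limit"
    if "r \<in> minimal_bases" for r
    using limit_correct[OF that] by (simp add: \<phi> env_def)
  then show ?thesis using computable_real_limit by blast
qed

end
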